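(* Let $t \geq 2$ be an integer and $G$ a graph. If $G$ contains no odd $K_t$ minor and $G$ contains a bipartite $K_{2t-2}+I_t$ subdivision, then there is $X \subseteq V(G)$ with $|X| \leq 2t-4$ such that $G \setminus X$ has a bipartite block with at least $t+3$ vertices.
   Context: All graphs are finite and simple. $K_s + I_t$ is the graph obtained from the disjoint union of $K_s$ and the edgeless graph $I_t$ on $t$ vertices by joining every vertex of $K_s$ to every vertex of $I_t$. A graph contains a bipartite $H$ subdivision if it has a subgraph that is bipartite and is obtained from $H$ by replacing edges by internally disjoint paths. A block is a maximal connected subgraph without a cut vertex. A graph $G$ contains $K_t$ as an odd minor if there exist vertex-disjoint trees $\{T_u\}_{u\in V(K_t)}$ in $G$ and a coloring $\alpha:\bigcup_u V(T_u)\to\{1,2\}$ such that every edge of each $T_u$ has ends of different colors and for every pair $v\ne w$ there is an edge of $G$ joining $V(T_v)$ and $V(T_w)$ whose ends have the same color. *)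

theory Defs
  imports Main
begin

definition graph :: "'a set \<Rightarrow> 'a set set \<Rightarrow> bool" where
  "graph V E \<longleftrightarrow> finite V \<and> (\<forall>e\<in>E. \<exists>u v. e = {u, v} \<and> u \<noteq> v \<and> u \<in> V \<and> v \<in> V)"

definition subgraph :: "'a set \<Rightarrow> 'a set set \<Rightarrow> 'a set \<Rightarrow> 'a set set \<Rightarrow> bool" where
  "subgraph V' E' V E \<longleftrightarrow> graph V' E' \<and> V' \<subseteq> V \<and> E' \<subseteq> E"

definition bipartite :: "'a set \<Rightarrow> 'a set set \<Rightarrow> bool" where
  "bipartite V E \<longleftrightarrow> (\<exists>f :: 'a \<Rightarrow> bool. \<forall>u\<in>V. \<forall>v\<in>V. {u, v} \<in> E \<longrightarrow> f u \<noteq> f v)"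

definition connected :: "'a set \<Rightarrow> 'a set set \<Rightarrow> bool" where
  "connected V E \<longleftrightarrow> V \<noteq> {} \<and>
     (\<forall>u\<in>V. \<forall>v\<in>V. (\<lambda>x y. {x, y} \<in> E)\<^sup>*\<^sup>* u v)"

definition del_verts_E :: "'a set set \<Rightarrow> 'a set \<Rightarrow> 'a set set" where
  "del_verts_E E X = {e\<in>E. e \<inter> X = {}}"

definition is_path :: "'a set \<Rightarrow> 'a set set \<Rightarrow> 'a list \<Rightarrow> bool" where
  "is_path V E p \<longleftrightarrow> p \<noteq> [] \<and> distinct p \<and> set p \<subseteq> V \<and>
     (\<forall>i. Suc i < length p \<longrightarrow> {p ! i, p ! Suc i} \<in> E)"

definition path_edges :: "'a list \<Rightarrow> 'a set set" where
  "path_edges p = {{p ! i, p ! Suc i} | i. Suc i < length p}"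

definition interior :: "'a list \<Rightarrow> 'a set" where
  "interior p = set (butlast (tl p))"

definition is_cycle :: "'a set \<Rightarrow> 'a set set \<Rightarrow> 'a list \<Rightarrow> bool" where
  "is_cycle V E c \<longleftrightarrow> length c \<ge> 3 \<and> is_path V E c \<and> {last c, hd c} \<in> E"

definition is_tree :: "'a set \<Rightarrow> 'a set set \<Rightarrow> bool" where
  "is_tree V E \<longleftrightarrow> graph V E \<and> connected V E \<and> \<not> (\<exists>c. is_cycle V E c)"

definition no_cut_vertex :: "'a set \<Rightarrow> 'a set set \<Rightarrow> bool" where
  "no_cut_vertex B F \<longleftrightarrow>
     (\<forall>v\<in>B. B - {v} = {} \<or> connected (B - {v}) (del_verts_E F {v}))"

definition is_block :: "'a set \<Rightarrow> 'a set set \<Rightarrow> 'a set \<Rightarrow> 'a set set \<Rightarrow> bool" where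
  "is_block B F V E \<longleftrightarrow> subgraph B F V E \<and> connected B F \<and> no_cut_vertex B F \<and>
     \<not> (\<exists>B' F'. subgraph B' F' V E \<and> B \<subseteq> B' \<and> F \<subseteq> F' \<and> (B, F) \<noteq> (B', F') \<and>
           connected B' F' \<and> no_cut_vertex B' F')"

text \<open>The graph K_s + I_t on vertices {0..<s+t}: vertices < s form the clique,
  vertices \<ge> s the independent set.\<close>
definition KI_verts :: "nat \<Rightarrow> nat \<Rightarrow> nat set" where
  "KI_verts s t = {0..<s+t}"

definition KI_edges :: "nat \<Rightarrow> nat \<Rightarrow> nat set set" where
  "KI_edges s t = {{i, j} | i j. i \<in> KI_verts s t \<and> j \<in> KI_verts s t \<and> i \<noteq> j \<and> (i < s \<or> j < s)}"

definition bipartite_subdivision ::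
  "'a set \<Rightarrow> 'a set set \<Rightarrow> 'b set \<Rightarrow> 'b set set \<Rightarrow> bool" where
  "bipartite_subdivision V E VH EH \<longleftrightarrow>
     (\<exists>(phi :: 'b \<Rightarrow> 'a) (P :: 'b set \<Rightarrow> 'a list).
        inj_on phi VH \<and> phi ` VH \<subseteq> V \<and>
        (\<forall>e\<in>EH. is_path V E (P e) \<and> {hd (P e), last (P e)} = phi ` e \<and>
                  interior (P e) \<inter> phi ` VH = {}) \<and>
        (\<forall>e\<in>EH. \<forall>e'\<in>EH. e \<noteq> e' \<longrightarrow> interior (P e) \<inter> set (P e') = {}) \<and>
        bipartite (phi ` VH \<union> (\<Union>e\<in>EH. set (P e))) (\<Union>e\<in>EH. path_edges (P e)))"

definition odd_Kt_minor :: "'a set \<Rightarrow> 'a set set \<Rightarrow> nat \<Rightarrow> bool" where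
  "odd_Kt_minor V E t \<longleftrightarrow>
     (\<exists>(TV :: nat \<Rightarrow> 'a set) (TE :: nat \<Rightarrow> 'a set set) (alpha :: 'a \<Rightarrow> bool).
        (\<forall>u<t. subgraph (TV u) (TE u) V E \<and> is_tree (TV u) (TE u)) \<and>
        (\<forall>u<t. \<forall>w<t. u \<noteq> w \<longrightarrow> TV u \<inter> TV w = {}) \<and>
        (\<forall>u<t. \<forall>x y. {x, y} \<in> TE u \<longrightarrow> alpha x \<noteq> alpha y) \<and>
        (\<forall>u<t. \<forall>w<t. u \<noteq> w \<longrightarrow>
           (\<exists>x\<in>TV u. \<exists>y\<in>TV w. {x, y} \<in> E \<and> alpha x = alpha y)))"

end

theory Submission
  imports Defs
begin

text \<open>
  Let \<open>A\<close> be the set of all \<open>3t - 2\<close> branch vertices of the bipartite subdivision, 2-coloured by \<open>f\<close>. Call a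
  path between two vertices of \<open>A\<close> with no inner vertex in \<open>A\<close> breaking if its parity disagrees with \<open>f\<close>.
  Take two copies of \<open>G\<close>, join the copies of every vertex outside \<open>A\<close>, and keep only the copy \<open>(a, f a)\<close> of
  every \<open>a \<in> A\<close>. Augmenting the matching formed by the joins yields disjoint breaking paths, so the
  Tutte-Berge formula gives either \<open>t - 1\<close> disjoint breaking paths or a set \<open>X\<close> of at most \<open>2t - 4\<close>
  vertices meeting all of them.

  In the first case choose the paths with as few edges outside the subdivision as possible. They leave \<open>t\<close>
  branch vertices unused, and a subdivided edge from an unused branch vertex \<open>u\<close> to a path end \<open>w\<close> first
  meets the paths on the path ending in \<open>w\<close>, in a segment consistent with \<open>f\<close>. Attaching an unused branch
  vertex to the first end of each path, and recolouring every path alternately from that end, the subdivided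
  edges to the second ends contain monochromatic edges, which gives an odd \<open>K\<^sub>t\<close> minor.

  In the second case the subdivision minus \<open>X\<close> has a 2-connected bipartite part on at least \<open>t + 3\<close> vertices. It
  is enlarged by ears as long as possible; a parity breaking ear would extend to a breaking path avoiding
  \<open>X\<close>, so the final graph is a bipartite block.
\<close>

text \<open>The constants come from counting path ends. The \<open>t - 1\<close> breaking paths have
  \<open>2 * t - 2\<close> ends, so \<open>3 * t - 2\<close> branch vertices leave \<open>t\<close>
  of them as roots of trees. Deleting \<open>2 * t - 4\<close> vertices leaves at least
  \<open>t + 2\<close> branch vertices, and the one still missing is a subdividing vertex, because a
  bipartite graph has no triangle. Breaking paths create monochromatic edges because a path
  recoloured alternately from its first end agrees with \<open>f\<close> there and disagrees with
  \<open>f\<close> at its second end: an edge of the subdivision that enters it stays bichromatic or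
  becomes monochromatic accordingly. In the second case parity is controlled only between vertices
  of \<open>A\<close>, whereas a block of \<open>G - X\<close> may use edges far from
  \<open>A\<close>. Hence the growing bipartite graph has to keep disjoint connections from any two
  of its vertices to \<open>A\<close>.\<close>

section \<open>Matchings, Gallai's lemma and the Tutte-Berge formula\<close>

definition matching :: "'b set set \<Rightarrow> 'b set set \<Rightarrow> bool" where
  "matching D M \<longleftrightarrow> M \<subseteq> D \<and> pairwise disjnt M"

definition maximum_matching :: "'b set set \<Rightarrow> 'b set set \<Rightarrow> bool" where
  "maximum_matching D M \<longleftrightarrow> matching D M \<and> (\<forall>M'. matching D M' \<longrightarrow> card M' \<le> card M)"

lemma graph_edgeE:
  assumes "graph V E" "e \<in> E"
  obtains u v where "e = {u, v}" "u \<noteq> v" "u \<in> V" "v \<in> V"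
  using assms unfolding graph_def by blast

lemma graph_edge_subset: "graph V E \<Longrightarrow> e \<in> E \<Longrightarrow> e \<subseteq> V"
  by (erule graph_edgeE) auto

lemma graph_finite_edges:
  assumes "graph V E"
  shows "finite E"
proof (rule finite_subset)
  show "E \<subseteq> Pow V" using graph_edge_subset[OF assms] by auto
  show "finite (Pow V)" using assms unfolding graph_def by simp
qed

lemma graph_del_verts:
  assumes "graph V E"
  shows "graph (V - X) (del_verts_E E X)"
  unfolding graph_def
proof (intro conjI ballI)
  show "finite (V - X)" using assms unfolding graph_def by simp
  fix e assume "e \<in> del_verts_E E X"
  then have e: "e \<in> E" "e \<inter> X = {}" unfolding del_verts_E_def by auto
  obtain u v where "e = {u, v}" "u \<noteq> v" "u \<in> V" "v \<in> V" using graph_edgeE[OF assms e(1)] .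
  then show "\<exists>u v. e = {u, v} \<and> u \<noteq> v \<and> u \<in> V - X \<and> v \<in> V - X" using e(2) by auto
qed

lemma matching_finite: "graph Z D \<Longrightarrow> matching D M \<Longrightarrow> finite M"
  unfolding matching_def by (auto intro: finite_subset dest: graph_finite_edges)

lemma matching_Union:
  assumes "graph Z D" "matching D M"
  shows "\<Union>M \<subseteq> Z"
  using graph_edge_subset[OF assms(1)] assms(2) unfolding matching_def by blast

lemma card_matching_Union:
  assumes "graph Z D" "matching D M"
  shows "card (\<Union>M) = 2 * card M"
proof -
  have two: "finite e \<and> card e = 2" if "e \<in> M" for e
    using assms that unfolding matching_def graph_def by (metis card_2_iff finite.intros subset_iff)
  have "card (\<Union>M) = sum card M"
    using assms(2) two unfolding matching_def by (intro card_Union_disjoint) auto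
  then show ?thesis using two by simp
qed

lemma matching_insert:
  assumes "matching D M" "e \<in> D" "e \<inter> \<Union>M = {}"
  shows "matching D (insert e M)"
  using assms unfolding matching_def pairwise_insert disjnt_def by blast

lemma matching_subset: "matching D M \<Longrightarrow> M' \<subseteq> M \<Longrightarrow> matching D M'"
  unfolding matching_def using pairwise_subset by blast

lemma matching_unique: "matching D M \<Longrightarrow> e \<in> M \<Longrightarrow> e' \<in> M \<Longrightarrow> x \<in> e \<Longrightarrow> x \<in> e' \<Longrightarrow> e = e'"
  unfolding matching_def pairwise_def disjnt_def by blast

lemma maximum_matching_exists:
  assumes "graph Z D"
  obtains M where "maximum_matching D M"
proof -
  let ?P = "\<lambda>M. matching D M"
  have "?P {}" unfolding matching_def by simp
  moreover have "\<forall>M. ?P M \<longrightarrow> card M < Suc (card D)"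
    using graph_finite_edges[OF assms] unfolding matching_def by (auto simp: less_Suc_eq_le intro: card_mono)
  ultimately have "\<exists>M. ?P M \<and> (\<forall>M'. ?P M' \<longrightarrow> card M' \<le> card M)"
    using ex_has_greatest_nat[of ?P "{}" card "Suc (card D)"] by metis
  then show ?thesis using that unfolding maximum_matching_def by blast
qed

lemma maximum_matching_covers_edge:
  assumes "graph Z D" "maximum_matching D M" "e \<in> D"
  shows "e \<inter> \<Union>M \<noteq> {}"
proof
  assume none: "e \<inter> \<Union>M = {}"
  have M: "matching D M" using assms(2) unfolding maximum_matching_def by blast
  have "matching D (insert e M)" using matching_insert[OF M assms(3) none] .
  moreover have "e \<notin> M" using none graph_edgeE[OF assms(1,3)] by blast
  ultimately show False
    using assms(2) matching_finite[OF assms(1) M] unfolding maximum_matching_def by fastforce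
qed

text \<open>Gallai's lemma: the maximum matching \<open>N\<close> missing \<open>w\<close> is chosen closest to \<open>M\<close>, and can still be
  moved closer to \<open>M\<close>.\<close>

lemma gallai_transitive:
  assumes G: "graph Z D"
    and M: "maximum_matching D M" and miss: "u \<notin> \<Union>M" "v \<notin> \<Union>M" "u \<noteq> v"
    and ex: "maximum_matching D N0" "w \<notin> \<Union>N0"
    and uw: "\<And>N. maximum_matching D N \<Longrightarrow> u \<in> \<Union>N \<or> w \<in> \<Union>N"
    and wv: "\<And>N. maximum_matching D N \<Longrightarrow> w \<in> \<Union>N \<or> v \<in> \<Union>N"
  shows False
proof -
  let ?P = "\<lambda>N. maximum_matching D N \<and> w \<notin> \<Union>N"
  have mM: "matching D M" and finM: "finite M"
    using M matching_finite[OF G] unfolding maximum_matching_def by auto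
  have "\<forall>N. ?P N \<longrightarrow> card (M \<inter> N) < Suc (card M)"
    using finM by (auto simp: less_Suc_eq_le intro: card_mono)
  then obtain N where N: "?P N" and Nbest: "\<And>N'. ?P N' \<Longrightarrow> card (M \<inter> N') \<le> card (M \<inter> N)"
    using ex_has_greatest_nat[of ?P N0 "\<lambda>N. card (M \<inter> N)" "Suc (card M)"] ex
    by (metis (lifting))
  have mN: "matching D N" and finN: "finite N"
    using N matching_finite[OF G] unfolding maximum_matching_def by auto
  have card_eq: "card M = card N"
    using M N unfolding maximum_matching_def by (meson antisym)
  have fin: "finite (\<Union>M)" "finite (\<Union>N)"
    using matching_Union[OF G mM] matching_Union[OF G mN] G unfolding graph_def
    by (meson finite_subset)+
  have "card (\<Union>M) = card (\<Union>N)"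
    using card_matching_Union[OF G mM] card_matching_Union[OF G mN] card_eq by simp
  then have diff: "card (\<Union>M - \<Union>N) = card (\<Union>N - \<Union>M)"
    using fin by (simp add: card_Diff_subset_Int Int_commute)
  \<comment> \<open>\<open>N\<close> covers \<open>u\<close> and \<open>v\<close>, which
    \<open>M\<close> misses. Since both cover equally many vertices, at least two vertices are
    covered by \<open>M\<close> only, and one of them is not \<open>w\<close>.\<close>
  have "{u, v} \<subseteq> \<Union>N - \<Union>M" using uw wv N miss by blast
  then have "2 \<le> card (\<Union>N - \<Union>M)"
    using miss(3) fin by (metis card_2_iff card_mono finite_Diff)
  then have "\<not> \<Union>M - \<Union>N \<subseteq> {w}"
    using diff card_mono[of "{w}" "\<Union>M - \<Union>N"] by auto
  then obtain x e where x: "x \<in> e" "e \<in> M" "x \<notin> \<Union>N" "x \<noteq> w" by blast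
  have eD: "e \<in> D" using x mM unfolding matching_def by blast
  obtain y where e: "e = {x, y}" "x \<noteq> y"
    using graph_edgeE[OF G eD] x(1) by (metis insert_commute insertE singletonD)
  have "y \<in> \<Union>N" using maximum_matching_covers_edge[OF G _ eD, of N] N x e by blast
  then obtain e2 where e2: "e2 \<in> N" "y \<in> e2" by blast
  have e2M: "e2 \<notin> M" using matching_unique[OF mM x(2), of e2 y] e e2 x by blast
  have eN: "e \<notin> N" using x by blast
  \<comment> \<open>Exchanging \<open>e2\<close> for \<open>e\<close> gains an edge of
    \<open>M\<close> and loses none. As \<open>y\<close> is covered by \<open>N\<close>, it is not
    \<open>w\<close>, so \<open>w\<close> stays uncovered.\<close>
  define N' where "N' = insert e (N - {e2})"
  have "e \<inter> \<Union>(N - {e2}) = {}"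
    using x(3) e matching_unique[OF mN e2(1) _ e2(2)] by auto
  then have mN': "matching D N'"
    unfolding N'_def by (intro matching_insert[OF matching_subset[OF mN] eD]) auto
  have "card N' = card N" unfolding N'_def using eN e2 finN
    by (metis (no_types, lifting) DiffD1 card_Suc_Diff1 card_insert_disjoint finite_Diff)
  then have maxN': "maximum_matching D N'" using mN' N unfolding maximum_matching_def by simp
  have "w \<notin> \<Union>N'" using N x(4) e \<open>y \<in> \<Union>N\<close> unfolding N'_def by auto
  then have "card (M \<inter> N') \<le> card (M \<inter> N)" using Nbest maxN' by blast
  moreover have "M \<inter> N' = insert e (M \<inter> N)" using x(2) e2M unfolding N'_def by blast
  moreover have "card (insert e (M \<inter> N)) = Suc (card (M \<inter> N))" using eN finM by simp
  ultimately show False by simp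
qed

text \<open>Induction on the number of vertices. A vertex covered by every maximum matching is moved
  to \<open>U\<close>. If there is none, being missed by no common maximum matching is an
  equivalence relation by Gallai's lemma, and its classes are the odd sets. Components are replaced
  by any partition into odd sets without edges across, which is the form in which the barrier is
  exploited below.\<close>

lemma tutte_berge:
  assumes "graph Z D"
  obtains U M \<K> where "U \<subseteq> Z" "matching D M" "\<Union>\<K> = Z - U" "pairwise disjnt \<K>"
    "\<And>K. K \<in> \<K> \<Longrightarrow> odd (card K)"
    "\<And>e. e \<in> D \<Longrightarrow> e \<inter> U = {} \<Longrightarrow> \<exists>K\<in>\<K>. e \<subseteq> K"
    "card Z + card U \<le> 2 * card M + card \<K>"
proof -
  have "\<exists>U M \<K>. U \<subseteq> Z \<and> matching D M \<and> \<Union>\<K> = Z - U \<and> pairwise disjnt \<K> \<and>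
    (\<forall>K\<in>\<K>. odd (card K)) \<and> (\<forall>e\<in>D. e \<inter> U = {} \<longrightarrow> (\<exists>K\<in>\<K>. e \<subseteq> K)) \<and>
    card Z + card U \<le> 2 * card M + card \<K>"
    using assms
  proof (induction "card Z" arbitrary: Z D rule: less_induct)
    case less
    note G = less.prems
    have finZ: "finite Z" using G unfolding graph_def by blast
    obtain M where M: "maximum_matching D M" using maximum_matching_exists[OF G] .
    have mM: "matching D M" using M unfolding maximum_matching_def by blast
    show ?case
    proof (cases "\<exists>v\<in>Z. \<forall>N. maximum_matching D N \<longrightarrow> v \<in> \<Union>N")
      case True
      then obtain v where v: "v \<in> Z" "\<And>N. maximum_matching D N \<Longrightarrow> v \<in> \<Union>N" by blast
      let ?D = "del_verts_E D {v}"
      have "card (Z - {v}) < card Z" using v finZ by (meson card_Diff1_less)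
      note IH = less.hyps[OF this graph_del_verts[OF G]]
      obtain U N \<K> where IH: "U \<subseteq> Z - {v}" "matching ?D N" "\<Union>\<K> = Z - {v} - U"
        "pairwise disjnt \<K>" "\<forall>K\<in>\<K>. odd (card K)"
        "\<forall>e\<in>?D. e \<inter> U = {} \<longrightarrow> (\<exists>K\<in>\<K>. e \<subseteq> K)"
        "card (Z - {v}) + card U \<le> 2 * card N + card \<K>"
        using IH by (elim exE conjE) (rule that)
      \<comment> \<open>If \<open>N\<close> were as large as \<open>M\<close>, it would be a maximum
        matching missing \<open>v\<close>. So the matching number drops when \<open>v\<close> is
        deleted, and the \<open>2\<close> gained in \<open>2 * card M\<close> pays for
        \<open>v\<close> both in \<open>Z\<close> and in \<open>U\<close>.\<close>
      have N: "matching D N" "v \<notin> \<Union>N" using IH(2) unfolding matching_def del_verts_E_def by auto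
      then have "card N \<le> card M" using M unfolding maximum_matching_def by blast
      moreover have "card N \<noteq> card M"
        using v(2)[of N] N M unfolding maximum_matching_def by metis
      ultimately have "card N < card M" by simp
      moreover have "card (insert v U) = Suc (card U)"
        using IH(1) finZ by (metis DiffD2 card_insert_disjoint finite_Diff finite_subset insertI1 subsetD)
      moreover have "card Z = Suc (card (Z - {v}))"
        using v finZ by (metis card_Suc_Diff1)
      ultimately have "card Z + card (insert v U) \<le> 2 * card M + card \<K>" using IH(7) by simp
      moreover have "\<forall>e\<in>D. e \<inter> insert v U = {} \<longrightarrow> (\<exists>K\<in>\<K>. e \<subseteq> K)"
        using IH(6) unfolding del_verts_E_def by simp
      moreover have "\<Union>\<K> = Z - insert v U" using IH(3) by blast
      moreover have "insert v U \<subseteq> Z" using IH(1) v by blast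
      ultimately show ?thesis using mM IH(4,5)
        by (intro exI[of _ "insert v U"] exI[of _ M] exI[of _ \<K>]) simp
    next
      case False
      then have ex: "\<exists>N. maximum_matching D N \<and> v \<notin> \<Union>N" if "v \<in> Z" for v using that by blast
      define r where "r = {(u, v). u \<in> Z \<and> v \<in> Z \<and>
        (u = v \<or> (\<forall>N. maximum_matching D N \<longrightarrow> u \<in> \<Union>N \<or> v \<in> \<Union>N))}"
      have "equiv Z r"
      proof (rule equivI)
        show "r \<subseteq> Z \<times> Z" unfolding r_def by blast
        show "refl_on Z r" unfolding r_def refl_on_def by blast
        show "sym r" unfolding r_def sym_def by blast
        show "trans r"
        proof (rule transI)
          fix u w v assume "(u, w) \<in> r" "(w, v) \<in> r"
          show "(u, v) \<in> r"
          proof (rule ccontr)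
            assume "(u, v) \<notin> r"
            with \<open>(u, w) \<in> r\<close> \<open>(w, v) \<in> r\<close> obtain N where N: "maximum_matching D N" "u \<notin> \<Union>N" "v \<notin> \<Union>N" "u \<noteq> v"
              "u \<noteq> w" "w \<noteq> v" unfolding r_def by blast
            obtain N0 where "maximum_matching D N0" "w \<notin> \<Union>N0"
              using ex \<open>(u, w) \<in> r\<close> unfolding r_def by blast
            then show False
              using gallai_transitive[OF G N(1-4)] \<open>(u, w) \<in> r\<close> \<open>(w, v) \<in> r\<close> N(5,6)
              unfolding r_def by blast
          qed
        qed
      qed
      note eq = this
      have refl: "(u, u) \<in> r" if "u \<in> Z" for u using that unfolding r_def by blast
      have edge: "(u, v) \<in> r" if "{u, v} \<in> D" for u v
        using maximum_matching_covers_edge[OF G _ that] graph_edgeE[OF G that]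
        unfolding r_def by (auto simp: doubleton_eq_iff)
      \<comment> \<open>A maximum matching missing \<open>w\<close> covers the rest of the class of
        \<open>w\<close>. Adjacent vertices are equivalent, so it induces a perfect matching of
        \<open>K - {w}\<close>.\<close>
      have odd: "odd (card K)" if K: "K \<in> Z // r" for K
      proof -
        obtain w where w: "w \<in> Z" "K = r `` {w}" using K by (auto elim: quotientE)
        obtain N where N: "maximum_matching D N" "w \<notin> \<Union>N" using ex w by blast
        have mN: "matching D N" using N unfolding maximum_matching_def by blast
        let ?N = "{e \<in> N. e \<subseteq> K}"
        have "K - {w} \<subseteq> \<Union>?N"
        proof
          fix s assume s: "s \<in> K - {w}"
          then have "s \<in> \<Union>N" using N w unfolding r_def by auto
          then obtain e where e: "e \<in> N" "s \<in> e" by blast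
          then have "e \<in> D" using mN unfolding matching_def by blast
          then obtain s' where s': "e = {s, s'}" "{s, s'} \<in> D"
            using graph_edgeE[OF G] e(2) by (metis insert_commute insertE singletonD)
          have "(w, s') \<in> r" using edge[OF s'(2)] s w eq by (meson DiffD1 Image_singleton_iff equivE transE)
          then show "s \<in> \<Union>?N" using e s' s w by auto
        qed
        then have "K - {w} = \<Union>?N" using N by blast
        moreover have "matching D ?N" using matching_subset[OF mN] by simp
        ultimately have "card (K - {w}) = 2 * card ?N" using card_matching_Union[OF G, of ?N] by simp
        moreover have "w \<in> K" using w refl by blast
        moreover have "finite K" using w finZ by (auto intro: finite_subset[of _ Z] simp: r_def)
        ultimately have "card K = Suc (2 * card ?N)" using card_Suc_Diff1[of K w] by simp
        then show ?thesis by simp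
      qed
      \<comment> \<open>\<open>M\<close> misses at most one vertex of each class, so there are at
        least \<open>card Z - 2 * card M\<close> classes.\<close>
      have "inj_on (\<lambda>s. r `` {s}) (Z - \<Union>M)"
      proof (rule inj_onI)
        fix x y assume xy: "x \<in> Z - \<Union>M" "y \<in> Z - \<Union>M" "r `` {x} = r `` {y}"
        then have "(x, y) \<in> r" using eq by (simp add: eq_equiv_class_iff)
        then show "x = y" using xy M unfolding r_def by blast
      qed
      then have "card (Z - \<Union>M) \<le> card (Z // r)"
      proof (rule card_inj_on_le)
        show "(\<lambda>s. r `` {s}) ` (Z - \<Union>M) \<subseteq> Z // r" by (auto intro: quotientI)
        show "finite (Z // r)" using finite_quotient[OF finZ] equiv_type[OF eq] by blast
      qed
      moreover have "card (Z - \<Union>M) = card Z - 2 * card M"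
        using card_matching_Union[OF G mM] matching_Union[OF G mM] finZ
        by (simp add: card_Diff_subset finite_subset)
      ultimately have "card Z + card ({} :: 'a set) \<le> 2 * card M + card (Z // r)" by simp
      moreover have "\<Union>(Z // r) = Z - {}" using Union_quotient[OF eq] by simp
      moreover have "pairwise disjnt (Z // r)"
        using quotient_disj[OF eq] unfolding pairwise_def disjnt_def by blast
      moreover have "\<exists>K\<in>Z // r. e \<subseteq> K" if "e \<in> D" for e
      proof -
        obtain u v where uv: "e = {u, v}" "u \<in> Z" using graph_edgeE[OF G \<open>e \<in> D\<close>] by blast
        then have "e \<subseteq> r `` {u}" using edge that refl by blast
        then show ?thesis using quotientI[OF uv(2), of r] by blast
      qed
      ultimately show ?thesis using mM odd
        by (intro exI[of _ "{}"] exI[of _ M] exI[of _ "Z // r"]) simp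
    qed
  qed
  then obtain U M \<K> where *: "U \<subseteq> Z" "matching D M" "\<Union>\<K> = Z - U" "pairwise disjnt \<K>"
    "\<forall>K\<in>\<K>. odd (card K)" "\<forall>e\<in>D. e \<inter> U = {} \<longrightarrow> (\<exists>K\<in>\<K>. e \<subseteq> K)"
    "card Z + card U \<le> 2 * card M + card \<K>"
    by (elim exE conjE) (rule that)
  show ?thesis by (rule that[OF *(1-4) _ _ *(7)]) (use *(5,6) in simp_all)
qed

section \<open>Alternating paths between two matchings\<close>

text \<open>The list begins and ends with an edge of \<open>M\<close>, which is the shape of a path
  augmenting \<open>N\<close>; each rule therefore consumes two vertices.\<close>

inductive alternating :: "'b set set \<Rightarrow> 'b set set \<Rightarrow> 'b list \<Rightarrow> bool" for M N where
  single: "{x, y} \<in> M \<Longrightarrow> alternating M N [x, y]"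
| step: "{x, y} \<in> M \<Longrightarrow> {y, hd zs} \<in> N \<Longrightarrow> alternating M N zs \<Longrightarrow> alternating M N (x # y # zs)"

lemma alternating_nonempty: "alternating M N xs \<Longrightarrow> xs \<noteq> []"
  by (induction rule: alternating.induct) auto

lemma alternating_mono:
  "alternating M N xs \<Longrightarrow> M \<subseteq> M' \<Longrightarrow> N \<subseteq> N' \<Longrightarrow> alternating M' N' xs"
  by (induction rule: alternating.induct) (auto intro: alternating.intros)

lemma alternating_subset: "alternating M N xs \<Longrightarrow> set xs \<subseteq> \<Union>M"
  by (induction rule: alternating.induct) auto

text \<open>Inner vertices are matched by \<open>N\<close> inside the list. Applied to the joins
  between copies, this keeps both copies of a vertex on the same list.\<close>

lemma alternating_partner:
  "alternating M N xs \<Longrightarrow> x \<in> set xs \<Longrightarrow> x = hd xs \<or> x = last xs \<or> (\<exists>y\<in>set xs. {x, y} \<in> N)"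
proof (induction rule: alternating.induct)
  case (step u v zs)
  have zs: "zs \<noteq> []" using step.hyps alternating_nonempty by auto
  have vz: "{v, hd zs} \<in> N" "{hd zs, v} \<in> N" using step.hyps(2) by (auto simp: insert_commute)
  consider "x = u" | "x = v" | "x \<in> set zs" using step.prems by auto
  then show ?case
  proof cases
    case 2
    then show ?thesis using vz zs by auto
  next
    case 3
    then consider "x = hd zs" | "x = last zs" | "\<exists>y\<in>set zs. {x, y} \<in> N" using step.IH by auto
    then show ?thesis using vz zs by cases auto
  qed simp
qed auto

text \<open>Undoes a contraction by replacing the step \<open>a, b\<close> with
  \<open>a, p, q, b\<close>. The last disjunct says that \<open>p\<close> and \<open>q\<close> enter
  only a list that contains \<open>a\<close> and \<open>b\<close>; of several disjoint lists at most
  one does, so they remain disjoint.\<close>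

lemma alternating_expand:
  assumes "alternating M' N' xs" "distinct xs" "p \<notin> set xs" "q \<notin> set xs" "p \<noteq> q"
    and M': "M' \<subseteq> insert {a, b} M" and N': "N' \<subseteq> N"
    and new: "{p, a} \<in> M" "{q, b} \<in> M" "{p, q} \<in> N"
  shows "\<exists>ys. alternating M N ys \<and> distinct ys \<and> hd ys = hd xs \<and> last ys = last xs \<and>
    set ys \<subseteq> set xs \<union> {p, q} \<and> (set ys \<subseteq> set xs \<or> {a, b} \<subseteq> set xs)"
  using assms(1-4)
proof (induction rule: alternating.induct)
  case (single x y)
  show ?case
  proof (cases "{x, y} = {a, b}")
    case True
    then consider "x = a" "y = b" | "x = b" "y = a" by (metis doubleton_eq_iff)
    then show ?thesis
    proof cases
      case 1
      have "alternating M N [x, p, q, y]"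
        using new 1 by (auto intro!: alternating.intros simp: insert_commute)
      then show ?thesis using single.prems 1 \<open>p \<noteq> q\<close> by (intro exI[of _ "[x, p, q, y]"]) auto
    next
      case 2
      have "alternating M N [x, q, p, y]"
        using new 2 by (auto intro!: alternating.intros simp: insert_commute)
      then show ?thesis using single.prems 2 \<open>p \<noteq> q\<close> by (intro exI[of _ "[x, q, p, y]"]) auto
    qed
  next
    case False
    then have "alternating M N [x, y]" using single.hyps M' by (auto intro: alternating.single)
    then show ?thesis using single.prems by (intro exI[of _ "[x, y]"]) auto
  qed
next
  case (step x y zs)
  obtain ys where ys: "alternating M N ys" "distinct ys" "hd ys = hd zs" "last ys = last zs"
    "set ys \<subseteq> set zs \<union> {p, q}" "set ys \<subseteq> set zs \<or> {a, b} \<subseteq> set zs"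
    using step.IH step.prems by auto
  have ne: "ys \<noteq> []" "zs \<noteq> []" using ys(1) step.hyps alternating_nonempty by auto
  have yz: "{y, hd ys} \<in> N" using step.hyps N' ys(3) by auto
  show ?case
  proof (cases "{x, y} = {a, b}")
    case True
    \<comment> \<open>The list is distinct, so \<open>a\<close> and \<open>b\<close> do not recur in
      the tail, and the induction hypothesis has not already inserted \<open>p\<close> and
      \<open>q\<close> there.\<close>
    then have sub: "set ys \<subseteq> set zs" using ys(6) step.prems(1) by auto
    have yN: "alternating M N (w # y # ys)" if "{w, y} \<in> M" for w
      using that yz ys(1) by (auto intro: alternating.step)
    from True consider "x = a" "y = b" | "x = b" "y = a" by (metis doubleton_eq_iff)
    then show ?thesis
    proof cases
      case 1
      have "alternating M N (x # p # q # y # ys)"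
        using new 1 yN[of q] by (intro alternating.step[of x p]) (auto simp: insert_commute)
      then show ?thesis using step.prems 1 \<open>p \<noteq> q\<close> sub ys ne
        by (intro exI[of _ "x # p # q # y # ys"]) auto
    next
      case 2
      have "alternating M N (x # q # p # y # ys)"
        using new 2 yN[of p] by (intro alternating.step[of x q]) (auto simp: insert_commute)
      then show ?thesis using step.prems 2 \<open>p \<noteq> q\<close> sub ys ne
        by (intro exI[of _ "x # q # p # y # ys"]) auto
    qed
  next
    case False
    then have "alternating M N (x # y # ys)"
      using step.hyps M' yz ys(1) by (auto intro: alternating.step)
    then show ?thesis using step.prems ys ne by (intro exI[of _ "x # y # ys"]) auto
  qed
qed

text \<open>Induction on \<open>N\<close>: the \<open>N\<close>-edge \<open>{p, q}\<close> is contracted, so that \<open>M\<close>-edges \<open>{p, a}\<close> and \<open>{q, b}\<close>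
  merge into \<open>{a, b}\<close>.\<close>

lemma alternating_paths:
  fixes M N :: "'b set set"
  assumes "finite N" "finite M" "matching {e. card e = 2} M" "matching {e. card e = 2} N"
  shows "\<exists>\<P>. finite \<P> \<and> card M \<le> card N + card \<P> \<and>
    (\<forall>xs\<in>\<P>. alternating M N xs \<and> distinct xs \<and> hd xs \<notin> \<Union>N \<and> last xs \<notin> \<Union>N) \<and>
    (\<forall>xs\<in>\<P>. \<forall>ys\<in>\<P>. xs \<noteq> ys \<longrightarrow> set xs \<inter> set ys = {})"
  using assms
proof (induction N arbitrary: M rule: finite_induct)
  case empty
  have "\<exists>x y. e = {x, y} \<and> x \<noteq> y" if "e \<in> M" for e
    using empty(2) that unfolding matching_def by (auto simp: card_2_iff)
  then obtain l r where lr: "\<And>e. e \<in> M \<Longrightarrow> e = {l e, r e} \<and> l e \<noteq> r e" by metis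
  let ?P = "(\<lambda>e. [l e, r e]) ` M"
  have setP: "set [l e, r e] = e" if "e \<in> M" for e using lr[OF that] by auto
  have inj: "inj_on (\<lambda>e. [l e, r e]) M"
    using setP by (metis (no_types, lifting) inj_onI)
  have "alternating M {} [l e, r e]" if "e \<in> M" for e
    using lr[OF that] that by (intro alternating.single) auto
  then have *: "alternating M {} xs \<and> distinct xs" if "xs \<in> ?P" for xs
    using lr that by auto
  have "set xs \<inter> set ys = {}" if "xs \<in> ?P" "ys \<in> ?P" "xs \<noteq> ys" for xs ys
  proof -
    obtain e e' where e: "e \<in> M" "xs = [l e, r e]" "e' \<in> M" "ys = [l e', r e']" using \<open>xs \<in> ?P\<close> \<open>ys \<in> ?P\<close> by blast
    then have "e \<noteq> e'" using that(3) by auto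
    then have "e \<inter> e' = {}" using matching_unique[OF empty(2) e(1,3)] by auto
    then show ?thesis using e setP[OF e(1)] setP[OF e(3)] by auto
  qed
  moreover have "card M \<le> card ({} :: 'b set set) + card ?P" using card_image[OF inj] by simp
  ultimately show ?case using empty(1) *
    by (intro exI[of _ ?P] conjI ballI impI) auto
next
  case (insert e0 N)
  obtain p q where pq: "e0 = {p, q}" "p \<noteq> q"
    using insert.prems(3) unfolding matching_def by (auto simp: card_2_iff)
  have mN: "matching {e. card e = 2} N" using insert.prems(3) matching_subset by blast
  have pqN: "p \<notin> \<Union>N" "q \<notin> \<Union>N"
    using matching_unique[OF insert.prems(3), of e0] insert.hyps(2) pq by auto
  note mM = insert.prems(2) and finM = insert.prems(1)
  define M1 where "M1 = {e \<in> M. p \<notin> e \<and> q \<notin> e}"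
  have mM1: "matching {e. card e = 2} M1" "finite M1"
    using matching_subset[OF mM, of M1] finM unfolding M1_def by auto
  have cN: "card (insert e0 N) = Suc (card N)" using insert.hyps by simp
  \<comment> \<open>Either at most one edge of \<open>M\<close> meets \<open>{p, q}\<close> and is
    dropped, or two do and are merged into one. In both cases \<open>M\<close> loses at most one
    edge while \<open>N\<close> loses \<open>e0\<close>, so the counting inequality carries
    over.\<close>
  have "(\<exists>a b. {p, a} \<in> M \<and> {q, b} \<in> M \<and> {p, q} \<notin> M) \<or> card M \<le> Suc (card M1)"
  proof -
    have other: "\<exists>y. e = {x, y}" if "e \<in> M" "x \<in> e" for e x
      using that mM unfolding matching_def by (auto simp: card_2_iff)
    show ?thesis
    proof (cases "\<exists>e1\<in>M. M - M1 \<subseteq> {e1}")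
      case True
      then obtain e1 where "e1 \<in> M" "M \<subseteq> insert e1 M1" by blast
      then have "card M \<le> card (insert e1 M1)" using mM1(2) by (intro card_mono) auto
      also have "\<dots> \<le> Suc (card M1)" using mM1(2) by (simp add: card_insert_if)
      finally show ?thesis by simp
    next
      case False
      show ?thesis
      proof (cases "M - M1 = {}")
        case True
        then have "M \<subseteq> M1" by blast
        then show ?thesis using card_mono[OF mM1(2), of M] by simp
      next
        case ne: False
        have uniq: "\<And>e e' x. e \<in> M \<Longrightarrow> e' \<in> M \<Longrightarrow> x \<in> e \<Longrightarrow> x \<in> e' \<Longrightarrow> e = e'"
          using matching_unique[OF mM] by blast
        obtain e1 e2 where e12: "e1 \<in> M - M1" "e2 \<in> M - M1" "e1 \<noteq> e2"
          using ne False by blast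
        have inter: "p \<in> e \<or> q \<in> e" if "e \<in> M - M1" for e using that unfolding M1_def by blast
        have "\<exists>e3\<in>M. \<exists>e4\<in>M. p \<in> e3 \<and> q \<in> e4 \<and> e3 \<noteq> e4"
        proof (cases "p \<in> e1")
          case True
          then have "q \<in> e2" using inter[of e2] uniq[of e1 e2 p] e12 by blast
          then show ?thesis using True e12 by blast
        next
          case False
          then have "q \<in> e1" using inter[of e1] e12 by blast
          moreover have "p \<in> e2" using inter[of e2] uniq[of e1 e2 q] e12 calculation by blast
          ultimately show ?thesis using e12 by blast
        qed
        then obtain e3 e4 where e34: "e3 \<in> M" "e4 \<in> M" "p \<in> e3" "q \<in> e4" "e3 \<noteq> e4" by blast
        have "{p, q} \<notin> M" using uniq[of "{p, q}" e3 p] uniq[of "{p, q}" e4 q] e34 by auto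
        moreover obtain a where "e3 = {p, a}" using other[OF e34(1,3)] by auto
        moreover obtain b where "e4 = {q, b}" using other[OF e34(2,4)] by auto
        ultimately show ?thesis using e34(1,2) by auto
      qed
    qed
  qed
  then show ?case
  proof
    assume "card M \<le> Suc (card M1)"
    obtain \<P> where P: "finite \<P>" "card M1 \<le> card N + card \<P>"
      "\<forall>xs\<in>\<P>. alternating M1 N xs \<and> distinct xs \<and> hd xs \<notin> \<Union>N \<and> last xs \<notin> \<Union>N"
      "\<forall>xs\<in>\<P>. \<forall>ys\<in>\<P>. xs \<noteq> ys \<longrightarrow> set xs \<inter> set ys = {}"
      using insert.IH[OF mM1(2) mM1(1) mN] by (elim exE conjE) (rule that)
    have "alternating M (insert e0 N) xs \<and> distinct xs \<and> hd xs \<notin> \<Union>(insert e0 N) \<and> last xs \<notin> \<Union>(insert e0 N)"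
      if xs: "xs \<in> \<P>" for xs
    proof -
      have alt: "alternating M1 N xs" using P(3) xs by blast
      have "set xs \<subseteq> \<Union>M1" using alternating_subset[OF alt] .
      then have "p \<notin> set xs" "q \<notin> set xs" unfolding M1_def by auto
      then have "hd xs \<notin> e0" "last xs \<notin> e0"
        using alternating_nonempty[OF alt] pq by (metis hd_in_set insertE singletonD, metis last_in_set insertE singletonD)
      moreover have "alternating M (insert e0 N) xs"
        using alt by (rule alternating_mono) (auto simp: M1_def)
      ultimately show ?thesis using P(3) xs by simp
    qed
    then show ?thesis using P cN \<open>card M \<le> Suc (card M1)\<close> by (intro exI[of _ \<P>]) simp
  next
    assume "\<exists>a b. {p, a} \<in> M \<and> {q, b} \<in> M \<and> {p, q} \<notin> M"
    then obtain a b where ab: "{p, a} \<in> M" "{q, b} \<in> M" "{p, q} \<notin> M" by blast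
    have uniq: "\<And>e e' x. e \<in> M \<Longrightarrow> e' \<in> M \<Longrightarrow> x \<in> e \<Longrightarrow> x \<in> e' \<Longrightarrow> e = e'"
      using matching_unique[OF mM] by blast
    have "card {p, a} = 2" "card {q, b} = 2" using ab mM unfolding matching_def by auto
    then have pa: "p \<noteq> a" "q \<noteq> b" by auto
    have ne: "{p, a} \<noteq> {q, b}" using ab(1,3) pq(2) by (auto simp: doubleton_eq_iff)
    then have dis: "a \<noteq> b" "a \<noteq> q" "b \<noteq> p" using uniq[OF ab(1,2), of a] ab pq by (auto simp: insert_commute)
    have M1e: "M = insert {p, a} (insert {q, b} M1)"
    proof
      show "insert {p, a} (insert {q, b} M1) \<subseteq> M" using ab unfolding M1_def by auto
      show "M \<subseteq> insert {p, a} (insert {q, b} M1)"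
        using uniq[OF ab(1), of _ p] uniq[OF ab(2), of _ q] unfolding M1_def by blast
    qed
    have notM1: "{p, a} \<notin> M1" "{q, b} \<notin> M1" unfolding M1_def by auto
    have cM: "card M = Suc (Suc (card M1))"
      using notM1 ne mM1(2) by (subst M1e) simp
    have abM1: "{a, b} \<inter> \<Union>M1 = {}"
      using uniq[OF ab(1), of _ a] uniq[OF ab(2), of _ b] notM1 unfolding M1_def by blast
    define M2 where "M2 = insert {a, b} M1"
    have mM2: "matching {e. card e = 2} M2"
      unfolding M2_def using matching_insert[OF mM1(1) _ abM1] dis by simp
    have "{a, b} \<notin> M1" using abM1 by blast
    then have c2: "card M2 = Suc (card M1)" unfolding M2_def using mM1(2) by simp
    have finM2: "finite M2" unfolding M2_def using mM1 by simp
    obtain \<P> where P: "finite \<P>" "card M2 \<le> card N + card \<P>"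
      "\<forall>xs\<in>\<P>. alternating M2 N xs \<and> distinct xs \<and> hd xs \<notin> \<Union>N \<and> last xs \<notin> \<Union>N"
      "\<forall>xs\<in>\<P>. \<forall>ys\<in>\<P>. xs \<noteq> ys \<longrightarrow> set xs \<inter> set ys = {}"
      using insert.IH[OF finM2 mM2 mN] by (elim exE conjE) (rule that)
    have pqxs: "p \<notin> set xs \<and> q \<notin> set xs" if "xs \<in> \<P>" for xs
    proof -
      have "set xs \<subseteq> \<Union>M2" using P(3) that alternating_subset by blast
      then show ?thesis using dis pa unfolding M2_def M1_def by auto
    qed
    have "\<exists>ys. alternating M (insert e0 N) ys \<and> distinct ys \<and> hd ys = hd xs \<and> last ys = last xs \<and>
      set ys \<subseteq> set xs \<union> {p, q} \<and> (set ys \<subseteq> set xs \<or> {a, b} \<subseteq> set xs)" if "xs \<in> \<P>" for xs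
    proof (rule alternating_expand[of M2 N])
      show "M2 \<subseteq> insert {a, b} M" unfolding M2_def M1_def by auto
    qed (use that P(3) pqxs pq ab in auto)
    then obtain F where F: "\<And>xs. xs \<in> \<P> \<Longrightarrow> alternating M (insert e0 N) (F xs) \<and> distinct (F xs) \<and>
      hd (F xs) = hd xs \<and> last (F xs) = last xs \<and>
      set (F xs) \<subseteq> set xs \<union> {p, q} \<and> (set (F xs) \<subseteq> set xs \<or> {a, b} \<subseteq> set xs)" by metis
    have hdl: "xs \<noteq> []" "hd xs \<in> set xs" "last xs \<in> set xs" if "xs \<in> \<P>" for xs
      using P(3) that alternating_nonempty[of M2 N xs] by auto
    have inj: "inj_on F \<P>"
    proof (rule inj_onI)
      fix xs ys assume "xs \<in> \<P>" "ys \<in> \<P>" "F xs = F ys"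
      then have "hd xs \<in> set xs \<inter> set ys" using F hdl by (metis IntI)
      then show "xs = ys" using P(4) \<open>xs \<in> \<P>\<close> \<open>ys \<in> \<P>\<close> by blast
    qed
    have "set (F xs) \<inter> set (F ys) = {}" if xy: "xs \<in> \<P>" "ys \<in> \<P>" "F xs \<noteq> F ys" for xs ys
    proof -
      have "xs \<noteq> ys" using xy(3) by auto
      then have dj: "set xs \<inter> set ys = {}" using P(4) xy(1,2) by simp
      have sub: "set (F xs) \<subseteq> set xs \<union> {p, q}" "set (F ys) \<subseteq> set ys \<union> {p, q}"
        "set (F xs) \<subseteq> set xs \<or> a \<in> set xs" "set (F ys) \<subseteq> set ys \<or> a \<in> set ys"
        using F[OF xy(1)] F[OF xy(2)] by auto
      have pq': "p \<notin> set xs" "q \<notin> set xs" "p \<notin> set ys" "q \<notin> set ys" using pqxs xy by auto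
      have "set (F xs) \<subseteq> set xs \<or> set (F ys) \<subseteq> set ys" using sub(3,4) dj by auto
      then show ?thesis using sub(1,2) dj pq' by auto
    qed
    moreover have "alternating M (insert e0 N) (F xs) \<and> distinct (F xs) \<and> hd (F xs) \<notin> \<Union>(insert e0 N) \<and>
      last (F xs) \<notin> \<Union>(insert e0 N)" if xs: "xs \<in> \<P>" for xs
    proof -
      have "hd xs \<notin> e0" "last xs \<notin> e0" using pqxs[OF xs] hdl[OF xs] pq by auto
      then show ?thesis using F[OF xs] P(3) xs by simp
    qed
    moreover have "card M \<le> card (insert e0 N) + card (F ` \<P>)"
      using cM c2 P(2) cN card_image[OF inj] by simp
    ultimately show ?thesis using P(1)
      by (intro exI[of _ "F ` \<P>"] conjI ballI impI) auto
  qed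
qed

section \<open>Breaking paths and the doubled graph\<close>

text \<open>\<open>length\<close> counts vertices. A path properly coloured by \<open>f\<close> has
  equally coloured ends exactly if this number is odd, so the last conjunct demands the
  opposite.\<close>

definition breaking :: "'a set \<Rightarrow> 'a set set \<Rightarrow> 'a set \<Rightarrow> ('a \<Rightarrow> bool) \<Rightarrow> 'a list \<Rightarrow> bool" where
  "breaking V E A f p \<longleftrightarrow> is_path V E p \<and> 2 \<le> length p \<and> hd p \<in> A \<and> last p \<in> A \<and>
     set p \<inter> A \<subseteq> {hd p, last p} \<and> ((f (hd p) = f (last p)) \<longleftrightarrow> even (length p))"

lemma is_path_iff_successively:
  "is_path V E p \<longleftrightarrow> p \<noteq> [] \<and> distinct p \<and> set p \<subseteq> V \<and> successively (\<lambda>x y. {x, y} \<in> E) p"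
  unfolding is_path_def successively_conv_nth by auto

text \<open>An edge of \<open>M\<close> moves along an edge of \<open>E\<close> and keeps the level;
  an edge of \<open>N\<close> stays at its vertex and switches the level. Hence the level switches
  once per inner vertex of the projection. The premise on the twin of the head excludes edges of
  \<open>M\<close> that project to a single vertex; it is inherited by the tail, because the twin of
  the next head is the vertex just left.\<close>

lemma alternating_project:
  fixes M N :: "('a \<times> bool) set set"
  assumes "alternating M N xs" "distinct xs" "(fst (hd xs), \<not> snd (hd xs)) \<notin> set xs"
    and M: "\<And>x y. {x, y} \<in> M \<Longrightarrow> fst x = fst y \<or> {fst x, fst y} \<in> E \<and> snd x = snd y"
    and N: "\<And>x y. {x, y} \<in> N \<Longrightarrow> fst x = fst y \<and> snd x \<noteq> snd y \<and> fst x \<notin> A"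
  shows "\<exists>vs. 2 \<le> length vs \<and> distinct vs \<and> successively (\<lambda>u v. {u, v} \<in> E) vs \<and>
    set vs = fst ` set xs \<and> hd vs = fst (hd xs) \<and> last vs = fst (last xs) \<and>
    set vs \<inter> A \<subseteq> {hd vs, last vs} \<and> ((snd (hd xs) = snd (last xs)) \<longleftrightarrow> even (length vs))"
  using assms(1-3)
proof (induction rule: alternating.induct)
  case (single x y)
  have ne: "fst x \<noteq> fst y" using single.prems by (cases x; cases y) auto
  then have "{fst x, fst y} \<in> E" "snd x = snd y" using M[OF single.hyps] by auto
  then show ?case using ne by (intro exI[of _ "[fst x, fst y]"]) auto
next
  case (step x y zs)
  have zs: "zs \<noteq> []" using step.hyps alternating_nonempty by blast
  have yz: "fst y = fst (hd zs)" "snd y \<noteq> snd (hd zs)" "fst y \<notin> A" using N[OF step.hyps(2)] by auto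
  have "(fst (hd zs), \<not> snd (hd zs)) = y" using yz by (cases y) auto
  then have "(fst (hd zs), \<not> snd (hd zs)) \<notin> set zs" using step.prems(1) by simp
  moreover have "distinct zs" using step.prems(1) by simp
  ultimately obtain vs where vs: "2 \<le> length vs" "distinct vs" "successively (\<lambda>u v. {u, v} \<in> E) vs"
    "set vs = fst ` set zs" "hd vs = fst (hd zs)" "last vs = fst (last zs)"
    "set vs \<inter> A \<subseteq> {hd vs, last vs}" "(snd (hd zs) = snd (last zs)) \<longleftrightarrow> even (length vs)"
    using step.IH by metis
  have fx: "fst x \<noteq> fst w" if "w \<in> set (y # zs)" for w
  proof
    assume "fst x = fst w"
    then have "w = x \<or> w = (fst x, \<not> snd x)" by (cases x; cases w) auto
    then show False using step.prems that by auto
  qed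
  have xy: "{fst x, fst y} \<in> E" "snd x = snd y" using M[OF step.hyps(1)] fx[of y] by auto
  have nin: "fst x \<notin> set vs" unfolding vs(4) using fx by auto
  have ne: "vs \<noteq> []" using vs(1) by auto
  show ?case
  proof (intro exI[of _ "fst x # vs"] conjI)
    show "successively (\<lambda>u v. {u, v} \<in> E) (fst x # vs)"
      using xy vs(3,5) yz by (simp add: successively_Cons)
    show "set (fst x # vs) = fst ` set (x # y # zs)" using vs(4) yz(1) zs by auto
    show "set (fst x # vs) \<inter> A \<subseteq> {hd (fst x # vs), last (fst x # vs)}"
      using vs(5,7) yz(1,3) ne by auto
    show "(snd (hd (x # y # zs)) = snd (last (x # y # zs))) = even (length (fst x # vs))"
      using vs(8) xy(2) yz(2) zs by auto
  qed (use vs nin ne zs in auto)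
qed

locale port_graph =
  fixes V :: "'a set" and E :: "'a set set" and A :: "'a set" and f :: "'a \<Rightarrow> bool"
  assumes G: "graph V E" and AV: "A \<subseteq> V"
begin

text \<open>A path of \<open>G\<close> is lifted to \<open>ports\<close> by using the two copies of every edge alternately; a vertex of \<open>A\<close>
  has only the copy given by its colour, so exactly the parity breaking paths lift.\<close>

definition ports :: "('a \<times> bool) set" where
  "ports = {x. fst x \<in> V \<and> (fst x \<in> A \<longrightarrow> snd x = f (fst x))}"

definition copies :: "('a \<times> bool) set set" where
  "copies = (\<lambda>v. {(v, False), (v, True)}) ` (V - A)"

definition port_edges :: "('a \<times> bool) set set" where
  "port_edges = {{(u, i), (v, i)} | u v i. {u, v} \<in> E \<and> (u, i) \<in> ports \<and> (v, i) \<in> ports} \<union> copies"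

lemma finite_V: "finite V"
  using G unfolding graph_def by blast

lemma edge_ne: "{u, v} \<in> E \<Longrightarrow> u \<noteq> v"
  using graph_edgeE[OF G, of "{u, v}"] by (metis doubleton_eq_iff)

lemma finite_ports: "finite ports"
  by (rule finite_subset[of _ "V \<times> UNIV"]) (auto simp: ports_def finite_V)

lemma card_ports: "card ports = 2 * card (V - A) + card A"
proof -
  have "ports = (V - A) \<times> UNIV \<union> (\<lambda>a. (a, f a)) ` A"
    using AV unfolding ports_def by (auto simp: image_iff)
  moreover have "card ((V - A) \<times> (UNIV :: bool set)) = 2 * card (V - A)" by (simp add: card_cartesian_product)
  moreover have "card ((\<lambda>a. (a, f a)) ` A) = card A" by (rule card_image) (auto simp: inj_on_def)
  moreover have "(V - A) \<times> UNIV \<inter> (\<lambda>a. (a, f a)) ` A = {}" by auto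
  moreover have "finite A" using AV finite_V finite_subset by auto
  ultimately show ?thesis using finite_V by (simp add: card_Un_disjoint)
qed

lemma card_copies: "card copies = card (V - A)"
  unfolding copies_def by (rule card_image) (auto simp: inj_on_def doubleton_eq_iff)

lemma Union_copies: "\<Union>copies = {x. fst x \<in> V - A}"
proof -
  have "(v, i) \<in> {(v, False), (v, True)}" for v :: 'a and i by (cases i) auto
  then show ?thesis unfolding copies_def by (auto simp: image_iff)
qed

lemma graph_ports: "graph ports port_edges"
  unfolding graph_def
proof (intro conjI ballI finite_ports)
  fix e assume "e \<in> port_edges"
  then consider u v i where "e = {(u, i), (v, i)}" "{u, v} \<in> E" "(u, i) \<in> ports" "(v, i) \<in> ports"
    | v where "e = {(v, False), (v, True)}" "v \<in> V - A" unfolding port_edges_def copies_def by auto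
  then show "\<exists>u v. e = {u, v} \<and> u \<noteq> v \<and> u \<in> ports \<and> v \<in> ports"
  proof cases
    case 1
    then show ?thesis using edge_ne[OF 1(2)] by (intro exI[of _ "(u, i)"] exI[of _ "(v, i)"]) simp
  next
    case 2
    then show ?thesis by (intro exI[of _ "(v, False)"] exI[of _ "(v, True)"]) (simp add: ports_def)
  qed
qed

lemma copies_edge: "{x, y} \<in> copies \<Longrightarrow> fst x = fst y \<and> snd x \<noteq> snd y \<and> fst x \<notin> A"
  unfolding copies_def by (auto simp: doubleton_eq_iff)

lemma copies_pair: "v \<in> V \<Longrightarrow> v \<notin> A \<Longrightarrow> {(v, i), (v, \<not> i)} \<in> copies"
  unfolding copies_def by (cases i) (auto simp: image_iff insert_commute)

lemma port_edge: "{x, y} \<in> port_edges \<Longrightarrow> fst x = fst y \<or> {fst x, fst y} \<in> E \<and> snd x = snd y"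
  unfolding port_edges_def copies_def by (auto simp: doubleton_eq_iff insert_commute)

text \<open>Relative to the matching \<open>copies\<close>, of size \<open>card (V - A)\<close>, the
  surplus \<open>k\<close> of \<open>M\<close> produces \<open>k\<close> alternating paths. Their
  ends are not covered by \<open>copies\<close>, so they are the single ports of vertices of
  \<open>A\<close>, whose levels are given by \<open>f\<close>; a projected path thus breaks
  parity.\<close>

lemma breaking_paths_if_large_matching:
  assumes M: "matching port_edges M" and k: "card (V - A) + k \<le> card M"
  shows "\<exists>P :: nat \<Rightarrow> 'a list. (\<forall>i<k. breaking V E A f (P i)) \<and>
    (\<forall>i<k. \<forall>j<k. i \<noteq> j \<longrightarrow> set (P i) \<inter> set (P j) = {})"
proof -
  have two: "port_edges \<subseteq> {e. card e = 2}"
    using graph_ports unfolding graph_def by auto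
  have finM: "finite M" using matching_finite[OF graph_ports M] .
  have mM: "matching {e. card e = 2} M" using M two unfolding matching_def by auto
  have "copies \<subseteq> port_edges" unfolding port_edges_def by auto
  moreover have "pairwise disjnt copies" unfolding copies_def pairwise_def disjnt_def by auto
  ultimately have mN: "matching {e. card e = 2} copies" using two unfolding matching_def by auto
  have finN: "finite copies" unfolding copies_def using finite_V by simp
  obtain \<P> where P: "finite \<P>" "card M \<le> card copies + card \<P>"
    "\<forall>xs\<in>\<P>. alternating M copies xs \<and> distinct xs \<and> hd xs \<notin> \<Union>copies \<and> last xs \<notin> \<Union>copies"
    "\<forall>xs\<in>\<P>. \<forall>ys\<in>\<P>. xs \<noteq> ys \<longrightarrow> set xs \<inter> set ys = {}"
    using alternating_paths[OF finN finM mM mN] by (elim exE conjE) (rule that)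
  have inA: "fst x \<in> A \<and> snd x = f (fst x)" if "x \<in> ports" "x \<notin> \<Union>copies" for x
    using that unfolding Union_copies ports_def by auto
  have sub: "set xs \<subseteq> ports" if "xs \<in> \<P>" for xs
  proof -
    have "set xs \<subseteq> \<Union>M" using P(3) that alternating_subset[of M copies xs] by simp
    then show ?thesis using matching_Union[OF graph_ports M] by simp
  qed
  have "\<exists>vs. breaking V E A f vs \<and> set vs = fst ` set xs" if xs: "xs \<in> \<P>" for xs
  proof -
    have alt: "alternating M copies xs" "distinct xs" and ends: "hd xs \<notin> \<Union>copies" "last xs \<notin> \<Union>copies"
      using P(3) xs by auto
    have ne: "xs \<noteq> []" using alternating_nonempty[OF alt(1)] .
    then have hl: "hd xs \<in> ports" "last xs \<in> ports" using sub[OF xs] by auto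
    have twin: "(fst (hd xs), \<not> snd (hd xs)) \<notin> set xs"
    proof
      assume "(fst (hd xs), \<not> snd (hd xs)) \<in> set xs"
      then have "(fst (hd xs), \<not> snd (hd xs)) \<in> ports" using sub[OF xs] by auto
      then show False using inA[OF hl(1) ends(1)] unfolding ports_def by auto
    qed
    have Medge: "fst x = fst y \<or> {fst x, fst y} \<in> E \<and> snd x = snd y" if "{x, y} \<in> M" for x y
      using port_edge[of x y] M that unfolding matching_def by auto
    have "\<exists>vs. 2 \<le> length vs \<and> distinct vs \<and> successively (\<lambda>u v. {u, v} \<in> E) vs \<and>
      set vs = fst ` set xs \<and> hd vs = fst (hd xs) \<and> last vs = fst (last xs) \<and>
      set vs \<inter> A \<subseteq> {hd vs, last vs} \<and> ((snd (hd xs) = snd (last xs)) \<longleftrightarrow> even (length vs))"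
      by (rule alternating_project[OF alt twin]) (erule Medge, erule copies_edge)
    then obtain vs where vs: "2 \<le> length vs" "distinct vs" "successively (\<lambda>u v. {u, v} \<in> E) vs"
      "set vs = fst ` set xs" "hd vs = fst (hd xs)" "last vs = fst (last xs)"
      "set vs \<inter> A \<subseteq> {hd vs, last vs}" "(snd (hd xs) = snd (last xs)) \<longleftrightarrow> even (length vs)"
      by (elim exE conjE) (rule that)
    have "set vs \<subseteq> V" unfolding vs(4) using sub[OF xs] unfolding ports_def by auto
    then have "breaking V E A f vs"
      unfolding breaking_def is_path_iff_successively
      using vs inA[OF hl(1) ends(1)] inA[OF hl(2) ends(2)] by auto
    then show ?thesis using vs(4) by auto
  qed
  then obtain F where F: "\<And>xs. xs \<in> \<P> \<Longrightarrow> breaking V E A f (F xs) \<and> set (F xs) = fst ` set xs" by metis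
  \<comment> \<open>Projections of disjoint lists could only meet in a vertex with one copy on each
    list, but the twin of a port covered by \<open>copies\<close> is its
    \<open>copies\<close>-partner and lies on the same list.\<close>
  have dj: "set (F xs) \<inter> set (F ys) = {}" if xy: "xs \<in> \<P>" "ys \<in> \<P>" "xs \<noteq> ys" for xs ys
  proof (rule ccontr)
    assume "set (F xs) \<inter> set (F ys) \<noteq> {}"
    then obtain v where v: "v \<in> set (F xs)" "v \<in> set (F ys)" by auto
    obtain x where x: "x \<in> set xs" "fst x = v" using v F[OF xy(1)] by auto
    obtain y where y: "y \<in> set ys" "fst y = v" using v F[OF xy(2)] by auto
    have dxy: "set xs \<inter> set ys = {}" using P(4) xy by simp
    then have xy': "x \<in> ports" "y \<in> ports" "x \<noteq> y"
      using sub[OF xy(1)] sub[OF xy(2)] x y by auto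
    then have "{x, y} \<in> copies"
      using copies_pair[of v "snd x"] x y unfolding ports_def by (cases x; cases y) auto
    moreover have "x \<noteq> hd xs" "x \<noteq> last xs" using P(3) xy(1) calculation by auto
    ultimately obtain z where z: "z \<in> set xs" "{x, z} \<in> copies"
      using alternating_partner[of M copies xs x] P(3) xy(1) x(1) by auto
    then have "z = y" using copies_edge[of x z] copies_edge[of x y] \<open>{x, y} \<in> copies\<close>
      by (cases z; cases y) auto
    then show False using z(1) y(1) dxy by auto
  qed
  have "k \<le> card \<P>" using P(2) k card_copies by simp
  then obtain h where h: "inj_on h {..<k}" "h ` {..<k} \<subseteq> \<P>"
    using card_le_inj[of "{..<k}" \<P>] P(1) by auto
  show ?thesis
  proof (intro exI[of _ "\<lambda>i. F (h i)"] conjI allI impI)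
    fix i assume "i < k"
    then show "breaking V E A f (F (h i))" using F h(2) by auto
  next
    fix i j assume ij: "i < k" "j < k" "i \<noteq> j"
    then have "h i \<noteq> h j" using h(1) by (auto simp: inj_on_def)
    then show "set (F (h i)) \<inter> set (F (h j)) = {}" using dj h(2) ij by auto
  qed
qed

text \<open>A class with no port over \<open>A\<close> and no port whose twin is in \<open>U\<close>
  would be closed under exchanging levels, hence even. So every class \<open>K\<close> has a
  representative \<open>r K\<close> of one of these two kinds, and different classes are represented
  over different vertices. The vertices of \<open>A\<close> and those under \<open>U\<close> that
  represent no class form the hitting set, which explains the bound
  \<open>card A + card U - card \<K>\<close>.\<close>

lemma hitting_set_if_barrier:
  assumes U: "U \<subseteq> ports" and K: "\<Union>\<K> = ports - U" "pairwise disjnt \<K>" "\<And>K. K \<in> \<K> \<Longrightarrow> odd (card K)"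
    and edges: "\<And>e. e \<in> port_edges \<Longrightarrow> e \<inter> U = {} \<Longrightarrow> \<exists>K\<in>\<K>. e \<subseteq> K"
    and card: "card A + card U \<le> m + card \<K>"
  shows "\<exists>X\<subseteq>V. card X \<le> m \<and> (\<forall>p. breaking V E A f p \<longrightarrow> set p \<inter> X \<noteq> {})"
proof -
  have uniq: "K = K'" if "K \<in> \<K>" "K' \<in> \<K>" "x \<in> K" "x \<in> K'" for K K' x
    using K(2) that unfolding pairwise_def disjnt_def by auto
  have Ksub: "K \<subseteq> ports - U" if "K \<in> \<K>" for K using K(1) that by auto
  have "\<exists>x\<in>K. fst x \<in> A \<or> (fst x, \<not> snd x) \<in> U" if KK: "K \<in> \<K>" for K
  proof (rule ccontr)
    assume no: "\<not> ?thesis"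
    let ?L = "{x \<in> K. snd x}" and ?R = "{x \<in> K. \<not> snd x}"
    let ?s = "\<lambda>x :: 'a \<times> bool. (fst x, \<not> snd x)"
    have sw: "?s x \<in> K" if x: "x \<in> K" for x
    proof -
      have xV: "fst x \<in> V" "fst x \<notin> A" "?s x \<notin> U" "x \<notin> U" using no x Ksub[OF KK] unfolding ports_def by auto
      have "{x, ?s x} \<in> port_edges" using copies_pair[OF xV(1,2), of "snd x"] unfolding port_edges_def by simp
      then obtain K' where "K' \<in> \<K>" "{x, ?s x} \<subseteq> K'" using edges xV(3,4) by (metis Int_insert_left_if0 Int_empty_left)
      then show ?thesis using uniq[of K K' x] KK x by auto
    qed
    have finK: "finite K" using Ksub[OF KK] finite_ports finite_subset by auto
    have "card ?L = card ?R"
    proof (rule bij_betw_same_card)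
      show "bij_betw ?s ?L ?R"
        by (rule bij_betw_byWitness[where f' = ?s]) (auto dest: sw)
    qed
    moreover have "card K = card ?L + card ?R"
      using finK by (subst card_Un_disjoint[symmetric]) (auto intro: arg_cong[where f = card])
    ultimately show False using K(3)[OF KK] by simp
  qed
  then obtain r where r: "\<And>K. K \<in> \<K> \<Longrightarrow> r K \<in> K" "\<And>K. K \<in> \<K> \<Longrightarrow> fst (r K) \<in> A \<or> (fst (r K), \<not> snd (r K)) \<in> U"
    by metis
  have rp: "r K \<in> ports" "r K \<notin> U" if "K \<in> \<K>" for K using r(1) Ksub that by auto
  have r_eq: "x = r K" if KK: "K \<in> \<K>" and x: "x \<in> ports - U" "fst x = fst (r K)" for K x
  proof (rule ccontr)
    assume "x \<noteq> r K"
    then have xs: "x = (fst (r K), \<not> snd (r K))" using x(2) by (cases x; cases "r K") auto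
    then show False using r(2)[OF KK] x(1) rp(1)[OF KK] unfolding ports_def by auto
  qed
  have inj: "inj_on (\<lambda>K. fst (r K)) \<K>"
  proof (rule inj_onI)
    fix K K' assume KK: "K \<in> \<K>" "K' \<in> \<K>" "fst (r K) = fst (r K')"
    then have "r K = r K'" using r_eq[of K' "r K"] rp by auto
    then show "K = K'" using uniq[of K K' "r K"] r(1)[OF KK(1)] r(1)[OF KK(2)] KK by simp
  qed
  define X where "X = (fst ` U \<union> A) - (\<lambda>K. fst (r K)) ` \<K>"
  have finU: "finite U" using U finite_ports finite_subset by auto
  have finA: "finite A" using AV finite_V finite_subset by auto
  have "fst (r K) \<in> fst ` U \<union> A" if "K \<in> \<K>" for K
    using r(2)[OF that] by (metis UnCI fst_conv image_eqI)
  then have rsub: "(\<lambda>K. fst (r K)) ` \<K> \<subseteq> fst ` U \<union> A" by auto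
  then have "card X = card (fst ` U \<union> A) - card \<K>"
    unfolding X_def using card_image[OF inj] finU finA
    by (subst card_Diff_subset) (auto intro: finite_subset)
  moreover have "card (fst ` U \<union> A) \<le> card U + card A"
    using card_Un_le[of "fst ` U" A] card_image_le[OF finU, of fst] by simp
  ultimately have cX: "card X \<le> m" using card by simp
  have XV: "X \<subseteq> V" using U AV unfolding X_def ports_def by auto
  have "set p \<inter> X \<noteq> {}" if br: "breaking V E A f p" for p
  proof
    assume avoid: "set p \<inter> X = {}"
    have p: "distinct p" "set p \<subseteq> V" "2 \<le> length p" "hd p \<in> A" "last p \<in> A" "p \<noteq> []"
      "\<And>i. Suc i < length p \<Longrightarrow> {p ! i, p ! Suc i} \<in> E"
      and pA: "set p \<inter> A \<subseteq> {hd p, last p}" and par: "(f (hd p) = f (last p)) \<longleftrightarrow> even (length p)"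
      using br unfolding breaking_def is_path_def by auto
    define s where "s j = (f (hd p) \<longleftrightarrow> even j)" for j :: nat
    have rep: "\<exists>K\<in>\<K>. v = fst (r K)" if "v \<in> set p" "v \<in> fst ` U \<union> A" for v
      using avoid that unfolding X_def by auto
    have hd0: "hd p = p ! 0" and lastn: "last p = p ! (length p - 1)"
      using p(6) by (simp_all add: hd_conv_nth last_conv_nth)
    text \<open>\<open>(p ! j, s j)\<close> is the port through which the lifted path leaves its vertex number \<open>j\<close>.\<close>
    have inv: "\<exists>K\<in>\<K>. (p ! j, s j) \<in> K \<and> (\<exists>i\<le>j. fst (r K) = p ! i)" if "Suc j < length p" for j
      using that
    proof (induction j)
      case 0
      obtain K where KK: "K \<in> \<K>" "hd p = fst (r K)" using rep[of "hd p"] p(4,6) by auto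
      then have "r K = (hd p, f (hd p))" using rp(1)[OF KK(1)] p(4) unfolding ports_def by (cases "r K") auto
      then have "(p ! 0, s 0) \<in> K" using r(1)[OF KK(1)] hd0 unfolding s_def by auto
      then show ?case using KK hd0 by auto
    next
      case (Suc j)
      then obtain K i where KK: "K \<in> \<K>" "(p ! j, s j) \<in> K" "i \<le> j" "fst (r K) = p ! i" by auto
      let ?v = "p ! Suc j"
      have vin: "?v \<in> set p" using Suc.prems by simp
      have "?v \<noteq> hd p" "?v \<noteq> last p"
        using Suc.prems p(1,6) unfolding hd0 lastn by (simp_all add: nth_eq_iff_index_eq)
      then have vA: "?v \<in> V" "?v \<notin> A" using vin pA p(2) by auto
      have fresh: "fst (r K) \<noteq> ?v" using KK(3,4) Suc.prems p(1) by (simp add: nth_eq_iff_index_eq)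
      have vports: "(?v, b) \<in> ports" for b using vA unfolding ports_def by auto
      have s': "s (Suc j) = (\<not> s j)" unfolding s_def by auto
      have "{p ! j, ?v} \<in> E" using p(7) Suc.prems by simp
      moreover have oj: "(p ! j, s j) \<in> ports" "(p ! j, s j) \<notin> U" using KK(1,2) Ksub by auto
      ultimately have e1: "{(p ! j, s j), (?v, s j)} \<in> port_edges"
        using vports unfolding port_edges_def by blast
      have e2: "{(?v, s j), (?v, \<not> s j)} \<in> port_edges"
        using copies_pair[OF vA] unfolding port_edges_def by auto
      have repU: "\<exists>K'\<in>\<K>. r K' = (?v, \<not> b)" if "(?v, b) \<in> U" for b
      proof -
        have "?v \<in> fst ` U" using that by (force simp: image_iff)
        then obtain K' where K': "K' \<in> \<K>" "?v = fst (r K')" using rep vin by auto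
        then have "r K' \<noteq> (?v, b)" using rp(2) that by auto
        then have "r K' = (?v, \<not> b)" using K'(2) by (cases "r K'") auto
        then show ?thesis using K'(1) by auto
      qed
      \<comment> \<open>If the entry port is in \<open>U\<close>, then \<open>?v\<close>, not being
        in \<open>X\<close>, represents a class whose representative is the exit port, and the path
        continues in that class. Otherwise the path stays in \<open>K\<close>: were the exit port in
        \<open>U\<close>, the entry port would represent \<open>K\<close>, whose representative lies
        over an earlier vertex.\<close>
      show ?case
      proof (cases "(?v, s j) \<in> U")
        case True
        then obtain K' where "K' \<in> \<K>" "r K' = (?v, \<not> s j)" using repU by auto
        then show ?thesis using r(1)[of K'] s' by (intro bexI[of _ K']) auto
      next
        case False
        then obtain K1 where K1: "K1 \<in> \<K>" "{(p ! j, s j), (?v, s j)} \<subseteq> K1" using edges[OF e1] oj by auto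
        then have vK: "(?v, s j) \<in> K" using uniq[OF K1(1) KK(1)] KK(2) by auto
        have "(?v, \<not> s j) \<notin> U"
        proof
          assume "(?v, \<not> s j) \<in> U"
          then obtain K' where K': "K' \<in> \<K>" "r K' = (?v, s j)" using repU[of "\<not> s j"] by auto
          then have "K' = K" using uniq[OF K'(1) KK(1)] r(1)[OF K'(1)] vK by auto
          then show False using K' fresh by auto
        qed
        then obtain K2 where K2: "K2 \<in> \<K>" "{(?v, s j), (?v, \<not> s j)} \<subseteq> K2" using edges[OF e2] False by auto
        then have "(?v, \<not> s j) \<in> K" using uniq[OF K2(1) KK(1)] vK by auto
        then show ?thesis using KK s' by (intro bexI[OF _ KK(1)]) (auto intro: exI[of _ i])
      qed
    qed
    define n where "n = length p - 2"
    have n: "Suc n < length p" "last p = p ! Suc n" "length p = n + 2" using p(3) lastn unfolding n_def by (auto simp: Suc_diff_Suc numeral_2_eq_2)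
    obtain K i where KK: "K \<in> \<K>" "(p ! n, s n) \<in> K" "i \<le> n" "fst (r K) = p ! i" using inv[OF n(1)] by auto
    \<comment> \<open>Because \<open>p\<close> breaks parity, it enters \<open>last p\<close> at
      level \<open>f (last p)\<close>, so through the only port there. The last edge then identifies
      \<open>K\<close> with the class represented by \<open>last p\<close>, although
      \<open>K\<close> is represented by an earlier vertex.\<close>
    obtain K' where K': "K' \<in> \<K>" "last p = fst (r K')" using rep[of "last p"] p(5,6) by auto
    then have rK': "r K' = (last p, f (last p))" using rp(1)[OF K'(1)] p(5) unfolding ports_def by (cases "r K'") auto
    have sn: "s n = f (last p)" using par n(3) unfolding s_def by auto
    have y: "(last p, s n) \<in> ports" "(last p, s n) \<notin> U" using rp[OF K'(1)] rK' sn by auto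
    have oj: "(p ! n, s n) \<in> ports" "(p ! n, s n) \<notin> U" using KK(1,2) Ksub by auto
    have "{p ! n, last p} \<in> E" using p(7)[OF n(1)] n(2) by simp
    then have "{(p ! n, s n), (last p, s n)} \<in> port_edges" using y oj unfolding port_edges_def by blast
    from edges[OF this] obtain K1 where K1: "K1 \<in> \<K>" "{(p ! n, s n), (last p, s n)} \<subseteq> K1"
      using y oj by auto
    then have "K1 = K" "K1 = K'"
      using uniq[OF K1(1) KK(1), of "(p ! n, s n)"] uniq[OF K1(1) K'(1), of "r K'"] r(1)[OF K'(1)] KK(2) rK' sn by auto
    then have "p ! i = p ! Suc n" using KK(4) K'(2) n(2) by simp
    then show False using p(1) n(1) KK(3) by (simp add: nth_eq_iff_index_eq)
  qed
  then show ?thesis using cX XV by auto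
qed

lemma packing_breaking_paths:
  assumes "1 \<le> k"
  shows "(\<exists>P :: nat \<Rightarrow> 'a list. (\<forall>i<k. breaking V E A f (P i)) \<and>
      (\<forall>i<k. \<forall>j<k. i \<noteq> j \<longrightarrow> set (P i) \<inter> set (P j) = {})) \<or>
    (\<exists>X\<subseteq>V. card X \<le> 2 * k - 2 \<and> (\<forall>p. breaking V E A f p \<longrightarrow> set p \<inter> X \<noteq> {}))"
proof -
  obtain U M \<K> where TB: "U \<subseteq> ports" "matching port_edges M" "\<Union>\<K> = ports - U" "pairwise disjnt \<K>"
    "\<And>K. K \<in> \<K> \<Longrightarrow> odd (card K)"
    "\<And>e. e \<in> port_edges \<Longrightarrow> e \<inter> U = {} \<Longrightarrow> \<exists>K\<in>\<K>. e \<subseteq> K"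
    "card ports + card U \<le> 2 * card M + card \<K>"
    using tutte_berge[OF graph_ports] by metis
  show ?thesis
  proof (cases "card (V - A) + k \<le> card M")
    case True
    then show ?thesis using breaking_paths_if_large_matching[OF TB(2)] by simp
  next
    case False
    \<comment> \<open>With \<open>card ports = 2 * card (V - A) + card A\<close>, a matching of at
      most \<open>card (V - A) + k - 1\<close> edges leaves \<open>2 * (k - 1)\<close> in the
      Tutte-Berge inequality.\<close>
    then have "card A + card U \<le> 2 * k - 2 + card \<K>" using TB(7) card_ports assms by simp
    then have "\<exists>X\<subseteq>V. card X \<le> 2 * k - 2 \<and> (\<forall>p. breaking V E A f p \<longrightarrow> set p \<inter> X \<noteq> {})"
      by (intro hitting_set_if_barrier[OF TB(1,3,4) TB(5,6)]) auto
    then show ?thesis by simp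
  qed
qed

end

section \<open>Edges of paths, reachability and colours along paths\<close>

lemma path_edges_Nil [simp]: "path_edges [] = {}"
  unfolding path_edges_def by simp

lemma path_edges_single [simp]: "path_edges [x] = {}"
  unfolding path_edges_def by simp

lemma path_edges_Cons [simp]: "path_edges (x # y # p) = insert {x, y} (path_edges (y # p))"
proof (rule set_eqI)
  fix e
  have "(\<exists>i. e = {(x # y # p) ! i, (x # y # p) ! Suc i} \<and> Suc i < length (x # y # p)) \<longleftrightarrow>
    e = {x, y} \<or> (\<exists>i. e = {(y # p) ! i, (y # p) ! Suc i} \<and> Suc i < length (y # p))" (is "?l \<longleftrightarrow> ?r")
  proof
    assume ?l
    then obtain i where i: "e = {(x # y # p) ! i, (x # y # p) ! Suc i}" "Suc i < length (x # y # p)" by blast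
    then show ?r by (cases i) auto
  next
    assume ?r
    then show ?l by (elim disjE exE) (rule exI[of _ 0], simp, rule_tac x = "Suc i" in exI, simp)
  qed
  then show "e \<in> path_edges (x # y # p) \<longleftrightarrow> e \<in> insert {x, y} (path_edges (y # p))"
    unfolding path_edges_def by simp
qed

lemma path_edges_subset_iff: "path_edges p \<subseteq> F \<longleftrightarrow> successively (\<lambda>x y. {x, y} \<in> F) p"
  by (induction p rule: induct_list012) auto

lemma path_edges_subset_set: "e \<in> path_edges p \<Longrightarrow> e \<subseteq> set p"
  by (induction p rule: induct_list012) auto

lemma path_edges_append:
  "path_edges (xs @ ys) = path_edges xs \<union> path_edges ys \<union>
     (if xs = [] \<or> ys = [] then {} else {{last xs, hd ys}})"
proof (induction xs rule: induct_list012)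
  case (2 x)
  then show ?case by (cases ys) auto
qed auto

lemma path_edges_rev [simp]: "path_edges (rev p) = path_edges p"
  by (induction p rule: induct_list012) (auto simp: path_edges_append insert_commute)

definition reach :: "'a set set \<Rightarrow> 'a \<Rightarrow> 'a \<Rightarrow> bool" where
  "reach F = (\<lambda>x y. {x, y} \<in> F)\<^sup>*\<^sup>*"

lemma reach_refl [simp]: "reach F x x"
  unfolding reach_def by simp

lemma reach_trans: "reach F x y \<Longrightarrow> reach F y z \<Longrightarrow> reach F x z"
  unfolding reach_def by simp

lemma reach_edge: "{x, y} \<in> F \<Longrightarrow> reach F x y"
  unfolding reach_def by auto

lemma reach_sym: "reach F x y \<Longrightarrow> reach F y x"
proof -
  have "symp (\<lambda>x y. {x, y} \<in> F)" by (auto simp: symp_def insert_commute)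
  then show "reach F x y \<Longrightarrow> reach F y x"
    unfolding reach_def by (metis symp_rtranclp sympD)
qed

lemma reach_mono: "reach F x y \<Longrightarrow> F \<subseteq> F' \<Longrightarrow> reach F' x y"
  unfolding reach_def by (rule rtranclp_mono[THEN predicate2D, rotated]) auto

lemma reach_path: "path_edges p \<subseteq> F \<Longrightarrow> x \<in> set p \<Longrightarrow> reach F (hd p) x"
proof (induction p rule: induct_list012)
  case (3 y z zs)
  then show ?case using reach_edge[of y z F] reach_trans[of F y z x] by auto
qed auto

lemma reach_path_two: "path_edges p \<subseteq> F \<Longrightarrow> x \<in> set p \<Longrightarrow> y \<in> set p \<Longrightarrow> reach F x y"
  using reach_path reach_sym reach_trans by metis

lemma del_verts_E_iff [simp]: "e \<in> del_verts_E F X \<longleftrightarrow> e \<in> F \<and> e \<inter> X = {}"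
  unfolding del_verts_E_def by simp

lemma path_edges_del: "path_edges p \<subseteq> F \<Longrightarrow> v \<notin> set p \<Longrightarrow> path_edges p \<subseteq> del_verts_E F {v}"
  using path_edges_subset_set by fastforce

text \<open>A path visits \<open>v\<close> at most once, so from \<open>z\<close> at least one of
  the two directions along it avoids \<open>v\<close>.\<close>

lemma path_escape:
  assumes "distinct p" "z \<in> set p" "z \<noteq> v" "path_edges p \<subseteq> F"
  shows "hd p \<noteq> v \<and> reach (del_verts_E F {v}) z (hd p) \<or> last p \<noteq> v \<and> reach (del_verts_E F {v}) z (last p)"
proof -
  obtain xs ys where p: "p = xs @ z # ys" using assms(2) by (auto simp: in_set_conv_decomp)
  have sub: "path_edges (xs @ [z]) \<subseteq> F" "path_edges (z # ys) \<subseteq> F"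
    using assms(4) unfolding p by (auto simp: path_edges_append split: if_splits)
  show ?thesis
  proof (cases "v \<in> set xs")
    case True
    then have nv: "v \<notin> set (z # ys)" using assms(1,3) p by auto
    have "last (z # ys) \<in> set (z # ys)" by (rule last_in_set) simp
    moreover have "last p = last (z # ys)" using p by simp
    ultimately show ?thesis using reach_path_two[OF path_edges_del[OF sub(2) nv], of z "last p"] nv by auto
  next
    case False
    then have nv: "v \<notin> set (xs @ [z])" using assms(3) by auto
    have "hd (xs @ [z]) \<in> set (xs @ [z])" by (rule hd_in_set) simp
    moreover have "hd p = hd (xs @ [z])" using p by (cases xs) auto
    ultimately show ?thesis using reach_path_two[OF path_edges_del[OF sub(1) nv], of z "hd p"] nv
      by (metis in_set_conv_decomp)
  qed
qed

lemma alternating_colours: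
  fixes g :: "'a \<Rightarrow> bool"
  assumes "successively (\<lambda>x y. g x \<noteq> g y) p" "i < length p"
  shows "(g (p ! i) = g (hd p)) \<longleftrightarrow> even i"
  using assms
proof (induction p arbitrary: i rule: induct_list012)
  case (3 x y zs)
  show ?case
  proof (cases i)
    case (Suc j)
    then have "(g ((y # zs) ! j) = g y) \<longleftrightarrow> even j" using 3 by auto
    moreover have "g x \<noteq> g y" using 3 by simp
    ultimately show ?thesis using Suc by auto
  qed simp
qed auto

lemma alternating_colours_last:
  fixes g :: "'a \<Rightarrow> bool"
  assumes "successively (\<lambda>x y. g x \<noteq> g y) p" "p \<noteq> []"
  shows "(g (hd p) = g (last p)) \<longleftrightarrow> odd (length p)"
proof -
  have "(g (last p) = g (hd p)) \<longleftrightarrow> even (length p - 1)"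
    using alternating_colours[OF assms(1), of "length p - 1"] assms(2) by (simp add: last_conv_nth)
  then show ?thesis using assms(2) by (cases p) auto
qed

lemma path_edge_colours:
  fixes g :: "'a \<Rightarrow> bool"
  shows "successively (\<lambda>x y. g x \<noteq> g y) p \<Longrightarrow> {x, y} \<in> path_edges p \<Longrightarrow> g x \<noteq> g y"
  by (induction p rule: induct_list012) (auto simp: doubleton_eq_iff)

lemma disjoint_family_avoids:
  assumes "finite Y" "card Y < card K"
    and "\<And>c c' z. c \<in> K \<Longrightarrow> c' \<in> K \<Longrightarrow> z \<in> R c \<Longrightarrow> z \<in> R c' \<Longrightarrow> c = c'"
  shows "\<exists>c\<in>K. R c \<inter> Y = {}"
proof (rule ccontr)
  assume "\<not> ?thesis"
  then have "\<forall>c\<in>K. \<exists>z. z \<in> R c \<inter> Y" by auto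
  then obtain g where g: "\<And>c. c \<in> K \<Longrightarrow> g c \<in> R c \<inter> Y" by metis
  have "inj_on g K" using g assms(3) by (metis IntD1 inj_onI)
  then have "card K \<le> card Y" using g assms(1) by (intro card_inj_on_le[of g]) auto
  then show False using assms(2) by simp
qed

section \<open>The subdivision as a system of directed segments\<close>

text \<open>Adjacency in the copy of \<open>K_s + I_t\<close> whose vertex set is \<open>A\<close>
  and whose clique is \<open>C\<close>.\<close>

definition adj :: "'a set \<Rightarrow> 'a set \<Rightarrow> 'a \<Rightarrow> 'a \<Rightarrow> bool" where
  "adj A C u w \<longleftrightarrow> u \<in> A \<and> w \<in> A \<and> u \<noteq> w \<and> (u \<in> C \<or> w \<in> C)"

text \<open>Segments are indexed by ordered pairs of branch vertices, with \<open>Q w u\<close> the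
  reverse of \<open>Q u w\<close>, so that each can be read from either end.\<close>

locale subdivision =
  fixes V :: "'a set" and E :: "'a set set" and A C :: "'a set" and Q :: "'a \<Rightarrow> 'a \<Rightarrow> 'a list"
    and f :: "'a \<Rightarrow> bool" and t :: nat
  assumes G: "graph V E" and t2: "2 \<le> t" and CA: "C \<subseteq> A" and AV: "A \<subseteq> V"
    and card_C: "card C = 2 * t - 2" and card_A: "card A = 3 * t - 2"
    and Q_path: "adj A C u w \<Longrightarrow> is_path V E (Q u w)"
    and Q_hd: "adj A C u w \<Longrightarrow> hd (Q u w) = u"
    and Q_last: "adj A C u w \<Longrightarrow> last (Q u w) = w"
    and Q_rev: "adj A C u w \<Longrightarrow> Q w u = rev (Q u w)"
    and Q_A: "adj A C u w \<Longrightarrow> set (Q u w) \<inter> A = {u, w}"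
    and Q_disjoint: "adj A C u w \<Longrightarrow> adj A C u' w' \<Longrightarrow> {u, w} \<noteq> {u', w'} \<Longrightarrow>
      z \<in> set (Q u w) \<Longrightarrow> z \<in> set (Q u' w') \<Longrightarrow> z \<in> A"
    and Q_colour: "adj A C u w \<Longrightarrow> successively (\<lambda>x y. f x \<noteq> f y) (Q u w)"
begin

lemma finite_V: "finite V"
  using G unfolding graph_def by blast

lemma finite_A: "finite A" and finite_C: "finite C"
  using finite_subset[OF AV finite_V] finite_subset[OF CA] by auto

lemma adj_sym: "adj A C u w \<Longrightarrow> adj A C w u"
  unfolding adj_def by auto

lemma Q_ne: "adj A C u w \<Longrightarrow> Q u w \<noteq> []"
  using Q_path unfolding is_path_def by auto

lemma Q_distinct: "adj A C u w \<Longrightarrow> distinct (Q u w)"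
  using Q_path unfolding is_path_def by auto

lemma Q_edges: "adj A C u w \<Longrightarrow> path_edges (Q u w) \<subseteq> E"
  using Q_path unfolding is_path_iff_successively path_edges_subset_iff by auto

lemma Q_V: "adj A C u w \<Longrightarrow> set (Q u w) \<subseteq> V"
  using Q_path unfolding is_path_def by auto

lemma Q_ends: "adj A C u w \<Longrightarrow> u \<in> set (Q u w)" "adj A C u w \<Longrightarrow> w \<in> set (Q u w)"
  using Q_A by auto

text \<open>There are \<open>2 * t - 2\<close> routes of one or two segments from \<open>u\<close>
  to \<open>w\<close>, disjoint apart from their ends, so \<open>2 * t - 3\<close> vertices cannot
  block them all.\<close>

lemma route:
  assumes Y: "finite Y" "card Y \<le> 2 * t - 3" and uw: "u \<in> A - Y" "w \<in> A - Y" "u \<noteq> w"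
  shows "adj A C u w \<and> set (Q u w) \<inter> Y = {} \<or>
    (\<exists>c. adj A C u c \<and> adj A C c w \<and> set (Q u c) \<inter> Y = {} \<and> set (Q c w) \<inter> Y = {})"
proof -
  \<comment> \<open>\<open>K\<close> lists the routes by their middle vertex; a member of
    \<open>{u, w}\<close> stands for the direct segment. If both ends are in \<open>C\<close>, the
    clique provides only \<open>2 * t - 3\<close> routes, and a vertex \<open>d\<close> outside
    \<open>C\<close> supplies one more.\<close>
  have "\<exists>K. card K = 2 * t - 2 \<and> (\<forall>c\<in>K - {u, w}. adj A C u c \<and> adj A C c w) \<and>
    (K \<inter> {u, w} \<noteq> {} \<longrightarrow> adj A C u w) \<and> \<not> {u, w} \<subseteq> K"
  proof (cases "u \<in> C \<and> w \<in> C")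
    case True
    have "card (A - C) = t" using card_Diff_subset[OF finite_C CA] card_A card_C t2 by simp
    then obtain d where d: "d \<in> A - C" using t2 by (metis card.empty ex_in_conv not_numeral_le_zero)
    have "card (insert d (C - {w})) = 2 * t - 2"
      using d True finite_C card_C t2 by (simp add: card_Diff_singleton)
    then show ?thesis using True uw d CA
      by (intro exI[of _ "insert d (C - {w})"]) (auto simp: adj_def)
  next
    case False
    then show ?thesis using uw CA card_C by (intro exI[of _ C]) (auto simp: adj_def)
  qed
  then obtain K where K: "card K = 2 * t - 2" "\<And>c. c \<in> K - {u, w} \<Longrightarrow> adj A C u c \<and> adj A C c w"
    "K \<inter> {u, w} \<noteq> {} \<Longrightarrow> adj A C u w" "\<not> {u, w} \<subseteq> K" by auto
  define R where "R c = (if c \<in> {u, w} then set (Q u w) else set (Q u c) \<union> set (Q c w)) - {u, w}" for c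
  have R: "\<exists>a b. adj A C a b \<and> z \<in> set (Q a b) \<and> z \<notin> {u, w} \<and>
      ({a, b} = {u, c} \<or> {a, b} = {c, w} \<or> {a, b} = {u, w}) \<and> ({a, b} = {u, w} \<longleftrightarrow> c \<in> {u, w})"
    if c: "c \<in> K" and z: "z \<in> R c" for c z
  proof (cases "c \<in> {u, w}")
    case True
    then have "adj A C u w" using K(3) c by auto
    then show ?thesis using True z unfolding R_def by (intro exI[of _ u] exI[of _ w]) auto
  next
    case False
    then have ac: "adj A C u c" "adj A C c w" using K(2) c by auto
    from False z consider "z \<in> set (Q u c)" "z \<notin> {u, w}" | "z \<in> set (Q c w)" "z \<notin> {u, w}"
      unfolding R_def by auto
    then show ?thesis
    proof cases
      case 1
      then show ?thesis using ac(1) False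
        by (intro exI[of _ u] exI[of _ c]) (auto simp: doubleton_eq_iff)
    next
      case 2
      then show ?thesis using ac(2) False
        by (intro exI[of _ c] exI[of _ w]) (auto simp: doubleton_eq_iff)
    qed
  qed
  have "\<exists>c\<in>K. R c \<inter> Y = {}"
  proof (rule disjoint_family_avoids[OF Y(1)])
    show "card Y < card K" using Y(2) K(1) t2 by simp
    fix c c' z assume *: "c \<in> K" "c' \<in> K" "z \<in> R c" "z \<in> R c'"
    obtain a b where ab: "adj A C a b" "z \<in> set (Q a b)" "z \<notin> {u, w}"
      "{a, b} = {u, c} \<or> {a, b} = {c, w} \<or> {a, b} = {u, w}" "{a, b} = {u, w} \<longleftrightarrow> c \<in> {u, w}"
      using R[OF *(1,3)] by auto
    obtain a' b' where ab': "adj A C a' b'" "z \<in> set (Q a' b')" "z \<notin> {u, w}"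
      "{a', b'} = {u, c'} \<or> {a', b'} = {c', w} \<or> {a', b'} = {u, w}" "{a', b'} = {u, w} \<longleftrightarrow> c' \<in> {u, w}"
      using R[OF *(2,4)] by auto
    show "c = c'"
    proof (rule ccontr)
      assume ne: "c \<noteq> c'"
      have "\<not> (c \<in> {u, w} \<and> c' \<in> {u, w})" using ne * K(4) by auto
      then have "{a, b} \<noteq> {a', b'}"
        using ne ab(4,5) ab'(4,5) uw(3) by (auto simp: doubleton_eq_iff)
      then have "z \<in> A" using Q_disjoint[OF ab(1) ab'(1) _ ab(2) ab'(2)] by simp
      then have "z \<in> {a, b}" "z \<in> {a', b'}" using Q_A[OF ab(1)] Q_A[OF ab'(1)] ab(2) ab'(2) by auto
      then have "z = c" "z = c'" using ab(3,4) ab'(4) by auto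
      then show False using ne by simp
    qed
  qed
  then obtain c where c: "c \<in> K" "R c \<inter> Y = {}" by auto
  show ?thesis
  proof (cases "c \<in> {u, w}")
    case True
    then show ?thesis using c uw K(3) unfolding R_def by auto
  next
    case False
    then have "adj A C u c \<and> adj A C c w" using K(2) c by auto
    moreover have "set (Q u c) \<inter> Y = {}" "set (Q c w) \<inter> Y = {}" using c(2) False uw unfolding R_def by auto
    ultimately show ?thesis by auto
  qed
qed

end

section \<open>The bipartite graph left by a hitting set\<close>

locale hitting = subdivision +
  fixes X :: "'a set"
  assumes XV: "X \<subseteq> V" and card_X: "card X \<le> 2 * t - 4"
    and hit: "breaking V E A f p \<Longrightarrow> set p \<inter> X \<noteq> {}"
begin

definition live :: "'a \<Rightarrow> 'a \<Rightarrow> bool" where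
  "live u w \<longleftrightarrow> adj A C u w \<and> set (Q u w) \<inter> X = {}"

definition "B0 = (A - X) \<union> \<Union>{set (Q u w) | u w. live u w}"

definition "F0 = \<Union>{path_edges (Q u w) | u w. live u w}"

definition fan :: "'a set \<Rightarrow> 'a set set \<Rightarrow> 'a \<Rightarrow> 'a list \<Rightarrow> bool" where
  "fan B F x p \<longleftrightarrow> is_path B F p \<and> hd p = x \<and> set p \<inter> A = {last p}"

text \<open>The last condition is the instance of Menger's theorem that turns a parity breaking ear into a
  parity breaking path between two vertices of \<open>A\<close>; unlike connectivity it is visibly preserved by adding ears.\<close>

definition good :: "'a set \<Rightarrow> 'a set set \<Rightarrow> ('a \<Rightarrow> bool) \<Rightarrow> bool" where
  "good B F g \<longleftrightarrow> subgraph B F (V - X) (del_verts_E E X) \<and> A - X \<subseteq> B \<and>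
     (\<forall>v. \<forall>x\<in>B - {v}. \<forall>y\<in>B - {v}. reach (del_verts_E F {v}) x y) \<and>
     (\<forall>x y. {x, y} \<in> F \<longrightarrow> g x \<noteq> g y) \<and> (\<forall>a\<in>A - X. g a = f a) \<and>
     (\<forall>x\<in>B. \<forall>y\<in>B. x \<noteq> y \<longrightarrow> (\<exists>p q. fan B F x p \<and> fan B F y q \<and> set p \<inter> set q = {}))"

lemma finite_X: "finite X"
  using finite_subset[OF XV finite_V] .

lemma live_B0: "live u w \<Longrightarrow> set (Q u w) \<subseteq> B0"
  unfolding B0_def by auto

lemma live_F0: "live u w \<Longrightarrow> path_edges (Q u w) \<subseteq> F0"
  unfolding F0_def by auto

lemma B0_cases:
  assumes "z \<in> B0"
  obtains "z \<in> A - X" | u w where "live u w" "z \<in> set (Q u w)" "z \<notin> A"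
proof (cases "z \<in> A")
  case True
  then have "z \<notin> X" using assms unfolding B0_def live_def by auto
  then show ?thesis using True that by auto
next
  case False
  then show ?thesis using assms that unfolding B0_def by auto
qed

lemma live_ends: "live u w \<Longrightarrow> u \<in> A - X" "live u w \<Longrightarrow> w \<in> A - X"
  using Q_ends[of u w] unfolding live_def by (auto simp: adj_def)

text \<open>\<open>X\<close> and \<open>v\<close> together have at most \<open>2 * t - 3\<close>
  vertices, so \<open>route\<close> connects the remaining branch vertices; an inner vertex of a
  live segment first escapes along that segment to an end other than \<open>v\<close>.\<close>

lemma B0_reach:
  assumes "x \<in> B0 - {v}" "y \<in> B0 - {v}"
  shows "reach (del_verts_E F0 {v}) x y"
proof -
  let ?F = "del_verts_E F0 {v}"
  have seg: "reach ?F u w" if "adj A C u w" "set (Q u w) \<inter> insert v X = {}" for u w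
  proof -
    have "live u w" using that unfolding live_def by auto
    then have "path_edges (Q u w) \<subseteq> ?F" using path_edges_del[OF live_F0] that(2) by auto
    then show ?thesis using reach_path_two Q_ends that(1) by metis
  qed
  have card: "card (insert v X) \<le> 2 * t - 3" 
  proof -
    have "card (insert v X) \<le> Suc (card X)" using finite_X by (simp add: card_insert_if)
    then show ?thesis using card_X t2 by linarith
  qed
  have AA: "reach ?F u w" if "u \<in> A - insert v X" "w \<in> A - insert v X" for u w
  proof (cases "u = w")
    case False
    from route[OF finite_insert[THEN iffD2, OF finite_X] card that False] show ?thesis
    proof (elim disjE exE conjE)
      fix c assume "adj A C u c" "adj A C c w" "set (Q u c) \<inter> insert v X = {}" "set (Q c w) \<inter> insert v X = {}"
      then show ?thesis using seg[of u c] seg[of c w] reach_trans by metis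
    qed (auto intro: seg)
  qed simp
  have toA: "\<exists>a\<in>A - insert v X. reach ?F z a" if z: "z \<in> B0 - {v}" for z
  proof -
    from z have "z \<in> B0" by simp
    then show ?thesis
    proof (cases rule: B0_cases)
      case 1
      then show ?thesis using z by (intro bexI[of _ z]) auto
    next
      case (2 u w)
      have ad: "adj A C u w" using 2(1) unfolding live_def by simp
      have "u \<noteq> v \<and> reach ?F z u \<or> w \<noteq> v \<and> reach ?F z w"
        using path_escape[OF Q_distinct[OF ad] 2(2) _ live_F0[OF 2(1)], of v] z Q_hd[OF ad] Q_last[OF ad] by auto
      then show ?thesis using live_ends[OF 2(1)] by auto
    qed
  qed
  obtain a where a: "a \<in> A - insert v X" "reach ?F x a" using toA[OF assms(1)] by auto
  obtain b where b: "b \<in> A - insert v X" "reach ?F y b" using toA[OF assms(2)] by auto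
  show ?thesis using reach_trans[OF reach_trans[OF a(2) AA[OF a(1) b(1)]] reach_sym[OF b(2)]] .
qed

lemma fan_singleton: "a \<in> A \<Longrightarrow> a \<in> B \<Longrightarrow> fan B F a [a]"
  unfolding fan_def is_path_def by auto

lemma live_sym: "live u w \<Longrightarrow> live w u"
  unfolding live_def using adj_sym[of u w] Q_rev[of u w] by auto

lemma fan_suffix:
  assumes "live u w" "Q u w = xs @ z # ys" "z \<notin> A"
  shows "fan B0 F0 z (z # ys)" "last (z # ys) = w" "u \<notin> set (z # ys)"
proof -
  have ad: "adj A C u w" using assms unfolding live_def by simp
  note q = assms(2)
  have "xs \<noteq> []" using q Q_hd[OF ad] assms(3) ad unfolding adj_def by (cases xs) auto
  then have u: "u \<in> set xs" using q Q_hd[OF ad] by (cases xs) auto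
  then show nu: "u \<notin> set (z # ys)" using Q_distinct[OF ad] unfolding q by auto
  show w: "last (z # ys) = w" using Q_last[OF ad] q by simp
  have "last (z # ys) \<in> set (z # ys)" by (rule last_in_set) simp
  moreover have "set (z # ys) \<inter> A \<subseteq> {u, w}" using Q_A[OF ad] unfolding q by auto
  ultimately have "set (z # ys) \<inter> A = {last (z # ys)}" using w nu ad unfolding adj_def by auto
  moreover have "path_edges (z # ys) \<subseteq> F0"
    using live_F0[OF assms(1)] unfolding q by (auto simp: path_edges_append split: if_splits)
  moreover have "set (z # ys) \<subseteq> B0" using live_B0[OF assms(1)] q by auto
  moreover have "distinct (z # ys)" using Q_distinct[OF ad] q by auto
  ultimately show "fan B0 F0 z (z # ys)"
    unfolding fan_def is_path_iff_successively path_edges_subset_iff[symmetric] by simp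
qed

lemma fan_prefix:
  assumes "live u w" "Q u w = xs @ z # ys" "z \<notin> A"
  shows "fan B0 F0 z (z # rev xs)" "last (z # rev xs) = u" "w \<notin> set (z # rev xs)"
proof -
  have "Q w u = rev ys @ z # rev xs" using Q_rev[of u w] assms unfolding live_def by simp
  from fan_suffix[OF live_sym[OF assms(1)] this assms(3)]
  show "fan B0 F0 z (z # rev xs)" "last (z # rev xs) = u" "w \<notin> set (z # rev xs)" by auto
qed

text \<open>Each vertex leaves along its own segment, and only the direction has to be chosen. On a
  common segment the two vertices go apart; on different segments the ends reached must
  differ.\<close>

lemma B0_fans:
  assumes "x \<in> B0" "y \<in> B0" "x \<noteq> y"
  shows "\<exists>p q. fan B0 F0 x p \<and> fan B0 F0 y q \<and> set p \<inter> set q = {}"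
proof -
  have off_A: "\<exists>p. fan B0 F0 z p \<and> last p \<in> {u, w} - {a} \<and> set p \<subseteq> set (Q u w) - {a}"
    if lv: "live u w" and z: "z \<in> set (Q u w)" "z \<notin> A" and a: "a \<in> A" for u w z a
  proof -
    obtain xs ys where q: "Q u w = xs @ z # ys" using z(1) by (auto simp: in_set_conv_decomp)
    note p1 = fan_suffix[OF lv q z(2)] and p2 = fan_prefix[OF lv q z(2)]
    have uw: "u \<noteq> w" using lv unfolding live_def adj_def by simp
    show ?thesis
    proof (cases "a = w")
      case True
      then show ?thesis using p2 uw q by (intro exI[of _ "z # rev xs"]) auto
    next
      case False
      have "set (z # ys) \<inter> A = {w}" using p1(1,2) unfolding fan_def by simp
      then have "a \<notin> set (z # ys)" using a False by auto
      then show ?thesis using p1 False q by (intro exI[of _ "z # ys"]) auto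
    qed
  qed
  have mixed: "\<exists>p q. fan B0 F0 x p \<and> fan B0 F0 y q \<and> set p \<inter> set q = {}"
    if "x \<in> A - X" "live u w" "y \<in> set (Q u w)" "y \<notin> A" for x y u w
  proof -
    have "x \<in> A" using \<open>x \<in> A - X\<close> by simp
    then obtain q where q: "fan B0 F0 y q" "set q \<subseteq> set (Q u w) - {x}"
      using off_A[OF \<open>live u w\<close> \<open>y \<in> set (Q u w)\<close> \<open>y \<notin> A\<close>, of x] by auto
    moreover have "fan B0 F0 x [x]" using \<open>x \<in> A - X\<close> by (intro fan_singleton) (auto simp: B0_def)
    ultimately show ?thesis by (intro exI[of _ "[x]"] exI[of _ q]) auto
  qed
  have ordered: "\<exists>p q. fan B0 F0 x p \<and> fan B0 F0 y q \<and> set p \<inter> set q = {}"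
    if lv: "live u w" and q: "Q u w = as @ x # bs @ y # cs" and xy: "x \<notin> A" "y \<notin> A" for x y u w as bs cs
  proof -
    have "distinct (as @ x # bs @ y # cs)" using Q_distinct[of u w] lv q unfolding live_def by simp
    then have "set (x # rev as) \<inter> set (y # cs) = {}" by auto
    moreover have "Q u w = (as @ x # bs) @ y # cs" using q by simp
    ultimately show ?thesis using fan_prefix(1)[OF lv q xy(1)] fan_suffix(1)[OF lv _ xy(2)] by metis
  qed
  show ?thesis
    using assms(1)
  proof (cases rule: B0_cases)
    case x: 1
    show ?thesis using assms(2)
    proof (cases rule: B0_cases)
      case 1
      then show ?thesis using x assms(3)
        by (intro exI[of _ "[x]"] exI[of _ "[y]"]) (auto intro: fan_singleton simp: B0_def)
    next
      case (2 u w)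
      then show ?thesis using mixed[OF x] by auto
    qed
  next
    case x: (2 u w)
    show ?thesis using assms(2)
    proof (cases rule: B0_cases)
      case 1
      then show ?thesis using mixed[OF 1 x] by (metis Int_commute)
    next
      case y: (2 u' w')
      have ad: "adj A C u w" "adj A C u' w'" using x(1) y(1) unfolding live_def by auto
      show ?thesis
      proof (cases "{u, w} = {u', w'}")
        case True
        then have "set (Q u' w') = set (Q u w)" using Q_rev[OF ad(1)] by (auto simp: doubleton_eq_iff)
        then have y': "y \<in> set (Q u w)" using y by simp
        obtain xs ys where q: "Q u w = xs @ x # ys" using x(2) by (auto simp: in_set_conv_decomp)
        show ?thesis
        proof (cases "y \<in> set ys")
          case True
          then obtain bs cs where "ys = bs @ y # cs" by (auto simp: in_set_conv_decomp)
          then show ?thesis using ordered[OF x(1) _ x(3) y(3)] q by simp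
        next
          case False
          then have "y \<in> set xs" using y' q assms(3) by auto
          then obtain bs cs where "xs = bs @ y # cs" by (auto simp: in_set_conv_decomp)
          then have "\<exists>p q. fan B0 F0 y p \<and> fan B0 F0 x q \<and> set p \<inter> set q = {}"
            using ordered[OF x(1) _ y(3) x(3), of bs cs ys] q by simp
          then show ?thesis by (metis Int_commute)
        qed
      next
        case False
        \<comment> \<open>Different segments share at most one end, so one end of the first is not
          an end of the second. Sending \<open>x\<close> there leaves only common vertices in
          \<open>A\<close> to exclude, and the choice of \<open>a\<close> excludes them.\<close>
        obtain a where a: "a \<in> {u, w}" "a \<notin> {u', w'}"
          using False ad unfolding adj_def by auto
        then obtain b where b: "b \<in> {u, w}" "b \<noteq> a" using ad(1) unfolding adj_def by auto
        have bA: "b \<in> A" using b ad unfolding adj_def by auto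
        obtain p where p: "fan B0 F0 x p" "last p \<in> {u, w} - {b}" "set p \<subseteq> set (Q u w) - {b}"
          using off_A[OF x bA] by auto
        have pa: "last p = a" "set p \<inter> A = {a}" using p a(1) b unfolding fan_def by auto
        have "u' \<in> A" using ad unfolding adj_def by auto
        then obtain q where q: "fan B0 F0 y q" "last q \<in> {u', w'} - {u'}" "set q \<subseteq> set (Q u' w') - {u'}"
          using off_A[OF y, of u'] by auto
        have qa: "set q \<inter> A = {last q}" using q(1) unfolding fan_def by simp
        have "set p \<inter> set q = {}"
        proof (rule ccontr)
          assume "set p \<inter> set q \<noteq> {}"
          then obtain z where z: "z \<in> set p" "z \<in> set q" by auto
          then have "z \<in> A" using Q_disjoint[OF ad False, of z] p(3) q(3) by auto
          then have "z = a" "z \<in> {u', w'}" using z pa qa q(2) by auto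
          then show False using a by simp
        qed
        then show ?thesis using p(1) q(1) by auto
      qed
    qed
  qed
qed

end

lemma reach_obtains_path:
  assumes "reach F x y"
  obtains p where "distinct p" "p \<noteq> []" "hd p = x" "last p = y" "path_edges p \<subseteq> F"
proof -
  have "\<exists>p. distinct p \<and> p \<noteq> [] \<and> hd p = x \<and> last p = y \<and> path_edges p \<subseteq> F"
    using assms unfolding reach_def
  proof (induction rule: converse_rtranclp_induct)
    case base
    show ?case by (intro exI[of _ "[y]"]) auto
  next
    case (step x z)
    then obtain p where p: "distinct p" "p \<noteq> []" "hd p = z" "last p = y" "path_edges p \<subseteq> F" by auto
    show ?case
    proof (cases "x \<in> set p")
      case True
      then obtain as bs where as: "p = as @ x # bs" by (auto simp: in_set_conv_decomp)
      then have "path_edges (x # bs) \<subseteq> F" using p(5) by (auto simp: path_edges_append split: if_splits)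
      then show ?thesis using p as by (intro exI[of _ "x # bs"]) auto
    next
      case False
      obtain p' where "p = z # p'" using p(2,3) by (cases p) auto
      then show ?thesis using p False step.hyps(1) by (intro exI[of _ "x # p"]) auto
    qed
  qed
  then show ?thesis using that by (elim exE conjE)
qed

section \<open>Growing the bipartite graph by ears\<close>

context hitting
begin

lemma good_B0: "good B0 F0 f"
proof -
  have sub: "B0 \<subseteq> V - X"
    using AV Q_V unfolding B0_def live_def by blast
  have ed: "e \<subseteq> B0" "e \<in> E" "e \<inter> X = {}" if eF: "e \<in> F0" for e
  proof -
    obtain u w where uw: "live u w" "e \<in> path_edges (Q u w)" using eF unfolding F0_def by auto
    have "e \<subseteq> set (Q u w)" using path_edges_subset_set[OF uw(2)] .
    then show "e \<subseteq> B0" "e \<inter> X = {}" using live_B0[OF uw(1)] uw(1) unfolding live_def by auto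
    show "e \<in> E" using Q_edges[of u w] uw unfolding live_def by auto
  qed
  have "graph B0 F0"
    unfolding graph_def
  proof (intro conjI ballI)
    show "finite B0" using finite_subset[OF sub] finite_V by simp
    fix e assume e: "e \<in> F0"
    obtain u v where "e = {u, v}" "u \<noteq> v" using graph_edgeE[OF G ed(2)[OF e]] .
    then show "\<exists>u v. e = {u, v} \<and> u \<noteq> v \<and> u \<in> B0 \<and> v \<in> B0"
      using ed(1)[OF e] by (intro exI[of _ u] exI[of _ v]) simp
  qed
  then have "subgraph B0 F0 (V - X) (del_verts_E E X)"
    using sub ed(2,3) unfolding subgraph_def by auto
  moreover have "f x \<noteq> f y" if xy: "{x, y} \<in> F0" for x y
  proof -
    obtain u w where uw: "live u w" "{x, y} \<in> path_edges (Q u w)" using xy unfolding F0_def by auto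
    then show ?thesis using path_edge_colours[OF Q_colour uw(2)] unfolding live_def by simp
  qed
  moreover have "A - X \<subseteq> B0" unfolding B0_def by simp
  ultimately show ?thesis
    unfolding good_def using B0_reach B0_fans by simp
qed

lemma card_AX: "t + 2 \<le> card (A - X)"
proof -
  have "card A - card X \<le> card (A - X)" using diff_card_le_card_Diff[OF finite_X, of A] .
  then show ?thesis using card_A card_X t2 by linarith
qed

lemma good_third_vertex:
  assumes "good B F g"
  obtains v where "v \<in> B" "v \<noteq> x" "v \<noteq> y"
proof -
  have "card {x, y} \<le> 2" by (simp add: card_insert_if)
  then have "\<not> A - X \<subseteq> {x, y}" using card_AX t2 card_mono[of "{x, y}" "A - X"] by auto
  then show ?thesis using assms that unfolding good_def by auto
qed

text \<open>\<open>good\<close> records reachability only after the deletion of a vertex; deleting a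
  third vertex also gives plain connectivity.\<close>

lemma good_connected:
  assumes "good B F g"
  shows "connected B F" "no_cut_vertex B F"
proof -
  have r: "reach (del_verts_E F {v}) x y" if "x \<in> B - {v}" "y \<in> B - {v}" for v x y
    using assms that unfolding good_def by simp
  have sub: "del_verts_E F {v} \<subseteq> F" for v by auto
  have "reach F x y" if "x \<in> B" "y \<in> B" for x y
  proof -
    obtain v where "v \<noteq> x" "v \<noteq> y" using good_third_vertex[OF assms] by metis
    then show ?thesis using reach_mono[OF r[of x v y] sub] that by auto
  qed
  moreover have "B \<noteq> {}" using good_third_vertex[OF assms] by auto
  ultimately show "connected B F" unfolding connected_def reach_def[symmetric] by simp
  show "no_cut_vertex B F"
    unfolding no_cut_vertex_def connected_def reach_def[symmetric] using r by auto
qed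

text \<open>A single edge with both ends in \<open>B\<close> is allowed, so that adding ears also
  adds chords.\<close>

definition ear :: "'a set \<Rightarrow> 'a list \<Rightarrow> bool" where
  "ear B p \<longleftrightarrow> is_path (V - X) (del_verts_E E X) p \<and> 2 \<le> length p \<and> hd p \<in> B \<and> last p \<in> B \<and>
     set p \<inter> B \<subseteq> {hd p, last p}"

lemma ear_consistent:
  assumes gd: "good B F g" and er: "ear B p"
  shows "(g (hd p) = g (last p)) \<longleftrightarrow> odd (length p)"
proof (rule ccontr)
  assume odd: "\<not> ?thesis"
  have p: "distinct p" "p \<noteq> []" "set p \<subseteq> V - X" "successively (\<lambda>x y. {x, y} \<in> del_verts_E E X) p"
    "2 \<le> length p" "hd p \<in> B" "last p \<in> B" "set p \<inter> B \<subseteq> {hd p, last p}"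
    using er unfolding ear_def is_path_iff_successively by auto
  obtain x p1 where p1: "p = x # p1" using p(2) by (cases p) auto
  have "p1 \<noteq> []" using p(5) p1 by auto
  then obtain m y where m: "p = x # m @ [y]" using p1 by (metis rev_exhaust)
  have xy: "hd p = x" "last p = y" "x \<noteq> y" using m p(1) by auto
  obtain q r where q: "fan B F x q" and r: "fan B F y r" and qr: "set q \<inter> set r = {}"
    using gd p(6,7) xy unfolding good_def by metis
  have FE: "F \<subseteq> del_verts_E E X" "B \<subseteq> V - X" and AB: "A - X \<subseteq> B"
    using gd unfolding good_def subgraph_def by auto
  have col: "successively (\<lambda>x y. g x \<noteq> g y) q" if "successively (\<lambda>x y. {x, y} \<in> F) q" for q
    using that by (rule successively_mono) (use gd in \<open>auto simp: good_def\<close>)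
  have q': "distinct q" "q \<noteq> []" "set q \<subseteq> B" "successively (\<lambda>x y. {x, y} \<in> F) q" "hd q = x"
    "set q \<inter> A = {last q}"
    using q unfolding fan_def is_path_iff_successively by auto
  have r': "distinct r" "r \<noteq> []" "set r \<subseteq> B" "successively (\<lambda>x y. {x, y} \<in> F) r" "hd r = y"
    "set r \<inter> A = {last r}"
    using r unfolding fan_def is_path_iff_successively by auto
  define P where "P = rev q @ m @ r"
  have mB: "set m \<inter> B = {}" using p(1,8) m by auto
  have dist: "distinct P" unfolding P_def using q'(1,3) r'(1,3) p(1) m mB qr by auto
  have setP: "set P \<subseteq> V - X" unfolding P_def using q'(3) r'(3) FE(2) p(3) m by auto
  have toE: "successively (\<lambda>x y. {x, y} \<in> E) s" if "successively (\<lambda>x y. {x, y} \<in> F) s" for s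
    using that by (rule successively_mono) (use FE in auto)
  have "successively (\<lambda>x y. {x, y} \<in> E) p"
    using p(4) by (rule successively_mono) auto
  then have sp: "successively (\<lambda>x y. {x, y} \<in> E) (x # m @ [y])" using m by simp
  obtain r2 where r2: "r = y # r2" using r'(2,5) by (cases r) auto
  obtain q2 where q2: "q = x # q2" using q'(2,5) by (cases q) auto
  have "successively (\<lambda>x y. {x, y} \<in> E) ((rev q2 @ [x]) @ m @ (y # r2))"
    using sp toE[OF r'(4)] toE[OF q'(4)] unfolding r2 q2
    by (auto simp: successively_append_iff successively_Cons hd_append insert_commute last_rev)
  then have succ: "successively (\<lambda>x y. {x, y} \<in> E) P" unfolding P_def r2 q2 by simp
  have hl: "hd P = last q" "last P = last r" "P \<noteq> []"
    unfolding P_def using q'(2) r'(2) by (auto simp: hd_rev)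
  have "set m \<inter> A = {}" using mB AB p(3) m by auto
  then have PA: "set P \<inter> A = {hd P, last P}"
    unfolding hl unfolding P_def using q'(6) r'(6) by auto
  have inAX: "last q \<in> A - X" "last r \<in> A - X"
    using q'(3,6) r'(3,6) FE(2) q'(2) r'(2) by auto
  then have gf: "g (last q) = f (last q)" "g (last r) = f (last r)" using gd unfolding good_def by auto
  have "(g x = g (last q)) \<longleftrightarrow> odd (length q)" "(g y = g (last r)) \<longleftrightarrow> odd (length r)"
    using alternating_colours_last[OF col[OF q'(4)] q'(2)] alternating_colours_last[OF col[OF r'(4)] r'(2)] q'(5) r'(5) by auto
  moreover have "(g x = g y) \<longleftrightarrow> even (length p)" using odd xy by auto
  \<comment> \<open>The ends of the ear are counted in \<open>p\<close> and in the fans. Hence the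
    lengths differ by \<open>2\<close>, and the parity defect of the ear becomes that of
    \<open>P\<close>; \<open>g\<close> may be replaced by \<open>f\<close> at its ends, which lie in
    \<open>A - X\<close>.\<close>
  moreover have "length P + 2 = length q + length p + length r" unfolding P_def m by simp
  then have "even (length P) \<longleftrightarrow> even (length q + length p + length r)" by presburger
  ultimately have "(f (hd P) = f (last P)) \<longleftrightarrow> even (length P)" unfolding hl using gf by auto
  moreover have "2 \<le> length P" unfolding P_def r2 q2 by simp
  ultimately have "breaking V E A f P"
    unfolding breaking_def is_path_iff_successively using dist setP succ hl inAX PA by auto
  then show False using hit setP by auto
qed

text \<open>Colouring the ear alternately from its head meets the old colour at its last vertex by
  \<open>ear_consistent\<close>. For the fans, an inner vertex of the ear walks to an end of the ear
  and continues along an old fan: towards an end different from the other vertex if that one is in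
  \<open>B\<close>, and in opposite directions if both are inner vertices.\<close>

lemma ear_extend:
  assumes gd: "good B F g" and er: "ear B p"
  shows "\<exists>g'. good (B \<union> set p) (F \<union> path_edges p) g'"
proof -
  let ?B = "B \<union> set p" and ?F = "F \<union> path_edges p"
  have p: "distinct p" "p \<noteq> []" "set p \<subseteq> V - X" "path_edges p \<subseteq> del_verts_E E X"
    "hd p \<in> B" "last p \<in> B" "set p \<inter> B \<subseteq> {hd p, last p}"
    using er unfolding ear_def is_path_iff_successively path_edges_subset_iff by auto
  have sub: "graph B F" "B \<subseteq> V - X" "F \<subseteq> del_verts_E E X" and AB: "A - X \<subseteq> B"
    and rch: "\<And>v x y. x \<in> B - {v} \<Longrightarrow> y \<in> B - {v} \<Longrightarrow> reach (del_verts_E F {v}) x y"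
    and proper: "\<And>x y. {x, y} \<in> F \<Longrightarrow> g x \<noteq> g y"
    and gf: "\<And>a. a \<in> A - X \<Longrightarrow> g a = f a"
    and fans: "\<And>x y. x \<in> B \<Longrightarrow> y \<in> B \<Longrightarrow> x \<noteq> y \<Longrightarrow> \<exists>p q. fan B F x p \<and> fan B F y q \<and> set p \<inter> set q = {}"
    using gd unfolding good_def subgraph_def by auto
  have "graph ?B ?F"
    unfolding graph_def
  proof (intro conjI ballI)
    show "finite ?B" using sub(1) unfolding graph_def by simp
    fix e assume "e \<in> ?F"
    then have e: "e \<in> E" "e \<subseteq> ?B"
      using sub(3) p(4) graph_edge_subset[OF sub(1)] path_edges_subset_set[of e p] by auto
    obtain u v where "e = {u, v}" "u \<noteq> v" using graph_edgeE[OF G e(1)] .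
    then show "\<exists>u v. e = {u, v} \<and> u \<noteq> v \<and> u \<in> ?B \<and> v \<in> ?B"
      using e(2) by (intro exI[of _ u] exI[of _ v]) simp
  qed
  then have S: "subgraph ?B ?F (V - X) (del_verts_E E X)"
    unfolding subgraph_def using sub p by auto
  have R: "reach (del_verts_E ?F {v}) x y" if xy: "x \<in> ?B - {v}" "y \<in> ?B - {v}" for v x y
  proof -
    have toB: "\<exists>b\<in>B - {v}. reach (del_verts_E ?F {v}) z b" if z: "z \<in> ?B - {v}" for z
    proof (cases "z \<in> B")
      case True
      then show ?thesis using z by (intro bexI[of _ z]) auto
    next
      case False
      then have "z \<in> set p" "z \<noteq> v" using z by auto
      from path_escape[OF p(1) this, of ?F] show ?thesis using p(5,6) by auto
    qed
    obtain a where a: "a \<in> B - {v}" "reach (del_verts_E ?F {v}) x a" using toB[OF xy(1)] by auto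
    obtain b where b: "b \<in> B - {v}" "reach (del_verts_E ?F {v}) y b" using toB[OF xy(2)] by auto
    have "reach (del_verts_E ?F {v}) a b" by (rule reach_mono[OF rch[OF a(1) b(1)]]) auto
    then show ?thesis using reach_trans a(2) reach_sym[OF b(2)] by metis
  qed
  define g' where "g' z = (if z \<in> B then g z else (g (hd p) \<longleftrightarrow> even (length (takeWhile (\<lambda>y. y \<noteq> z) p))))" for z
  have idx: "length (takeWhile (\<lambda>y. y \<noteq> p ! i) p) = i" if "i < length p" for i
  proof -
    have "takeWhile (\<lambda>y. y \<noteq> p ! i) p = take i p"
      using p(1) that by (intro takeWhile_eq_take_P_nth) (auto simp: nth_eq_iff_index_eq)
    then show ?thesis using that by simp
  qed
  have g'p: "g' (p ! i) \<longleftrightarrow> (g (hd p) \<longleftrightarrow> even i)" if i: "i < length p" for i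
  proof (cases "p ! i \<in> B")
    case True
    moreover have "p ! i \<in> set p" using i by simp
    ultimately have "p ! i = hd p \<or> p ! i = last p" using p(7) by blast
    then have "i = 0 \<or> i = length p - 1"
      using i p(1,2) by (metis hd_conv_nth last_conv_nth length_greater_0_conv diff_less less_numeral_extra(1) nth_eq_iff_index_eq)
    moreover have "(g (hd p) = g (last p)) \<longleftrightarrow> even (length p - 1)"
      using ear_consistent[OF gd er] p(2) by (cases p) auto
    ultimately show ?thesis using True p(2) unfolding g'_def by (auto simp: hd_conv_nth last_conv_nth)
  next
    case False
    then show ?thesis using idx[OF i] unfolding g'_def by simp
  qed
  have proper': "g' x \<noteq> g' y" if xy: "{x, y} \<in> ?F" for x y
  proof (cases "{x, y} \<in> F")
    case True
    then have "{x, y} \<subseteq> B" using graph_edge_subset[OF sub(1), of "{x, y}"] by simp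
    then show ?thesis using proper[OF True] unfolding g'_def by simp
  next
    case False
    then obtain i where i: "{x, y} = {p ! i, p ! Suc i}" "Suc i < length p"
      using xy unfolding path_edges_def by blast
    have "g' (p ! i) \<noteq> g' (p ! Suc i)" using g'p[of i] g'p[of "Suc i"] i(2) by auto
    then show ?thesis using i(1) by (auto simp: doubleton_eq_iff)
  qed
  have fan_mono: "fan ?B ?F x s" if "fan B F x s" for x s
    using that unfolding fan_def is_path_def by auto
  have fanB: "set s \<subseteq> B" if "fan B F x s" for x s
    using that unfolding fan_def is_path_def by auto
  have ext: "fan ?B ?F z (zs @ s)"
    if s: "fan B F b s" and z: "zs \<noteq> []" "hd zs = z" "set zs \<inter> B = {}" "set zs \<subseteq> set p" "distinct zs"
      and e: "path_edges (zs @ [b]) \<subseteq> path_edges p" for z zs b s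
  proof -
    have s': "s \<noteq> []" "distinct s" "set s \<subseteq> B" "path_edges s \<subseteq> F" "hd s = b" "set s \<inter> A = {last s}"
      using s unfolding fan_def is_path_iff_successively path_edges_subset_iff by auto
    have "path_edges (zs @ s) \<subseteq> ?F"
      using e s'(1,4,5) z(1) by (auto simp: path_edges_append)
    moreover have "set zs \<inter> A = {}" using z(3,4) AB p(3) by auto
    ultimately show ?thesis
      using s' z unfolding fan_def is_path_iff_successively path_edges_subset_iff[symmetric] by auto
  qed
  have hl: "hd p \<noteq> last p" using er p(1) unfolding ear_def by (cases p) auto
  \<comment> \<open>Stated for a list \<open>p'\<close> that traverses the ear in either direction,
    so that it yields both \<open>fwd\<close> and \<open>bwd\<close>.\<close>
  have leave: "fan ?B ?F z ((z # ys) @ s) \<and> set (z # ys) \<inter> B = {}"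
    if p': "distinct p'" "path_edges p' = path_edges p" "set p' = set p" "set p \<inter> B \<subseteq> {hd p', last p'}"
      and d: "p' = as @ z # ys @ [b]" "as \<noteq> []" and s: "fan B F b s" for p' as z ys b s
  proof -
    have ends: "hd p' \<in> set as" "last p' = b" using d by simp_all
    have dist: "distinct (as @ (z # ys) @ [b])" using p'(1) d(1) by simp
    have B: "set (z # ys) \<inter> B = {}"
    proof (rule ccontr)
      assume "set (z # ys) \<inter> B \<noteq> {}"
      then obtain v where v: "v \<in> set (z # ys)" "v \<in> B" by blast
      have "v \<in> set p'" using v(1) d(1) by auto
      then have "v = hd p' \<or> v = b" using v(2) p'(3,4) ends(2) by blast
      then show False using v(1) ends(1) dist by auto
    qed
    have "path_edges ((z # ys) @ [b]) \<subseteq> path_edges p'"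
      unfolding d(1) using path_edges_append[of as "z # ys @ [b]"] by auto
    then have e: "path_edges ((z # ys) @ [b]) \<subseteq> path_edges p" using p'(2) by simp
    have zs: "set (z # ys) \<subseteq> set p" "distinct (z # ys)"
      unfolding p'(3)[symmetric] using p'(1) unfolding d(1) by auto
    have "fan ?B ?F z ((z # ys) @ s)"
      by (rule ext[OF s _ _ B zs e]) simp_all
    then show ?thesis using B by simp
  qed
  have fwd: "fan ?B ?F z ((z # ys) @ s) \<and> set (z # ys) \<inter> B = {}"
    if "p = as @ z # ys @ [b]" "as \<noteq> []" "fan B F b s" for as z ys b s
    by (rule leave[OF p(1) refl refl p(7) that])
  have bwd: "fan ?B ?F z ((z # rev xs) @ s) \<and> set (z # rev xs) \<inter> B = {}"
    if d: "p = a # xs @ z # ys" "ys \<noteq> []" and s: "fan B F a s" for a xs z ys s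
  proof (rule leave[OF _ _ _ _ _ _ s])
    show "distinct (rev p)" using p(1) by simp
    show "path_edges (rev p) = path_edges p" by (rule path_edges_rev)
    show "set p \<inter> B \<subseteq> {hd (rev p), last (rev p)}" using p(2,7) by (simp add: hd_rev last_rev insert_commute)
    show "rev p = rev ys @ z # rev xs @ [a]" using d(1) by simp
  qed (use d(2) in simp_all)
  have dec: "\<exists>a xs ys b. p = a # xs @ z # ys @ [b]" if "z \<in> set p" "z \<notin> B" for z
  proof -
    obtain as bs where ab: "p = as @ z # bs" using \<open>z \<in> set p\<close> by (auto simp: in_set_conv_decomp)
    have "as \<noteq> []" using ab p(5) \<open>z \<notin> B\<close> by (cases as) auto
    then obtain a as' where as: "as = a # as'" by (auto simp: neq_Nil_conv)
    have "bs \<noteq> []" using ab p(6) \<open>z \<notin> B\<close> by (cases bs) auto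
    then obtain bs' b where "bs = bs' @ [b]" by (metis rev_exhaust)
    then show ?thesis using ab as
      by (intro exI[of _ a] exI[of _ as'] exI[of _ bs'] exI[of _ b]) simp
  qed
  have one: "\<exists>q r. fan ?B ?F x q \<and> fan ?B ?F y r \<and> set q \<inter> set r = {}"
    if x: "x \<in> set p" "x \<notin> B" and y: "y \<in> B" for x y
  proof -
    obtain a xs ys b where d: "p = a # xs @ x # ys @ [b]" using dec[OF x] by blast
    have ab: "a \<in> B" "b \<in> B" "a \<noteq> b" using p(5,6) hl d by auto
    show ?thesis
    proof (cases "y = b")
      case False
      obtain s r where sr: "fan B F b s" "fan B F y r" "set s \<inter> set r = {}" using fans[OF ab(2) y] False by auto
      have "fan ?B ?F x ((x # ys) @ s) \<and> set (x # ys) \<inter> B = {}" using fwd[of "a # xs" x ys b s] d sr(1) by simp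
      then show ?thesis using sr fanB[OF sr(2)] fan_mono[OF sr(2)]
        by (intro exI[of _ "(x # ys) @ s"] exI[of _ r]) auto
    next
      case True
      then obtain s r where sr: "fan B F a s" "fan B F y r" "set s \<inter> set r = {}" using fans[OF ab(1) y] ab(3) by auto
      have "fan ?B ?F x ((x # rev xs) @ s) \<and> set (x # rev xs) \<inter> B = {}" using bwd[of a xs x "ys @ [b]" s] d sr(1) by simp
      then show ?thesis using sr fanB[OF sr(2)] fan_mono[OF sr(2)]
        by (intro exI[of _ "(x # rev xs) @ s"] exI[of _ r]) auto
    qed
  qed
  have two: "\<exists>q r. fan ?B ?F x q \<and> fan ?B ?F y r \<and> set q \<inter> set r = {}"
    if d: "p = a # xs @ x # ys @ y # zs @ [b]" for x y a xs ys zs b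
  proof -
    have ab: "a \<in> B" "b \<in> B" "a \<noteq> b" using p(5,6) hl d by auto
    obtain s r where sr: "fan B F a s" "fan B F b r" "set s \<inter> set r = {}" using fans[OF ab] by auto
    have 1: "fan ?B ?F x ((x # rev xs) @ s) \<and> set (x # rev xs) \<inter> B = {}"
      using bwd[of a xs x "ys @ y # zs @ [b]" s] d sr(1) by simp
    have 2: "fan ?B ?F y ((y # zs) @ r) \<and> set (y # zs) \<inter> B = {}"
      using fwd[of "a # xs @ x # ys" y zs b r] d sr(2) by simp
    have "set (x # rev xs) \<inter> set (y # zs) = {}" using p(1) d by auto
    then have "set ((x # rev xs) @ s) \<inter> set ((y # zs) @ r) = {}"
      using 1 2 sr(3) fanB[OF sr(1)] fanB[OF sr(2)] unfolding set_append by blast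
    then show ?thesis using 1 2 by blast
  qed
  have "\<exists>q r. fan ?B ?F x q \<and> fan ?B ?F y r \<and> set q \<inter> set r = {}"
    if x: "x \<in> ?B" and y: "y \<in> ?B" and ne: "x \<noteq> y" for x y
  proof -
    consider "x \<in> B" "y \<in> B" | "x \<in> B" "y \<in> set p" "y \<notin> B" | "x \<in> set p" "x \<notin> B" "y \<in> B"
      | "x \<in> set p" "x \<notin> B" "y \<in> set p" "y \<notin> B" using x y by auto
    then show ?thesis
    proof cases
      case 1
      then obtain q r where "fan B F x q" "fan B F y r" "set q \<inter> set r = {}" using fans ne by blast
      then show ?thesis using fan_mono by blast
    next
      case 2
      then show ?thesis using one[of y x] by (metis Int_commute)
    next
      case 3
      then show ?thesis using one[of x y] by simp
    next
      case 4
      obtain a xs ys b where d: "p = a # xs @ x # ys @ [b]" using dec 4(1,2) by blast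
      have "y \<noteq> a" "y \<noteq> b" using 4(4) p(5,6) d by auto
      then have "y \<in> set xs \<or> y \<in> set ys" using 4(3) d ne by auto
      then show ?thesis
      proof
        assume "y \<in> set ys"
        then obtain cs ds where "ys = cs @ y # ds" by (auto simp: in_set_conv_decomp)
        then show ?thesis using two[of a xs x cs y ds b] d by simp
      next
        assume "y \<in> set xs"
        then obtain cs ds where "xs = cs @ y # ds" by (auto simp: in_set_conv_decomp)
        then show ?thesis using two[of a cs y ds x ys b] d by (simp add: Int_commute) (metis Int_commute)
      qed
    qed
  qed
  then have "good ?B ?F g'"
    unfolding good_def using S AB R proper' gf by (auto simp: g'_def)
  then show ?thesis by blast
qed

text \<open>With equal vertex sets a new edge is an ear. Otherwise some edge \<open>{x, z}\<close>
  leaves \<open>B\<close>; since \<open>x\<close> is not a cut vertex of the larger graph,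
  \<open>z\<close> is connected to the rest of \<open>B\<close> without using \<open>x\<close>, and
  the first return to \<open>B\<close> closes an ear.\<close>

lemma ear_of_larger_block:
  assumes gd: "good B F g" and sub: "subgraph B' F' (V - X) (del_verts_E E X)"
    and larger: "B \<subseteq> B'" "F \<subseteq> F'" "(B, F) \<noteq> (B', F')" and conn: "connected B' F'" "no_cut_vertex B' F'"
  obtains p where "ear B p" "\<not> (set p \<subseteq> B \<and> path_edges p \<subseteq> F)"
proof -
  have gr: "graph B' F'" "B' \<subseteq> V - X" "F' \<subseteq> del_verts_E E X" using sub unfolding subgraph_def by auto
  show ?thesis
  proof (cases "B' = B")
    case True
    then obtain e where e: "e \<in> F'" "e \<notin> F" using larger by auto
    obtain x y where xy: "e = {x, y}" "x \<noteq> y" "x \<in> B'" "y \<in> B'" using graph_edgeE[OF gr(1) e(1)] .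
    have "ear B [x, y]"
      unfolding ear_def is_path_iff_successively using xy True e gr by auto
    then show ?thesis using that[of "[x, y]"] e(2) xy by simp
  next
    case False
    then obtain y where y: "y \<in> B'" "y \<notin> B" using larger by auto
    obtain x0 where x0: "x0 \<in> B" using good_third_vertex[OF gd] by metis
    have "reach F' x0 y" using conn(1) x0 y larger unfolding connected_def reach_def by auto
    then obtain q where q: "q \<noteq> []" "hd q = x0" "last q = y" "path_edges q \<subseteq> F'" using reach_obtains_path by metis
    have "\<exists>x z. x \<in> B \<and> z \<notin> B \<and> {x, z} \<in> F'" using q x0 y(2)
    proof (induction q arbitrary: x0 rule: induct_list012)
      case (3 u v zs)
      then show ?case by (cases "v \<in> B") auto
    qed auto
    then obtain x z where xz: "x \<in> B" "z \<notin> B" "{x, z} \<in> F'" by blast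
    have xz': "x \<in> B'" "z \<in> B'" "x \<noteq> z" using graph_edge_subset[OF gr(1) xz(3)] xz by auto
    obtain b where b: "b \<in> B" "b \<noteq> x" using good_third_vertex[OF gd] by metis
    have "connected (B' - {x}) (del_verts_E F' {x})"
    proof -
      have "B' - {x} = {} \<or> connected (B' - {x}) (del_verts_E F' {x})"
        using conn(2) xz'(1) unfolding no_cut_vertex_def by simp
      then show ?thesis using xz'(2,3) by auto
    qed
    then have "reach (del_verts_E F' {x}) z b"
      using xz' b larger(1) unfolding connected_def reach_def by auto
    then obtain q where q: "distinct q" "q \<noteq> []" "hd q = z" "last q = b" "path_edges q \<subseteq> del_verts_E F' {x}"
      using reach_obtains_path by metis
    have "\<exists>w\<in>set q. w \<in> B" using q b by (metis last_in_set)
    then obtain as w bs where w: "q = as @ w # bs" "w \<in> B" "\<forall>v\<in>set as. v \<notin> B"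
      by (rule split_list_first_propE) (rule that)
    have "as \<noteq> []" using w q(3) xz(2) by (cases as) auto
    define p where "p = x # as @ [w]"
    have qa: "path_edges (as @ [w]) \<subseteq> del_verts_E F' {x}"
      using q(5) unfolding w(1) using \<open>as \<noteq> []\<close> by (auto simp: path_edges_append)
    have xas: "x \<notin> set (as @ [w])"
    proof
      assume "x \<in> set (as @ [w])"
      then obtain cs ds where cd: "as @ [w] = cs @ x # ds" by (auto simp: in_set_conv_decomp)
      have "cs \<noteq> []" using cd xz' q(3) w(1) by (cases cs; cases as) auto
      then have "{last cs, x} \<in> path_edges (as @ [w])" unfolding cd by (simp add: path_edges_append)
      then show False using qa by auto
    qed
    have hdas: "hd (as @ [w]) = z" using q(3) w(1) \<open>as \<noteq> []\<close> by simp
    then have pe: "path_edges p \<subseteq> F'"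
      using qa xz(3) \<open>as \<noteq> []\<close> unfolding p_def by (cases as) auto
    have "set p \<subseteq> B'"
    proof
      fix v assume "v \<in> set p"
      then have "reach F' x v" using reach_path[OF pe] unfolding p_def by simp
      then obtain r where r: "r \<noteq> []" "hd r = x" "last r = v" "path_edges r \<subseteq> F'" using reach_obtains_path by metis
      show "v \<in> B'"
      proof (cases "tl r = []")
        case True
        then show ?thesis using r xz' by (cases r) auto
      next
        case False
        then obtain r' u where "r = r' @ [u, v]" using r(1,3)
          by (metis append_butlast_last_id append.assoc append_Cons append_Nil butlast_tl last_tl list.collapse butlast.simps(2))
        then have "{u, v} \<in> F'" using r(4) by (auto simp: path_edges_append)
        then show ?thesis using graph_edge_subset[OF gr(1)] by auto
      qed
    qed
    moreover have "successively (\<lambda>x y. {x, y} \<in> del_verts_E E X) p"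
      using pe gr(3) unfolding path_edges_subset_iff[symmetric] by simp
    moreover have "distinct p" using xas q(1) w(1) unfolding p_def by auto
    moreover have "set p \<inter> B \<subseteq> {hd p, last p}" using w(3) unfolding p_def by auto
    ultimately have "ear B p"
      unfolding ear_def is_path_iff_successively using gr(2) xz(1) w(2) by (auto simp: p_def)
    moreover have "z \<in> set p" using hdas \<open>as \<noteq> []\<close> unfolding p_def by auto
    ultimately show ?thesis using that[of p] xz(2) by auto
  qed
qed

text \<open>A good graph maximising \<open>card B + card F\<close> replaces the iteration. Edges are
  counted as well, because a chord enlarges the graph without adding a vertex;
  \<open>B0 \<subseteq> B\<close> is kept for the size bound.\<close>

lemma bipartite_block:
  "\<exists>B F. is_block B F (V - X) (del_verts_E E X) \<and> bipartite B F \<and> B0 \<subseteq> B"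
proof -
  let ?P = "\<lambda>s. (\<exists>g. good (fst s) (snd s) g) \<and> B0 \<subseteq> fst s"
  let ?m = "\<lambda>s. card (fst s) + card (snd s)"
  have finE: "finite E" using graph_finite_edges[OF G] .
  have fin: "finite B" "finite F" "B \<subseteq> V" "F \<subseteq> E" if "good B F g" for B F g
  proof -
    show "B \<subseteq> V" "F \<subseteq> E" using that unfolding good_def subgraph_def by auto
    then show "finite B" "finite F" using finite_V finE finite_subset by auto
  qed
  have bound: "\<forall>s. ?P s \<longrightarrow> ?m s < Suc (card V + card E)"
  proof (intro allI impI)
    fix s assume "?P s"
    then obtain g where g: "good (fst s) (snd s) g" by auto
    show "?m s < Suc (card V + card E)"
      using card_mono[OF finite_V fin(3)[OF g]] card_mono[OF finE fin(4)[OF g]] by simp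
  qed
  have P0: "?P (B0, F0)" using good_B0 by auto
  obtain s where "?P s \<and> (\<forall>s'. ?P s' \<longrightarrow> ?m s' \<le> ?m s)"
    using ex_has_greatest_nat[of ?P "(B0, F0)" ?m "Suc (card V + card E)", OF P0 bound]
    by (rule exE)
  then have s: "?P s" "\<forall>s'. ?P s' \<longrightarrow> ?m s' \<le> ?m s" by auto
  obtain B F where sB: "s = (B, F)" by (cases s)
  then obtain g where gd: "good B F g" and B0: "B0 \<subseteq> B" using s(1) by auto
  have "is_block B F (V - X) (del_verts_E E X)"
    unfolding is_block_def
  proof (intro conjI good_connected[OF gd] notI)
    show "subgraph B F (V - X) (del_verts_E E X)" using gd unfolding good_def by simp
    assume "\<exists>B' F'. subgraph B' F' (V - X) (del_verts_E E X) \<and> B \<subseteq> B' \<and> F \<subseteq> F' \<and> (B, F) \<noteq> (B', F') \<and>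
      connected B' F' \<and> no_cut_vertex B' F'"
    then obtain B' F' where *: "subgraph B' F' (V - X) (del_verts_E E X)" "B \<subseteq> B'" "F \<subseteq> F'" "(B, F) \<noteq> (B', F')"
      "connected B' F'" "no_cut_vertex B' F'" by (elim exE conjE) (rule that)
    obtain p where p: "ear B p" "\<not> (set p \<subseteq> B \<and> path_edges p \<subseteq> F)"
      using ear_of_larger_block[OF gd *] .
    obtain g' where g': "good (B \<union> set p) (F \<union> path_edges p) g'" using ear_extend[OF gd p(1)] by auto
    then have "card (B \<union> set p) + card (F \<union> path_edges p) \<le> card B + card F"
      using s(2)[rule_format, of "(B \<union> set p, F \<union> path_edges p)"] B0 sB by auto
    moreover have "card B \<le> card (B \<union> set p)" "card F \<le> card (F \<union> path_edges p)"
      using fin(1,2)[OF g'] by (auto intro: card_mono)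
    ultimately have "card (B \<union> set p) = card B" "card (F \<union> path_edges p) = card F" by auto
    then have "B \<union> set p = B" "F \<union> path_edges p = F"
      using card_subset_eq[OF fin(1)[OF g'], of B] card_subset_eq[OF fin(2)[OF g'], of F] by auto
    then show False using p(2) by blast
  qed
  moreover have "\<forall>x y. {x, y} \<in> F \<longrightarrow> g x \<noteq> g y" using gd unfolding good_def by simp
  then have "bipartite B F" unfolding bipartite_def by (intro exI[of _ g]) simp
  ultimately show ?thesis using B0 by blast
qed

text \<open>\<open>3 * t - 2 - (2 * t - 4)\<close> is \<open>t + 2\<close>, one too few. If
  \<open>A - X\<close> is no larger, then \<open>X \<subseteq> A\<close>, so every segment between
  surviving branch vertices is live. Two survivors in \<open>C\<close> and a third vertex are then
  pairwise joined by segments; two of the three have the same colour, so not all three segments are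
  single edges, and an inner vertex is the one still missing.\<close>

lemma card_B0: "t + 3 \<le> card B0"
proof (cases "t + 3 \<le> card (A - X)")
  case True
  have "finite B0" using good_B0 unfolding good_def subgraph_def graph_def by auto
  then have "card (A - X) \<le> card B0" by (intro card_mono) (auto simp: B0_def)
  then show ?thesis using True by simp
next
  case False
  have finB0: "finite B0" using good_B0 unfolding good_def subgraph_def graph_def by auto
  have XA: "X \<subseteq> A"
  proof (rule ccontr)
    assume "\<not> X \<subseteq> A"
    then have "A \<inter> X \<subset> X" by auto
    then have "card (A \<inter> X) < card X" using finite_X psubset_card_mono by blast
    then show False using False card_Diff_subset_Int[of A X] finite_X card_A card_X t2 by simp
  qed
  have "card (C - X) \<ge> 2"
    using diff_card_le_card_Diff[OF finite_X, of C] card_C card_X t2 by linarith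
  then obtain T where T: "T \<subseteq> C - X" "card T = 2" using obtain_subset_with_card_n[of 2 "C - X"] by metis
  then obtain c1 c2 where c: "c1 \<in> C - X" "c2 \<in> C - X" "c1 \<noteq> c2" by (auto simp: card_2_iff)
  have "\<not> A - X \<subseteq> {c1, c2}" using card_AX t2 c(3) card_mono[of "{c1, c2}" "A - X"] by auto
  then obtain d where d: "d \<in> A - X" "d \<noteq> c1" "d \<noteq> c2" by auto
  have lv: "live u w" if "adj A C u w" "u \<notin> X" "w \<notin> X" for u w
    using Q_A[OF that(1)] that XA unfolding live_def by auto
  have live3: "live c1 c2" "live c1 d" "live c2 d" using c d CA by (auto intro!: lv simp: adj_def)
  have short: "f u \<noteq> f w" if "live u w" "set (Q u w) \<subseteq> A" for u w
  proof -
    have ad: "adj A C u w" using that(1) unfolding live_def by simp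
    have ne: "u \<noteq> w" using ad unfolding adj_def by simp
    have "set (Q u w) = {u, w}" using Q_A[OF ad] that(2) by auto
    then have "length (Q u w) = 2" using distinct_card[OF Q_distinct[OF ad]] ne by simp
    then show ?thesis
      using alternating_colours_last[OF Q_colour[OF ad] Q_ne[OF ad]] Q_hd[OF ad] Q_last[OF ad] by simp
  qed
  have "\<exists>u w. live u w \<and> \<not> set (Q u w) \<subseteq> A"
    using short[OF live3(1)] short[OF live3(2)] short[OF live3(3)] live3 by blast
  then obtain u w z where z: "live u w" "z \<in> set (Q u w)" "z \<notin> A" by auto
  then have "insert z (A - X) \<subseteq> B0" unfolding B0_def by auto
  then have "card (insert z (A - X)) \<le> card B0" using finB0 card_mono by blast
  then show ?thesis using z(3) finite_A card_AX by simp
qed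

end

section \<open>Building odd minors from connected vertex sets\<close>

text \<open>A connected spanning edge set of least cardinality has no cycle, because the closing
  edge of a cycle can be replaced by the rest of it.\<close>

lemma spanning_tree:
  assumes gr: "graph T D" and conn: "connected T D"
  obtains D' where "D' \<subseteq> D" "is_tree T D'"
proof -
  let ?P = "\<lambda>D'. D' \<subseteq> D \<and> connected T D'"
  have "\<exists>D'. ?P D' \<and> (\<forall>D''. ?P D'' \<longrightarrow> card D' \<le> card D'')"
    using ex_has_least_nat[of ?P D card] conn by simp
  then obtain D' where "?P D' \<and> (\<forall>D''. ?P D'' \<longrightarrow> card D' \<le> card D'')" by (rule exE)
  then have D': "D' \<subseteq> D" "connected T D'" and least: "\<forall>D''. ?P D'' \<longrightarrow> card D' \<le> card D''" by simp_all
  have fin: "finite D'" using finite_subset[OF D'(1) graph_finite_edges[OF gr]] .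
  have "\<not> is_cycle T D' c" for c
  proof
    assume "is_cycle T D' c"
    then have c: "3 \<le> length c" "distinct c" "path_edges c \<subseteq> D'" "{last c, hd c} \<in> D'" "c \<noteq> []"
      unfolding is_cycle_def is_path_iff_successively path_edges_subset_iff by auto
    let ?e = "{last c, hd c}"
    have "?e \<notin> path_edges c"
    proof
      assume "?e \<in> path_edges c"
      then obtain i where i: "?e = {c ! i, c ! Suc i}" "Suc i < length c" unfolding path_edges_def by blast
      have l: "last c = c ! (length c - 1)" "hd c = c ! 0" using c(5) by (simp_all add: last_conv_nth hd_conv_nth)
      have len: "length c - 1 < length c" "0 < length c" "i < length c" using i(2) by auto
      from i(1) consider "last c = c ! i" "hd c = c ! Suc i" | "last c = c ! Suc i" "hd c = c ! i"
        by (auto simp: doubleton_eq_iff)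
      then show False
      proof cases
        case 1
        then show False using nth_eq_iff_index_eq[OF c(2) len(2) i(2)] l by simp
      next
        case 2
        then have "i = 0" "length c - 1 = Suc i"
          using nth_eq_iff_index_eq[OF c(2) len(2,3)] nth_eq_iff_index_eq[OF c(2) len(1) i(2)] l by simp_all
        then show False using c(1) by simp
      qed
    qed
    then have sub: "path_edges c \<subseteq> D' - {?e}" using c(3) by auto
    have step: "reach (D' - {?e}) x y" if "{x, y} \<in> D'" for x y
    proof (cases "{x, y} = ?e")
      case True
      then have "x \<in> set c" "y \<in> set c" using c(5) by (auto simp: doubleton_eq_iff)
      then show ?thesis by (rule reach_path_two[OF sub])
    next
      case False
      then show ?thesis using that by (intro reach_edge) auto
    qed
    have "reach (D' - {?e}) x y" if "reach D' x y" for x y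
      using that unfolding reach_def[of D']
    proof (induction rule: rtranclp_induct)
      case (step y z)
      then show ?case using \<open>\<And>y x. {x, y} \<in> D' \<Longrightarrow> reach (D' - {?e}) x y\<close>[of y z] reach_trans by metis
    qed simp
    then have "connected T (D' - {?e})" using D'(2) unfolding connected_def reach_def[symmetric] by auto
    moreover have "D' - {?e} \<subseteq> D" using D'(1) by auto
    ultimately have "card D' \<le> card (D' - {?e})" using least by simp
    then show False using c(4) fin by (metis card_Diff1_less not_le)
  qed
  moreover have "graph T D'" using gr D'(1) unfolding graph_def by auto
  ultimately show ?thesis using that[of D'] D' unfolding is_tree_def by auto
qed

definition bichromatic :: "'a set set \<Rightarrow> ('a \<Rightarrow> bool) \<Rightarrow> 'a set \<Rightarrow> 'a set set" where
  "bichromatic E \<alpha> T = {e \<in> E. e \<subseteq> T \<and> (\<forall>x y. e = {x, y} \<longrightarrow> \<alpha> x \<noteq> \<alpha> y)}"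

lemma bichromaticI: "{x, y} \<in> E \<Longrightarrow> x \<in> T \<Longrightarrow> y \<in> T \<Longrightarrow> \<alpha> x \<noteq> \<alpha> y \<Longrightarrow> {x, y} \<in> bichromatic E \<alpha> T"
  unfolding bichromatic_def by (auto simp: doubleton_eq_iff)

text \<open>Trees need not be constructed: it suffices that each vertex set is connected by its
  bichromatic edges, as any spanning tree of these is properly coloured.\<close>

lemma odd_Kt_minorI:
  assumes G: "graph V E"
    and T: "\<And>i. i < t \<Longrightarrow> T i \<subseteq> V" "\<And>i. i < t \<Longrightarrow> connected (T i) (bichromatic E \<alpha> (T i))"
    and disj: "\<And>i j. i < t \<Longrightarrow> j < t \<Longrightarrow> i \<noteq> j \<Longrightarrow> T i \<inter> T j = {}"
    and mono: "\<And>i j. i < t \<Longrightarrow> j < t \<Longrightarrow> i \<noteq> j \<Longrightarrow> \<exists>x\<in>T i. \<exists>y\<in>T j. {x, y} \<in> E \<and> \<alpha> x = \<alpha> y"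
  shows "odd_Kt_minor V E t"
proof -
  have "\<exists>D'. D' \<subseteq> bichromatic E \<alpha> (T i) \<and> is_tree (T i) D'" if i: "i < t" for i
  proof -
    have "graph (T i) (bichromatic E \<alpha> (T i))"
      unfolding graph_def
    proof (intro conjI ballI)
      show "finite (T i)" using T(1)[OF i] G finite_subset unfolding graph_def by auto
      fix e assume "e \<in> bichromatic E \<alpha> (T i)"
      then have e: "e \<in> E" "e \<subseteq> T i" unfolding bichromatic_def by auto
      obtain u v where "e = {u, v}" "u \<noteq> v" using graph_edgeE[OF G e(1)] .
      then show "\<exists>u v. e = {u, v} \<and> u \<noteq> v \<and> u \<in> T i \<and> v \<in> T i"
        using e(2) by (intro exI[of _ u] exI[of _ v]) simp
    qed
    from spanning_tree[OF this T(2)[OF i]] show ?thesis by metis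
  qed
  then obtain TE where TE: "\<And>i. i < t \<Longrightarrow> TE i \<subseteq> bichromatic E \<alpha> (T i)" "\<And>i. i < t \<Longrightarrow> is_tree (T i) (TE i)"
    by metis
  have sub: "subgraph (T i) (TE i) V E" if "i < t" for i
    using TE(1)[OF that] TE(2)[OF that] T(1)[OF that] unfolding subgraph_def is_tree_def bichromatic_def by auto
  have col: "\<alpha> x \<noteq> \<alpha> y" if "i < t" "{x, y} \<in> TE i" for i x y
  proof -
    have "{x, y} \<in> bichromatic E \<alpha> (T i)" using TE(1)[OF that(1)] that(2) by (rule subsetD)
    then show ?thesis unfolding bichromatic_def by blast
  qed
  show ?thesis
    unfolding odd_Kt_minor_def
    by (intro exI[of _ T] exI[of _ TE] exI[of _ \<alpha>]) (simp add: TE(2) sub disj mono col)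
qed

lemma breaking_rev: "breaking V E A f p \<Longrightarrow> breaking V E A f (rev p)"
  unfolding breaking_def is_path_iff_successively
  by (auto simp: hd_rev last_rev insert_commute)

text \<open>The indices in \<open>J\<close> are served first, from \<open>U \<inter> C\<close>; the
  others are distributed over what remains of \<open>U\<close>.\<close>

lemma injection_with_constraint:
  fixes U C :: "'a set"
  assumes U: "finite U" "card U = t" and J: "J \<subseteq> {..<t}" "card J \<le> card (U \<inter> C)"
  obtains u :: "nat \<Rightarrow> 'a" where "inj_on u {..<t}" "u ` {..<t} \<subseteq> U" "u ` J \<subseteq> C"
proof -
  have finJ: "finite J" using J(1) finite_subset by auto
  obtain h1 where h1: "inj_on h1 J" "h1 ` J \<subseteq> U \<inter> C"
    using card_le_inj[OF finJ _ J(2)] U(1) by auto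
  have "card (h1 ` J) = card J" using card_image[OF h1(1)] .
  then have "card ({..<t} - J) \<le> card (U - h1 ` J)"
    using card_Diff_subset[OF finJ J(1)] card_Diff_subset[of "h1 ` J" U] finJ h1(2) U(2) by auto
  then obtain h2 where h2: "inj_on h2 ({..<t} - J)" "h2 ` ({..<t} - J) \<subseteq> U - h1 ` J"
    using card_le_inj[of "{..<t} - J" "U - h1 ` J"] U(1) by auto
  define u where "u i = (if i \<in> J then h1 i else h2 i)" for i
  have "inj_on u {..<t}"
  proof (rule inj_onI)
    fix i j assume ij: "i \<in> {..<t}" "j \<in> {..<t}" "u i = u j"
    consider "i \<in> J" "j \<in> J" | "i \<in> J" "j \<notin> J" | "i \<notin> J" "j \<in> J" | "i \<notin> J" "j \<notin> J" by blast
    then show "i = j"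
    proof cases
      case 1
      then show ?thesis using ij(3) h1(1) unfolding u_def by (auto dest: inj_onD)
    next
      case 2
      then have "h2 j \<in> U - h1 ` J" using h2(2) ij(2) by blast
      then have "h1 i \<noteq> h2 j" using 2(1) by (metis DiffD2 imageI)
      then show ?thesis using 2 ij(3) unfolding u_def by simp
    next
      case 3
      then have "h2 i \<in> U - h1 ` J" using h2(2) ij(1) by blast
      then have "h1 j \<noteq> h2 i" using 3(2) by (metis DiffD2 imageI)
      then show ?thesis using 3 ij(3) unfolding u_def by simp
    next
      case 4
      then show ?thesis using ij h2(1) unfolding u_def by (auto dest: inj_onD)
    qed
  qed
  moreover have "u ` {..<t} \<subseteq> U" using h1(2) h2(2) unfolding u_def by auto
  moreover have "u ` J \<subseteq> C" using h1(2) unfolding u_def by auto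
  ultimately show ?thesis by (rule that)
qed

section \<open>Minimal linkages and the odd minor\<close>

context subdivision
begin

definition linkage :: "(nat \<Rightarrow> 'a list) \<Rightarrow> bool" where
  "linkage P \<longleftrightarrow> (\<forall>i<t - 1. breaking V E A f (P i)) \<and>
     (\<forall>i<t - 1. \<forall>j<t - 1. i \<noteq> j \<longrightarrow> set (P i) \<inter> set (P j) = {})"

definition "sub_edges = \<Union>{path_edges (Q u w) | u w. adj A C u w}"

definition weight :: "(nat \<Rightarrow> 'a list) \<Rightarrow> nat" where
  "weight P = (\<Sum>i<t - 1. card (path_edges (P i) - sub_edges))"

definition covered :: "(nat \<Rightarrow> 'a list) \<Rightarrow> 'a set" where
  "covered P = (\<Union>i<t - 1. set (P i))"

definition minimal :: "(nat \<Rightarrow> 'a list) \<Rightarrow> bool" where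
  "minimal P \<longleftrightarrow> linkage P \<and> (\<forall>P'. linkage P' \<longrightarrow> weight P \<le> weight P')"

lemma sub_edges_stay:
  assumes "adj A C u w" "v \<in> set (Q u w)" "v \<notin> A" "{v, v'} \<in> sub_edges"
  shows "v' \<in> set (Q u w)"
proof -
  obtain a b where ab: "adj A C a b" "{v, v'} \<in> path_edges (Q a b)" using assms(4) unfolding sub_edges_def by auto
  then have vv: "v \<in> set (Q a b)" "v' \<in> set (Q a b)" using path_edges_subset_set[OF ab(2)] by auto
  have "{u, w} = {a, b}" using Q_disjoint[OF assms(1) ab(1) _ assms(2) vv(1)] assms(3) by auto
  then have "set (Q a b) = set (Q u w)" using Q_rev[OF assms(1)] by (auto simp: doubleton_eq_iff)
  then show ?thesis using vv by simp
qed

text \<open>An inner vertex of a segment lies on no other segment, so a path inside the subdivision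
  can leave a segment only at a branch vertex.\<close>

lemma sub_path_stays:
  assumes ad: "adj A C u w"
  shows "path_edges p \<subseteq> sub_edges \<Longrightarrow> p \<noteq> [] \<Longrightarrow> hd p \<in> set (Q u w) \<Longrightarrow> set (butlast p) \<inter> A = {} \<Longrightarrow>
    last p \<in> set (Q u w)"
proof (induction p rule: induct_list012)
  case (3 x y zs)
  then have "y \<in> set (Q u w)" using sub_edges_stay[OF ad, of x y] by auto
  then show ?case using 3 by auto
qed auto

text \<open>The part of \<open>p\<close> before \<open>x\<close> breaks parity, so rerouting \<open>p\<close> from \<open>x\<close> to \<open>u\<close> along \<open>Q u w\<close> gives another
  linkage; by minimality the discarded part of \<open>p\<close> runs inside the subdivision.\<close>

lemma minimal_reroute:
  assumes min: "minimal P" and k: "k < t - 1" and p: "p = P k \<or> p = rev (P k)"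
    and u: "u \<notin> covered P" and w: "w \<in> covered P" and ad: "adj A C u w"
    and q: "Q u w = xs @ x # ys" and xs: "set xs \<inter> covered P = {}"
    and px: "p = as @ x # bs" and br: "(f (hd p) = f x) \<longleftrightarrow> odd (length as)"
  shows "last p = w"
proof -
  have lk: "linkage P" using min unfolding minimal_def by simp
  have bk: "breaking V E A f p" using lk k p breaking_rev[of V E A f "P k"] unfolding linkage_def by auto
  have setp: "set p = set (P k)" "path_edges p = path_edges (P k)" using p by auto
  then have pcov: "set p \<subseteq> covered P" using k unfolding covered_def by auto
  have P: "distinct p" "set p \<subseteq> V" "path_edges p \<subseteq> E" "hd p \<in> A" "last p \<in> A" "set p \<inter> A \<subseteq> {hd p, last p}"
    using bk unfolding breaking_def is_path_iff_successively path_edges_subset_iff by auto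
  have inA: "v = hd p \<or> v = last p" if "v \<in> set p" "v \<in> A" for v using P(6) that by blast
  have as: "as \<noteq> []" using br px by (cases as) auto
  then have hdp: "hd p = hd as" using px by simp
  have xcov: "x \<in> covered P" using pcov px by auto
  have uA: "u \<in> A" "w \<in> A" "u \<noteq> w" using ad unfolding adj_def by auto
  have QA: "set (Q u w) \<inter> A = {u, w}" using Q_A[OF ad] .
  have lastu: "last p \<noteq> u" using u pcov px by (metis append_is_Nil_conv last_in_set list.discI subsetD)
  show ?thesis
  proof (cases "x \<in> A")
    case True
    have "x = hd p \<or> x = last p" using True px by (intro inA) simp_all
    moreover have "x \<noteq> hd p" using P(1) px as hdp by auto
    moreover have "x = u \<or> x = w" using True QA q by auto
    ultimately show ?thesis using lastu by auto
  next
    case False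
    have xs_ne: "xs \<noteq> []" using q Q_hd[OF ad] xcov u by (cases xs) auto
    have hdxs: "hd xs = u" using q Q_hd[OF ad] xs_ne by simp
    define n where "n = xs @ x # rev as"
    have e1: "path_edges (xs @ [x]) \<subseteq> path_edges (Q u w)"
      unfolding q using path_edges_append[of xs "x # ys"] xs_ne by (auto simp: path_edges_append)
    have e2: "path_edges (as @ [x]) \<subseteq> path_edges p" "path_edges (x # bs) \<subseteq> path_edges p"
      unfolding px using path_edges_append[of as "x # bs"] as by (auto simp: path_edges_append)
    have "path_edges (x # rev as) = path_edges (as @ [x])"
      using path_edges_rev[of "as @ [x]"] by simp
    then have en: "path_edges n = path_edges (xs @ [x]) \<union> path_edges (as @ [x])"
      unfolding n_def using xs_ne path_edges_append[of xs "x # rev as"] path_edges_append[of xs "[x]"] by auto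
    have asA: "set as \<inter> A \<subseteq> {hd p}"
    proof
      fix v assume v: "v \<in> set as \<inter> A"
      then have "v = hd p \<or> v = last p" using px by (intro inA) simp_all
      moreover have "v \<noteq> last p"
      proof
        assume "v = last p"
        then have "v \<in> set (x # bs)" using px by (metis last_appendR last_in_set list.discI)
        then show False using v P(1) px by auto
      qed
      ultimately show "v \<in> {hd p}" by simp
    qed
    have xsA: "set xs \<inter> A \<subseteq> {u}" using QA q xs w by auto
    have dis: "set xs \<inter> set p = {}" using xs pcov by auto
    have "distinct n" unfolding n_def using Q_distinct[OF ad] P(1) dis unfolding q px by auto
    moreover have "set n \<subseteq> V" unfolding n_def using Q_V[OF ad] P(2) unfolding q px by auto
    moreover have "path_edges n \<subseteq> E" unfolding en using e1 e2(1) Q_edges[OF ad] P(3) by blast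
    moreover have "2 \<le> length n" unfolding n_def using xs_ne by (cases xs) auto
    moreover have hn: "hd n = u" "last n = hd p" "n \<noteq> []"
      unfolding n_def using hdxs xs_ne as hdp by (auto simp: last_rev)
    moreover have "set n \<inter> A \<subseteq> {hd n, last n}" unfolding hn unfolding n_def using xsA asA False by auto
    moreover have "(f u = f x) \<longleftrightarrow> even (length xs)"
      using alternating_colours[OF Q_colour[OF ad], of "length xs"] Q_hd[OF ad] q by auto
    then have "(f (hd n) = f (last n)) \<longleftrightarrow> even (length n)" unfolding hn unfolding n_def using br by auto
    ultimately have bn: "breaking V E A f n"
      unfolding breaking_def is_path_iff_successively path_edges_subset_iff[symmetric] using uA P(4) by simp
    have covn: "set n \<inter> set (P j) = {}" if "j < t - 1" "j \<noteq> k" for j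
    proof -
      have "set (P j) \<subseteq> covered P" using that(1) unfolding covered_def by auto
      moreover have "set p \<inter> set (P j) = {}" using lk k that setp unfolding linkage_def by auto
      ultimately show ?thesis unfolding n_def using xs px by auto
    qed
    have "linkage (P(k := n))"
      using lk bn covn unfolding linkage_def by (auto simp: Int_commute)
    then have "weight P \<le> weight (P(k := n))" using min unfolding minimal_def by simp
    moreover have "weight P = card (path_edges p - sub_edges) + (\<Sum>i\<in>{..<t - 1} - {k}. card (path_edges (P i) - sub_edges))"
      unfolding weight_def setp(2) using k by (simp add: sum.remove[of _ k])
    moreover have "weight (P(k := n)) = card (path_edges n - sub_edges) + (\<Sum>i\<in>{..<t - 1} - {k}. card (path_edges (P i) - sub_edges))"
      unfolding weight_def using k by (simp add: sum.remove[of _ k])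
    ultimately have le: "card (path_edges p - sub_edges) \<le> card (path_edges n - sub_edges)" by simp
    \<comment> \<open>The new path has no edges outside the subdivision except those of
      \<open>p\<close> before \<open>x\<close>, so minimality forces all such edges of
      \<open>p\<close> to lie there. The rest of \<open>p\<close> then stays on \<open>Q u w\<close>
      and ends in a branch vertex of it, which cannot be the uncovered \<open>u\<close>.\<close>
    have "path_edges (Q u w) \<subseteq> sub_edges" using ad unfolding sub_edges_def by auto
    then have nsub: "path_edges n - sub_edges \<subseteq> path_edges (as @ [x]) - sub_edges" using en e1 by blast
    have finp: "finite (path_edges p)" using finite_subset[OF P(3) graph_finite_edges[OF G]] .
    have "path_edges n - sub_edges \<subseteq> path_edges p - sub_edges" using nsub e2(1) by blast
    then have eq: "path_edges n - sub_edges = path_edges p - sub_edges"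
      using card_seteq[OF _ _ le] finp by simp
    have "path_edges (x # bs) \<subseteq> sub_edges"
    proof
      fix e assume e: "e \<in> path_edges (x # bs)"
      show "e \<in> sub_edges"
      proof (rule ccontr)
        assume "e \<notin> sub_edges"
        then have "e \<in> path_edges (as @ [x])" using e e2(2) eq nsub by blast
        then have "e \<subseteq> set (as @ [x])" by (rule path_edges_subset_set)
        moreover have "e \<subseteq> set (x # bs)" using e by (rule path_edges_subset_set)
        ultimately have "e \<subseteq> {x}" using P(1) px by auto
        moreover have "e \<in> E" using e e2(2) P(3) by blast
        then obtain a b where "e = {a, b}" "a \<noteq> b" using graph_edgeE[OF G] by metis
        ultimately show False by auto
      qed
    qed
    moreover have "set (butlast (x # bs)) \<inter> A = {}"
    proof (rule ccontr)
      assume "set (butlast (x # bs)) \<inter> A \<noteq> {}"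
      then obtain v where v: "v \<in> set (butlast (x # bs))" "v \<in> A" by blast
      have v': "v \<in> set (x # bs)" using v(1) by (rule in_set_butlastD)
      then have "v = hd p \<or> v = last p" using v(2) px by (intro inA) auto
      moreover have "v \<noteq> hd p" using v' P(1) px hdp hd_in_set[OF as] by auto
      moreover have "v \<noteq> last p"
      proof
        assume "v = last p"
        then have "v = last (x # bs)" using px by simp
        moreover have "distinct (butlast (x # bs) @ [last (x # bs)])"
          by (subst append_butlast_last_id) (use P(1) px in simp_all)
        ultimately show False using v(1) by simp
      qed
      ultimately show False by blast
    qed
    ultimately have "last (x # bs) \<in> set (Q u w)" using sub_path_stays[OF ad, of "x # bs"] q by simp
    moreover have "last p = last (x # bs)" using px by simp
    ultimately have "last p \<in> {u, w}" using QA P(5) by (metis IntI)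
    then show ?thesis using lastu by simp
  qed
qed

lemma linkage_colouring:
  assumes lk: "linkage P"
  obtains \<alpha> where "\<And>i j. i < t - 1 \<Longrightarrow> j < length (P i) \<Longrightarrow> \<alpha> (P i ! j) \<longleftrightarrow> (f (hd (P i)) \<longleftrightarrow> even j)"
    "\<And>v. v \<notin> covered P \<Longrightarrow> \<alpha> v = f v"
proof -
  define \<alpha> where "\<alpha> v = (if v \<in> covered P then \<exists>i<t - 1. \<exists>j<length (P i). v = P i ! j \<and> (f (hd (P i)) \<longleftrightarrow> even j) else f v)" for v
  have "\<alpha> (P i ! j) \<longleftrightarrow> (f (hd (P i)) \<longleftrightarrow> even j)" if ij: "i < t - 1" "j < length (P i)" for i j
  proof -
    have "P i ! j \<in> set (P i)" using ij(2) by simp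
    then have "P i ! j \<in> covered P" using ij(1) unfolding covered_def by auto
    moreover have "i' = i \<and> j' = j" if "i' < t - 1" "j' < length (P i')" "P i ! j = P i' ! j'" for i' j'
    proof -
      have "P i ! j \<in> set (P i) \<inter> set (P i')" using ij that by (metis IntI nth_mem)
      then have "i' = i" using lk ij that(1) unfolding linkage_def by blast
      moreover have "distinct (P i)" using lk ij unfolding linkage_def breaking_def is_path_def by simp
      ultimately show ?thesis using that ij by (simp add: nth_eq_iff_index_eq)
    qed
    ultimately show ?thesis using ij unfolding \<alpha>_def by auto
  qed
  moreover have "\<alpha> v = f v" if "v \<notin> covered P" for v using that unfolding \<alpha>_def by simp
  ultimately show ?thesis by (rule that)
qed

text \<open>The first hit \<open>x\<close> splits \<open>P k\<close> into two parts, exactly one of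
  which breaks parity; \<open>\<alpha> x = f x\<close> means that it is the one behind
  \<open>x\<close>. Applying \<open>minimal_reroute\<close> to \<open>P k\<close>, directed so that
  the breaking part comes first, shows that \<open>w\<close> is the end of the consistent
  part.\<close>

lemma first_hit:
  assumes min: "minimal P" and u: "u \<notin> covered P" and w: "w \<in> covered P" and ad: "adj A C u w"
    and \<alpha>: "\<And>i j. i < t - 1 \<Longrightarrow> j < length (P i) \<Longrightarrow> \<alpha> (P i ! j) \<longleftrightarrow> (f (hd (P i)) \<longleftrightarrow> even j)"
  obtains xs x ys k where "Q u w = xs @ x # ys" "takeWhile (\<lambda>v. v \<notin> covered P) (Q u w) = xs" "xs \<noteq> []"
    "k < t - 1" "x \<in> set (P k)" "w = hd (P k) \<and> \<alpha> x = f x \<or> w = last (P k) \<and> \<alpha> x \<noteq> f x"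
proof -
  have "\<exists>v\<in>set (Q u w). v \<in> covered P" using Q_ends(2)[OF ad] w by auto
  then obtain xs x ys where q: "Q u w = xs @ x # ys" "x \<in> covered P" "\<forall>v\<in>set xs. v \<notin> covered P"
    by (rule split_list_first_propE) (rule that)
  have tw: "takeWhile (\<lambda>v. v \<notin> covered P) (Q u w) = xs" using q by simp
  have ne: "xs \<noteq> []" using q Q_hd[OF ad] u by (cases xs) auto
  have xsc: "set xs \<inter> covered P = {}" using q(3) by auto
  obtain k where k: "k < t - 1" "x \<in> set (P k)" using q(2) unfolding covered_def by auto
  obtain as bs where ab: "P k = as @ x # bs" using k(2) by (auto simp: in_set_conv_decomp)
  have ax: "\<alpha> x \<longleftrightarrow> (f (hd (P k)) \<longleftrightarrow> even (length as))" using \<alpha>[OF k(1), of "length as"] ab by simp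
  have lk: "linkage P" using min unfolding minimal_def by simp
  then have bk: "(f (hd (P k)) = f (last (P k))) \<longleftrightarrow> even (length (P k))" and nek: "P k \<noteq> []"
    using k(1) unfolding linkage_def breaking_def is_path_def by auto
  have "w = hd (P k) \<and> \<alpha> x = f x \<or> w = last (P k) \<and> \<alpha> x \<noteq> f x"
  proof (cases "\<alpha> x = f x")
    case True
    have "(f (hd (rev (P k))) = f x) \<longleftrightarrow> odd (length (rev bs))"
    proof -
      have "length (P k) = Suc (length as + length bs)" using ab by simp
      then have "(f (hd (P k)) = f (last (P k))) \<longleftrightarrow> (even (length as) \<longleftrightarrow> odd (length bs))" using bk by simp
      then show ?thesis using ax True nek by (auto simp: hd_rev)
    qed
    moreover have "rev (P k) = rev bs @ x # rev as" using ab by simp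
    ultimately have "last (rev (P k)) = w"
      using minimal_reroute[OF min k(1) disjI2[OF refl] u w ad q(1) xsc] by blast
    then show ?thesis using True nek by (simp add: last_rev)
  next
    case False
    then have "(f (hd (P k)) = f x) \<longleftrightarrow> odd (length as)" using ax by blast
    then have "last (P k) = w"
      using minimal_reroute[OF min k(1) disjI1[OF refl] u w ad q(1) xsc ab] by blast
    then show ?thesis using False by simp
  qed
  then show ?thesis using that[OF q(1) tw ne k] by simp
qed

text \<open>Reversing a path changes neither its edges nor its breaking parity. The last vertices
  are the ends that other roots must reach, so they are put into the clique whenever the path has an
  end there.\<close>

lemma minimal_oriented_linkage:
  assumes "linkage P0"
  obtains P where "minimal P" "\<And>i. i < t - 1 \<Longrightarrow> hd (P i) \<in> C \<Longrightarrow> last (P i) \<in> C"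
proof -
  have "\<exists>P. linkage P \<and> (\<forall>P'. linkage P' \<longrightarrow> weight P \<le> weight P')"
    using ex_has_least_nat[of linkage P0 weight] assms by simp
  then obtain P1 where P1: "linkage P1" "\<forall>P'. linkage P' \<longrightarrow> weight P1 \<le> weight P'" by auto
  define P where "P i = (if last (P1 i) \<in> C then P1 i else rev (P1 i))" for i
  have eq: "set (P i) = set (P1 i)" "path_edges (P i) = path_edges (P1 i)" for i unfolding P_def by auto
  have "breaking V E A f (P i)" if "i < t - 1" for i
    using P1(1) that breaking_rev[of V E A f "P1 i"] unfolding linkage_def P_def by auto
  then have "linkage P" using P1(1) unfolding linkage_def eq by simp
  moreover have "weight P = weight P1" unfolding weight_def eq by simp
  ultimately have "minimal P" using P1(2) unfolding minimal_def by simp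
  moreover have "last (P i) \<in> C" if "i < t - 1" "hd (P i) \<in> C" for i
  proof -
    have "P1 i \<noteq> []" using P1(1) that(1) unfolding linkage_def breaking_def is_path_def by simp
    then show ?thesis using that(2) unfolding P_def by (auto simp: hd_rev last_rev split: if_splits)
  qed
  ultimately show ?thesis by (rule that)
qed

lemma linkage_ends:
  assumes "linkage P" "i < t - 1"
  shows "set (P i) \<inter> A = {hd (P i), last (P i)}" "hd (P i) \<noteq> last (P i)" "P i \<noteq> []"
    "hd (P i) \<in> set (P i)" "last (P i) \<in> set (P i)" "set (P i) \<subseteq> covered P"
proof -
  have p: "P i \<noteq> []" "distinct (P i)" "2 \<le> length (P i)" "hd (P i) \<in> A" "last (P i) \<in> A"
    "set (P i) \<inter> A \<subseteq> {hd (P i), last (P i)}"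
    using assms unfolding linkage_def breaking_def is_path_def by auto
  show "P i \<noteq> []" by fact
  show h: "hd (P i) \<in> set (P i)" "last (P i) \<in> set (P i)" using p(1) by simp_all
  show "set (P i) \<inter> A = {hd (P i), last (P i)}" using p(4-6) h by auto
  show "hd (P i) \<noteq> last (P i)" using p(1-3) by (cases "P i") auto
  show "set (P i) \<subseteq> covered P" using assms(2) unfolding covered_def by auto
qed

lemma linkage_index_unique:
  assumes "linkage P" "i < t - 1" "j < t - 1" "x \<in> set (P i)" "x \<in> set (P j)"
  shows "i = j"
  using assms unfolding linkage_def by blast

text \<open>The paths have \<open>2 * (t - 1)\<close> ends, exactly \<open>card C\<close>, so the
  uncovered vertices of \<open>C\<close> are as many as the ends outside \<open>C\<close>, namely
  \<open>card J + card L\<close>. This is enough to give a clique vertex to every path whose head is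
  outside \<open>C\<close> and, if some last vertex is outside \<open>C\<close>, also to the index
  \<open>t - 1\<close>.\<close>

lemma free_branch_vertices:
  assumes lk: "linkage P" and orient: "\<And>i. i < t - 1 \<Longrightarrow> hd (P i) \<in> C \<Longrightarrow> last (P i) \<in> C"
  obtains u where "inj_on u {..<t}" "u ` {..<t} \<subseteq> A - covered P"
    "\<And>i. i < t - 1 \<Longrightarrow> hd (P i) \<notin> C \<Longrightarrow> u i \<in> C"
    "\<And>i. i < t - 1 \<Longrightarrow> last (P i) \<notin> C \<Longrightarrow> u (t - 1) \<in> C"
proof -
  let ?I = "{..<t - 1}"
  let ?h = "\<lambda>i. hd (P i)" and ?l = "\<lambda>i. last (P i)"
  define J where "J = {i \<in> ?I. ?h i \<notin> C}"
  define L where "L = {i \<in> ?I. ?l i \<notin> C}"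
  have fin: "finite J" "finite L" unfolding J_def L_def by auto
  have injh: "inj_on ?h ?I" and injl: "inj_on ?l ?I"
    using linkage_ends(4,5)[OF lk] linkage_index_unique[OF lk] by (auto intro!: inj_onI) metis+
  have dj: "?h i \<noteq> ?l j" if "i < t - 1" "j < t - 1" for i j
    using linkage_index_unique[OF lk that, of "?h i"] linkage_ends[OF lk that(1)] linkage_ends[OF lk that(2)] by metis
  define W where "W = covered P \<inter> A"
  have W: "W = ?h ` ?I \<union> ?l ` ?I"
  proof -
    have "W = (\<Union>i<t - 1. set (P i) \<inter> A)" unfolding W_def covered_def by auto
    also have "\<dots> = (\<Union>i<t - 1. {?h i, ?l i})" using linkage_ends(1)[OF lk] by simp
    finally show ?thesis by auto
  qed
  have "?h ` ?I \<inter> ?l ` ?I = {}" using dj by auto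
  then have cW: "card W = 2 * (t - 1)"
    unfolding W using card_image[OF injh] card_image[OF injl] by (simp add: card_Un_disjoint)
  have "W - C = ?h ` J \<union> ?l ` L" unfolding W J_def L_def by auto
  moreover have "?h ` J \<inter> ?l ` L = {}" using dj unfolding J_def L_def by auto
  moreover have "card (?h ` J) = card J" "card (?l ` L) = card L"
    using card_image[OF inj_on_subset[OF injh, of J]] card_image[OF inj_on_subset[OF injl, of L]]
    unfolding J_def L_def by auto
  ultimately have cWC: "card (W - C) = card J + card L" using fin by (simp add: card_Un_disjoint)
  have finW: "finite W" unfolding W by simp
  have "card W = card (W \<inter> C) + card (W - C)"
    using card_Un_disjoint[of "W \<inter> C" "W - C"] finW by (simp add: Int_Diff_Un Int_Diff_disjoint)
  then have cWiC: "card (W \<inter> C) + card J + card L = 2 * (t - 1)" using cW cWC by simp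
  have "(A - covered P) \<inter> C = C - W \<inter> C" using CA unfolding W_def by auto
  then have "card ((A - covered P) \<inter> C) = card C - card (W \<inter> C)"
    using card_Diff_subset[of "W \<inter> C" C] finW by simp
  then have cUC: "card ((A - covered P) \<inter> C) = card J + card L" using cWiC card_C by simp
  have "A - covered P = A - W" "W \<subseteq> A" unfolding W_def by auto
  then have cU: "card (A - covered P) = t"
    using card_Diff_subset[OF finW, of A] cW card_A t2 by simp
  \<comment> \<open>The index \<open>t - 1\<close> has no path of its own; its clique vertex is paid
    for by an element of \<open>L\<close>.\<close>
  define J' where "J' = J \<union> (if L = {} then {} else {t - 1})"
  have "card J' \<le> card J + card L"
  proof (cases "L = {}")
    case False
    then have "1 \<le> card L" using fin(2) by (simp add: Suc_le_eq card_gt_0_iff)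
    then show ?thesis using card_Un_le[of J "{t - 1}"] False unfolding J'_def by simp
  qed (simp add: J'_def)
  moreover have "J' \<subseteq> {..<t}" using t2 unfolding J'_def J_def by auto
  ultimately obtain u where u: "inj_on u {..<t}" "u ` {..<t} \<subseteq> A - covered P" "u ` J' \<subseteq> C"
    using injection_with_constraint[of "A - covered P" t J' C] finite_A cU cUC by auto
  show ?thesis
  proof (rule that[OF u(1,2)])
    fix i assume "i < t - 1" "hd (P i) \<notin> C"
    then have "i \<in> J'" unfolding J'_def J_def by simp
    then show "u i \<in> C" using u(3) by auto
  next
    fix i assume "i < t - 1" "last (P i) \<notin> C"
    then have "i \<in> L" unfolding L_def by simp
    then have "t - 1 \<in> J'" unfolding J'_def by auto
    then show "u (t - 1) \<in> C" using u(3) by auto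
  qed
qed

text \<open>The root \<open>u i\<close> takes the initial parts, up to the first hit, of its
  segments to all covered branch vertices. The segment to \<open>hd (P i)\<close> attaches
  \<open>P i\<close>, and the segments to the other last vertices give the monochromatic edges. The
  tree with index \<open>t - 1\<close> has a root but no path.\<close>

lemma odd_minor_if_linkage:
  assumes "linkage P0"
  shows "odd_Kt_minor V E t"
proof -
  obtain P where min: "minimal P" and orient: "\<And>i. i < t - 1 \<Longrightarrow> hd (P i) \<in> C \<Longrightarrow> last (P i) \<in> C"
    using minimal_oriented_linkage[OF assms] by metis
  have lk: "linkage P" using min unfolding minimal_def by simp
  obtain u where u: "inj_on u {..<t}" "u ` {..<t} \<subseteq> A - covered P"
    and uh: "\<And>i. i < t - 1 \<Longrightarrow> hd (P i) \<notin> C \<Longrightarrow> u i \<in> C"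
    and ul: "\<And>i. i < t - 1 \<Longrightarrow> last (P i) \<notin> C \<Longrightarrow> u (t - 1) \<in> C"
    using free_branch_vertices[OF lk orient] by metis
  obtain \<alpha> where aP: "\<And>i j. i < t - 1 \<Longrightarrow> j < length (P i) \<Longrightarrow> \<alpha> (P i ! j) \<longleftrightarrow> (f (hd (P i)) \<longleftrightarrow> even j)"
    and af: "\<And>v. v \<notin> covered P \<Longrightarrow> \<alpha> v = f v"
    using linkage_colouring[OF lk] by metis
  let ?W = "covered P"
  define sg where "sg a w = takeWhile (\<lambda>v. v \<notin> ?W) (Q a w)" for a w
  define SG where "SG a = insert a (\<Union>{set (sg a w) | w. w \<in> ?W \<and> adj A C a w})" for a
  define T where "T i = SG (u i) \<union> (if i < t - 1 then set (P i) else {})" for i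
  have uA: "u i \<in> A" "u i \<notin> ?W" if "i < t" for i using u(2) that by auto
  have sgQ: "set (sg a w) \<subseteq> set (Q a w) - ?W" for a w
    unfolding sg_def by (auto dest: set_takeWhileD)
  have SG_A: "z = a" if zS: "z \<in> SG a" and zA: "z \<in> A" for z a
  proof (rule ccontr)
    assume "z \<noteq> a"
    then obtain w where w: "w \<in> ?W" "adj A C a w" "z \<in> set (sg a w)" using zS unfolding SG_def by auto
    then have "z \<in> set (Q a w)" "z \<notin> ?W" using sgQ by auto
    then show False using Q_A[OF w(2)] zA w(1) \<open>z \<noteq> a\<close> by auto
  qed
  have SG_W: "z \<notin> ?W" if "z \<in> SG a" "a \<notin> ?W" for z a
    using that sgQ unfolding SG_def by auto
  have SG_eq: "a = b" if z: "z \<in> SG a" "z \<in> SG b" and ab: "a \<in> A" "b \<in> A" "a \<notin> ?W" "b \<notin> ?W" for z a b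
  proof (rule ccontr)
    assume ne: "a \<noteq> b"
    have "z \<in> A"
    proof (cases "z = a \<or> z = b")
      case False
      then obtain w where w: "w \<in> ?W" "adj A C a w" "z \<in> set (sg a w)" using z(1) unfolding SG_def by auto
      from False obtain w' where w': "w' \<in> ?W" "adj A C b w'" "z \<in> set (sg b w')" using z(2) unfolding SG_def by auto
      have "{a, w} \<noteq> {b, w'}" using ne w(1) w'(1) ab by (auto simp: doubleton_eq_iff)
      moreover have "z \<in> set (Q a w)" "z \<in> set (Q b w')" using w w' sgQ by auto
      ultimately show ?thesis using Q_disjoint[OF w(2) w'(2)] by simp
    qed (use ab in auto)
    then show False using SG_A[OF z(1)] SG_A[OF z(2)] ne by simp
  qed
  have SG_V: "SG a \<subseteq> V" if "a \<in> A" for a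
  proof
    fix z assume "z \<in> SG a"
    then consider "z = a" | w where "adj A C a w" "z \<in> set (sg a w)" unfolding SG_def by auto
    then show "z \<in> V"
    proof cases
      case 2
      then show ?thesis using sgQ[of a w] Q_V[of a w] by auto
    qed (use that AV in auto)
  qed
  have PV: "set (P i) \<subseteq> V" "path_edges (P i) \<subseteq> E" if "i < t - 1" for i
    using lk that unfolding linkage_def breaking_def is_path_iff_successively path_edges_subset_iff by auto
  have sg_col: "f x \<noteq> f y" if "adj A C a w" "{x, y} \<in> path_edges (Q a w)" for a w x y
    using path_edge_colours[OF Q_colour[OF that(1)] that(2)] .
  \<comment> \<open>Just before the first hit the colour is still \<open>f\<close>, so the edge into
    \<open>x\<close> is bichromatic under \<open>\<alpha>\<close> if \<open>\<alpha> x = f x\<close>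
    and monochromatic otherwise; which case occurs depends on the end of \<open>P k\<close> to which
    the segment leads.\<close>
  have hit: "\<exists>xs x k. takeWhile (\<lambda>v. v \<notin> ?W) (Q a w) = xs \<and> xs \<noteq> [] \<and> last xs \<in> SG a \<and> {last xs, x} \<in> E \<and>
      f (last xs) \<noteq> f x \<and> k < t - 1 \<and> x \<in> set (P k) \<and>
      (w = hd (P k) \<and> \<alpha> x = f x \<or> w = last (P k) \<and> \<alpha> x \<noteq> f x)"
    if aw: "a \<notin> ?W" "w \<in> ?W" "adj A C a w" for a w
  proof -
    obtain xs x ys k where h: "Q a w = xs @ x # ys" "takeWhile (\<lambda>v. v \<notin> ?W) (Q a w) = xs" "xs \<noteq> []"
      "k < t - 1" "x \<in> set (P k)" "w = hd (P k) \<and> \<alpha> x = f x \<or> w = last (P k) \<and> \<alpha> x \<noteq> f x"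
      using first_hit[OF min aw aP] by metis
    have e: "{last xs, x} \<in> path_edges (Q a w)" unfolding h(1) using h(3) by (simp add: path_edges_append)
    have "last xs \<in> set (sg a w)" unfolding sg_def h(2) using h(3) by simp
    then have "last xs \<in> SG a" using aw unfolding SG_def by auto
    moreover have "{last xs, x} \<in> E" using Q_edges[OF aw(3)] e by auto
    ultimately show ?thesis using h(2-6) sg_col[OF aw(3) e] by (intro exI[of _ xs] exI[of _ x] exI[of _ k]) simp
  qed
  show ?thesis
  proof (rule odd_Kt_minorI[OF G, of t T \<alpha>])
    fix i assume i: "i < t"
    show "T i \<subseteq> V" using SG_V[OF uA(1)[OF i]] PV(1)[of i] unfolding T_def by auto
    let ?D = "bichromatic E \<alpha> (T i)"
    have SGT: "SG (u i) \<subseteq> T i" unfolding T_def by simp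
    have uT: "u i \<in> T i" unfolding T_def SG_def by simp
    have toU: "reach ?D (u i) z" if z: "z \<in> SG (u i)" for z
    proof (cases "z = u i")
      case False
      then obtain w where w: "w \<in> ?W" "adj A C (u i) w" "z \<in> set (sg (u i) w)" using z unfolding SG_def by auto
      have sub: "set (sg (u i) w) \<subseteq> SG (u i)" using w(1,2) unfolding SG_def by auto
      obtain r where r: "Q (u i) w = sg (u i) w @ r" unfolding sg_def by (metis takeWhile_dropWhile_id)
      have pq: "path_edges (sg (u i) w) \<subseteq> path_edges (Q (u i) w)" unfolding r by (auto simp: path_edges_append)
      have pe: "path_edges (sg (u i) w) \<subseteq> ?D"
      proof
        fix e assume e: "e \<in> path_edges (sg (u i) w)"
        then have eQ: "e \<in> path_edges (Q (u i) w)" using pq by auto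
        then have eE: "e \<in> E" using Q_edges[OF w(2)] by auto
        obtain x y where xy: "e = {x, y}" using graph_edgeE[OF G eE] by metis
        have in_sg: "x \<in> set (sg (u i) w)" "y \<in> set (sg (u i) w)" using path_edges_subset_set[OF e] xy by auto
        then have "\<alpha> x = f x" "\<alpha> y = f y" using sgQ[of "u i" w] by (auto intro!: af)
        then have "\<alpha> x \<noteq> \<alpha> y" using sg_col[OF w(2)] eQ xy by simp
        then show "e \<in> ?D" using eE in_sg sub SGT unfolding xy by (intro bichromaticI) auto
      qed
      have "sg (u i) w \<noteq> []" using w(3) by auto
      then have "hd (sg (u i) w) = u i" using Q_hd[OF w(2)] r by simp
      then show ?thesis using reach_path[OF pe w(3)] by simp
    qed simp
    have "reach ?D (u i) z" if z: "z \<in> T i" for z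
    proof (cases "z \<in> SG (u i)")
      case True
      then show ?thesis by (rule toU)
    next
      case False
      then have i': "i < t - 1" and zP: "z \<in> set (P i)" using z unfolding T_def by (auto split: if_splits)
      have PT: "set (P i) \<subseteq> T i" using i' unfolding T_def by simp
      have pe: "path_edges (P i) \<subseteq> ?D"
      proof
        fix e assume "e \<in> path_edges (P i)"
        then obtain j where j: "e = {P i ! j, P i ! Suc j}" "Suc j < length (P i)" and eE: "e \<in> E"
          using PV(2)[OF i'] unfolding path_edges_def by blast
        have "\<alpha> (P i ! j) \<noteq> \<alpha> (P i ! Suc j)" using aP[OF i', of j] aP[OF i', of "Suc j"] j(2) by auto
        moreover have "P i ! j \<in> T i" "P i ! Suc j \<in> T i" using PT j(2) by auto
        ultimately show "e \<in> ?D" using eE unfolding j(1) by (intro bichromaticI)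
      qed
      have e: "hd (P i) \<in> ?W" "hd (P i) \<in> A" "hd (P i) \<noteq> last (P i)" using linkage_ends[OF lk i'] by auto
      then have "adj A C (u i) (hd (P i))" using uA[OF i] uh[OF i'] unfolding adj_def by auto
      from hit[OF uA(2)[OF i] e(1) this] obtain xs x k where h: "last xs \<in> SG (u i)" "{last xs, x} \<in> E"
        "f (last xs) \<noteq> f x" "k < t - 1" "x \<in> set (P k)"
        "hd (P i) = hd (P k) \<and> \<alpha> x = f x \<or> hd (P i) = last (P k) \<and> \<alpha> x \<noteq> f x" by blast
      have "hd (P i) \<in> set (P k)" using h(6) linkage_ends(4,5)[OF lk h(4)] by auto
      then have k: "k = i" using linkage_index_unique[OF lk h(4) i'] linkage_ends(4)[OF lk i'] by auto
      then have "\<alpha> x = f x" using h(6) e(3) by auto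
      moreover have "\<alpha> (last xs) = f (last xs)" using af SG_W[OF h(1) uA(2)[OF i]] by simp
      ultimately have "{last xs, x} \<in> ?D" using h(1-3,5) k SGT PT by (intro bichromaticI) auto
      then have "reach ?D (u i) x" using reach_trans[OF toU[OF h(1)] reach_edge] by simp
      moreover have "reach ?D x z" using reach_path_two[OF pe] h(5) k zP by simp
      ultimately show ?thesis by (rule reach_trans)
    qed
    then have "reach ?D x y" if "x \<in> T i" "y \<in> T i" for x y
      using that reach_trans[OF reach_sym] by metis
    then show "connected (T i) ?D" unfolding connected_def reach_def[symmetric] using uT by auto
  next
    fix i j assume ij: "i < t" "j < t" "i \<noteq> j"
    have "u i \<noteq> u j" using u(1) ij by (auto dest: inj_onD)
    then have 1: "SG (u i) \<inter> SG (u j) = {}" using SG_eq uA ij by blast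
    have 2: "SG (u i) \<inter> set (P j) = {}" if "j < t - 1"
      using SG_W[OF _ uA(2)[OF ij(1)]] linkage_ends(6)[OF lk that] by auto
    have 3: "set (P i) \<inter> SG (u j) = {}" if "i < t - 1"
      using SG_W[OF _ uA(2)[OF ij(2)]] linkage_ends(6)[OF lk that] by auto
    have 4: "set (P i) \<inter> set (P j) = {}" if "i < t - 1" "j < t - 1"
      using lk ij(3) that unfolding linkage_def by simp
    show "T i \<inter> T j = {}" unfolding T_def using 1 2 3 4 by (auto split: if_splits)
  next
    fix i j assume ij: "i < t" "j < t" "i \<noteq> j"
    have link: "\<exists>x\<in>T i. \<exists>y\<in>T j. {x, y} \<in> E \<and> \<alpha> x = \<alpha> y"
      if i: "i < t" and j: "j < t - 1" and c: "u i \<in> C \<or> last (P j) \<in> C" for i j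
    proof -
      have e: "last (P j) \<in> ?W" "last (P j) \<in> A" "hd (P j) \<noteq> last (P j)" using linkage_ends[OF lk j] by auto
      then have "adj A C (u i) (last (P j))" using uA[OF i] c unfolding adj_def by auto
      from hit[OF uA(2)[OF i] e(1) this] obtain xs x k where h: "last xs \<in> SG (u i)" "{last xs, x} \<in> E"
        "f (last xs) \<noteq> f x" "k < t - 1" "x \<in> set (P k)"
        "last (P j) = hd (P k) \<and> \<alpha> x = f x \<or> last (P j) = last (P k) \<and> \<alpha> x \<noteq> f x" by blast
      have "last (P j) \<in> set (P k)" using h(6) linkage_ends(4,5)[OF lk h(4)] by auto
      then have k: "k = j" using linkage_index_unique[OF lk h(4) j] linkage_ends(5)[OF lk j] by auto
      then have "\<alpha> x \<noteq> f x" using h(6) e(3) by auto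
      moreover have "\<alpha> (last xs) = f (last xs)" using af SG_W[OF h(1) uA(2)[OF i]] by simp
      ultimately have "\<alpha> (last xs) = \<alpha> x" using h(3) by auto
      moreover have "last xs \<in> T i" "x \<in> T j" using h(1,5) k j unfolding T_def by auto
      ultimately show ?thesis using h(2) by blast
    qed
    have sym: "\<exists>x\<in>T i. \<exists>y\<in>T j. {x, y} \<in> E \<and> \<alpha> x = \<alpha> y"
      if "\<exists>x\<in>T j. \<exists>y\<in>T i. {x, y} \<in> E \<and> \<alpha> x = \<alpha> y" using that by (metis insert_commute)
    consider "j = t - 1" "i < t - 1" | "i = t - 1" "j < t - 1" | "i < t - 1" "j < t - 1" using ij by linarith
    then show "\<exists>x\<in>T i. \<exists>y\<in>T j. {x, y} \<in> E \<and> \<alpha> x = \<alpha> y"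
    proof cases
      case 1
      then have "u j \<in> C \<or> last (P i) \<in> C" using ul[of i] by auto
      then show ?thesis by (rule sym[OF link[OF ij(2) 1(2)]])
    next
      case 2
      then have "u i \<in> C \<or> last (P j) \<in> C" using ul[of j] by auto
      then show ?thesis by (rule link[OF ij(1) 2(2)])
    next
      case 3
      show ?thesis
      proof (cases "last (P j) \<in> C")
        case True
        then show ?thesis using link[OF ij(1) 3(2)] by simp
      next
        case False
        \<comment> \<open>By the orientation both ends of \<open>P j\<close> are outside
          \<open>C\<close>. Then \<open>u j\<close> is a clique vertex, and its segment to
          \<open>last (P i)\<close> is used in place of the one from \<open>u i\<close>.\<close>
        then have "u j \<in> C" using uh[OF 3(2)] orient[OF 3(2)] by auto
        then show ?thesis using sym[OF link[OF ij(2) 3(1)]] by simp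
      qed
    qed
  qed
qed

end

section \<open>From a bipartite subdivision to the locale, and the conclusion\<close>

lemma set_path_interior:
  assumes "p \<noteq> []"
  shows "set p = {hd p, last p} \<union> interior p"
proof (cases "tl p = []")
  case True
  then show ?thesis using assms unfolding interior_def by (cases p) auto
next
  case False
  then have "p = hd p # butlast (tl p) @ [last p]"
    using assms by (metis append_butlast_last_id last_tl list.collapse)
  then have "set p = set (hd p # butlast (tl p) @ [last p])" by simp
  then show ?thesis unfolding interior_def by auto
qed

text \<open>The given paths belong to unordered edges and may run either way; \<open>Q u w\<close>
  reverses them where necessary to start at \<open>u\<close>. A vertex common to two of them is not
  interior to the first, so it is an end and lies in \<open>A\<close>.\<close>

lemma subdivision_of_bipartite_subdivision:
  fixes V :: "'a set" and E :: "'a set set"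
  assumes t: "2 \<le> t" and G: "graph V E"
    and sub: "bipartite_subdivision V E (KI_verts (2*t-2) t) (KI_edges (2*t-2) t)"
  shows "\<exists>A C Q f. subdivision V E A C Q f t"
proof -
  let ?N = "KI_verts (2*t-2) t" and ?D = "KI_edges (2*t-2) t"
  obtain phi :: "nat \<Rightarrow> 'a" and P where inj: "inj_on phi ?N" and phiV: "phi ` ?N \<subseteq> V"
    and P1: "\<forall>e\<in>?D. is_path V E (P e) \<and> {hd (P e), last (P e)} = phi ` e \<and> interior (P e) \<inter> phi ` ?N = {}"
    and P2: "\<forall>e\<in>?D. \<forall>e'\<in>?D. e \<noteq> e' \<longrightarrow> interior (P e) \<inter> set (P e') = {}"
    and bip: "bipartite (phi ` ?N \<union> (\<Union>e\<in>?D. set (P e))) (\<Union>e\<in>?D. path_edges (P e))"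
    using sub unfolding bipartite_subdivision_def by (elim exE conjE) (rule that)
  obtain f :: "'a \<Rightarrow> bool" where f: "\<And>x y e. e \<in> ?D \<Longrightarrow> {x, y} \<in> path_edges (P e) \<Longrightarrow> f x \<noteq> f y"
  proof -
    obtain f :: "'a \<Rightarrow> bool" where f: "\<forall>u\<in>phi ` ?N \<union> (\<Union>e\<in>?D. set (P e)). \<forall>v\<in>phi ` ?N \<union> (\<Union>e\<in>?D. set (P e)).
      {u, v} \<in> (\<Union>e\<in>?D. path_edges (P e)) \<longrightarrow> f u \<noteq> f v"
      using bip unfolding bipartite_def by (rule exE)
    show ?thesis
    proof (rule that)
      fix x y e assume that: "e \<in> ?D" "{x, y} \<in> path_edges (P e)"
      have "x \<in> set (P e)" "y \<in> set (P e)" using path_edges_subset_set[OF that(2)] by auto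
      then have "x \<in> phi ` ?N \<union> (\<Union>e\<in>?D. set (P e))" "y \<in> phi ` ?N \<union> (\<Union>e\<in>?D. set (P e))" using that(1) by auto
      moreover have "{x, y} \<in> (\<Union>e\<in>?D. path_edges (P e))" using that by auto
      ultimately show "f x \<noteq> f y" using f by simp
    qed
  qed
  define A where "A = phi ` ?N"
  define C where "C = phi ` {0..<2*t-2}"
  define psi where "psi = the_inv_into ?N phi"
  define ed where "ed u w = {psi u, psi w}" for u w
  define Q where "Q u w = (if hd (P (ed u w)) = u then P (ed u w) else rev (P (ed u w)))" for u w
  have sN: "{0..<2*t-2} \<subseteq> ?N" unfolding KI_verts_def by auto
  have psi: "psi u \<in> ?N" "phi (psi u) = u" if "u \<in> A" for u
    using that inj unfolding psi_def A_def by (auto simp: the_inv_into_f_f f_the_inv_into_f)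
  have psiC: "psi u < 2*t-2" if uC: "u \<in> C" for u
  proof -
    obtain i where i: "i < 2*t-2" "u = phi i" using uC unfolding C_def by auto
    then have "i \<in> ?N" using sN by auto
    then show ?thesis using i the_inv_into_f_f[OF inj] unfolding psi_def by simp
  qed
  have edD: "ed u w \<in> ?D" and phied: "phi ` ed u w = {u, w}" if "adj A C u w" for u w
  proof -
    have uw: "u \<in> A" "w \<in> A" "u \<noteq> w" "u \<in> C \<or> w \<in> C" using that unfolding adj_def by auto
    show "phi ` ed u w = {u, w}" using psi(2)[OF uw(1)] psi(2)[OF uw(2)] unfolding ed_def by simp
    have "psi u \<noteq> psi w" using psi(2)[OF uw(1)] psi(2)[OF uw(2)] uw(3) by metis
    moreover have "psi u < 2*t-2 \<or> psi w < 2*t-2" using psiC uw(4) by blast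
    ultimately show "ed u w \<in> ?D"
      using psi(1)[OF uw(1)] psi(1)[OF uw(2)] unfolding ed_def KI_edges_def by blast
  qed
  have ed_inj: "{u, w} = {u', w'}" if "adj A C u w" "adj A C u' w'" "ed u w = ed u' w'" for u w u' w'
    using phied[OF that(1)] phied[OF that(2)] that(3) by simp
  have PQ: "is_path V E (P (ed u w))" "{hd (P (ed u w)), last (P (ed u w))} = {u, w}"
    "interior (P (ed u w)) \<inter> A = {}" "u \<noteq> w" "P (ed u w) \<noteq> []" if "adj A C u w" for u w
    using P1 edD[OF that] phied[OF that] that unfolding A_def adj_def is_path_def by auto
  have setQ: "set (Q u w) = set (P (ed u w))" for u w unfolding Q_def by simp
  have ends: "hd (Q u w) = u \<and> last (Q u w) = w" if "adj A C u w" for u w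
  proof -
    have "hd (P (ed u w)) = u \<and> last (P (ed u w)) = w \<or> hd (P (ed u w)) = w \<and> last (P (ed u w)) = u"
      using PQ(2)[OF that] by (auto simp: doubleton_eq_iff)
    then show ?thesis using PQ(4,5)[OF that] unfolding Q_def by (auto simp: hd_rev last_rev)
  qed
  have "subdivision V E A C Q f t"
  proof
    show "graph V E" "2 \<le> t" by fact+
    show "C \<subseteq> A" unfolding A_def C_def using sN by auto
    show "A \<subseteq> V" unfolding A_def by fact
    show "card C = 2 * t - 2" unfolding C_def using card_image[OF inj_on_subset[OF inj sN]] by simp
    show "card A = 3 * t - 2" unfolding A_def using card_image[OF inj] t by (simp add: KI_verts_def)
  next
    fix u w assume ad: "adj A C u w"
    show "is_path V E (Q u w)"
      using PQ(1)[OF ad] unfolding Q_def is_path_iff_successively by (auto simp: insert_commute)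
    show "hd (Q u w) = u" "last (Q u w) = w" using ends[OF ad] by auto
    have "ed w u = ed u w" unfolding ed_def by (simp add: insert_commute)
    then show "Q w u = rev (Q u w)" using PQ(2,4)[OF ad] unfolding Q_def by (auto simp: doubleton_eq_iff)
    have "set (Q u w) = {u, w} \<union> interior (P (ed u w))"
      unfolding setQ using set_path_interior[OF PQ(5)[OF ad]] PQ(2)[OF ad] by simp
    then show "set (Q u w) \<inter> A = {u, w}" using PQ(3)[OF ad] ad unfolding adj_def by auto
    have "successively (\<lambda>x y. f x \<noteq> f y) (P (ed u w))"
      unfolding successively_conv_nth
    proof (intro allI impI)
      fix i assume "Suc i < length (P (ed u w))"
      then have "{P (ed u w) ! i, P (ed u w) ! Suc i} \<in> path_edges (P (ed u w))" unfolding path_edges_def by blast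
      then show "f (P (ed u w) ! i) \<noteq> f (P (ed u w) ! Suc i)" using f[OF edD[OF ad]] by blast
    qed
    then show "successively (\<lambda>x y. f x \<noteq> f y) (Q u w)" unfolding Q_def by (auto elim: successively_mono)
  next
    fix u w u' w' z
    assume ad: "adj A C u w" "adj A C u' w'" "{u, w} \<noteq> {u', w'}" and z: "z \<in> set (Q u w)" "z \<in> set (Q u' w')"
    have "ed u w \<noteq> ed u' w'" using ed_inj[OF ad(1,2)] ad(3) by blast
    then have "interior (P (ed u w)) \<inter> set (P (ed u' w')) = {}" using P2 edD[OF ad(1)] edD[OF ad(2)] by simp
    then have "z \<notin> interior (P (ed u w))" using z(2) setQ by auto
    then have "z \<in> {u, w}"
      using z(1) set_path_interior[OF PQ(5)[OF ad(1)]] PQ(2)[OF ad(1)] unfolding setQ by auto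
    then show "z \<in> A" using ad(1) unfolding adj_def by auto
  qed
  then show ?thesis by blast
qed

theorem theorem3p6:
  fixes V :: "'a set" and E :: "'a set set" and t :: nat
  assumes "t \<ge> 2"
    and "graph V E"
    and "\<not> odd_Kt_minor V E t"
    and "bipartite_subdivision V E (KI_verts (2*t-2) t) (KI_edges (2*t-2) t)"
  shows "\<exists>X \<subseteq> V. card X \<le> 2*t-4 \<and>
           (\<exists>B F. is_block B F (V - X) (del_verts_E E X) \<and> bipartite B F \<and> card B \<ge> t+3)"
proof -
  obtain A C Q f where "subdivision V E A C Q f t"
    using subdivision_of_bipartite_subdivision[OF assms(1,2,4)] by blast
  then interpret subdivision V E A C Q f t .
  interpret port_graph V E A f using G AV by unfold_locales
  have no: "\<not> linkage P" for P using odd_minor_if_linkage assms(3) by blast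
  have "1 \<le> t - 1" using assms(1) by simp
  \<comment> \<open>For \<open>k = t - 1\<close> the bound \<open>2 * k - 2\<close> is the required
    \<open>2 * t - 4\<close>.\<close>
  from packing_breaking_paths[OF this] no
  obtain X where X: "X \<subseteq> V" "card X \<le> 2 * (t - 1) - 2" "\<forall>p. breaking V E A f p \<longrightarrow> set p \<inter> X \<noteq> {}"
    unfolding linkage_def by blast
  interpret hitting V E A C Q f t X using X by unfold_locales auto
  obtain B F where B: "is_block B F (V - X) (del_verts_E E X)" "bipartite B F" "B0 \<subseteq> B"
    using bipartite_block by blast
  have "finite B" using B(1) unfolding is_block_def subgraph_def graph_def by blast
  then have "t + 3 \<le> card B" using card_B0 card_mono[OF _ B(3)] by simp
  then show ?thesis using X(1) card_X B(1,2) by blast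
qed

end
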